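(* Let $d$ be a positive integer, let $q\geq 2$ and $w\geq 0$ be real numbers. For $t\in\mathbb{R}$ let $$\Phi_{d,q,w}(t):=\left(\sqrt{1+\frac{w}{q}}\cos(t)+\sqrt{\frac{(q-1)w}{q}}\sin(t)\right)^{d}+(q-1)\left(\sqrt{1+\frac{w}{q}}\cos(t)-\sqrt{\frac{w}{q(q-1)}}\sin(t)\right)^{d},$$ and let $\Phi_{d,q,w}:=\max_{t\in[-\pi,\pi]}\Phi_{d,q,w}(t)$. If $(G_n)_n$ is an essentially large girth sequence of $d$-regular graphs, then the limit $$\lim_{n\to\infty}\frac{1}{v(G_n)}\ln Z_{G_n}(q,w)$$ exists and equals $\ln\Phi_{d,q,w}$. The same conclusion holds with probability one for a sequence of random $d$-regular graphs.
   Context: Graphs are finite; $v(G)$ is the number of vertices of $G$. For a graph $G=(V,E)$ the partition function of the random cluster model is $$Z_G(q,w)=\sum_{A\subseteq E(G)}q^{k(A)}w^{|A|},$$ where $k(A)$ is the number of connected components of the graph $(V,A)$. For a graph $G$ and integer $g$ let $L(G,g)$ denote the number of cycles in $G$ of length at most $g-1$. A graph sequence $(G_n)_n$ is called essentially large girth if for every $g$ we have $\lim_{n\to\infty}L(G_n,g)/v(G_n)=0$. A sequence of random $d$-regular graphs means a sequence in which $G_n$ is a uniformly random $d$-regular graph on $n$ (labelled) vertices ($n$ running over the values with $nd$ even). *)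

theory Defs
  imports "HOL-Probability.Probability"
begin

text \<open>A graph is a pair of a vertex set and a set of two-element vertex sets.\<close>

type_synonym 'v graph = "'v set \<times> 'v set set"

abbreviation verts :: "'v graph \<Rightarrow> 'v set" where "verts \<equiv> fst"
abbreviation edges :: "'v graph \<Rightarrow> 'v set set" where "edges \<equiv> snd"

text \<open>The null graph is excluded: with \<open>x / 0 = 0\<close> it would have free energy \<open>0\<close>.\<close>

definition fin_graph :: "'v graph \<Rightarrow> bool" where
  "fin_graph G \<longleftrightarrow> finite (verts G) \<and> verts G \<noteq> {} \<and>
     (\<forall>e\<in>edges G. e \<subseteq> verts G \<and> card e = 2)"

definition regular_graph :: "nat \<Rightarrow> 'v graph \<Rightarrow> bool" where
  "regular_graph d G \<longleftrightarrow> fin_graph G \<and> (\<forall>v\<in>verts G. card {e \<in> edges G. v \<in> e} = d)"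

definition connected_in :: "'v set \<Rightarrow> 'v set set \<Rightarrow> ('v \<times> 'v) set" where
  "connected_in V A = {(x, y). x \<in> V \<and> y \<in> V \<and> (x, y) \<in> {(a, b). {a, b} \<in> A}\<^sup>*}"

definition num_components :: "'v set \<Rightarrow> 'v set set \<Rightarrow> nat" where
  "num_components V A = card (V // connected_in V A)"

definition rc_partition :: "'v graph \<Rightarrow> real \<Rightarrow> real \<Rightarrow> real" where
  "rc_partition G q w = (\<Sum>A\<in>Pow (edges G). q ^ num_components (verts G) A * w ^ card A)"

text \<open>A cycle is a subgraph, identified with its edge set, so that its rotations and
  reflections are counted once; its length is the number of its edges.\<close>

definition is_cycle :: "'v graph \<Rightarrow> 'v set set \<Rightarrow> bool" where
  "is_cycle G C \<longleftrightarrow> C \<subseteq> edges G \<and>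
     (\<exists>xs. 3 \<le> length xs \<and> distinct xs \<and>
       C = {{xs ! i, xs ! ((i + 1) mod length xs)} | i. i < length xs})"

definition num_short_cycles :: "'v graph \<Rightarrow> int \<Rightarrow> nat" where
  "num_short_cycles G g = card {C. is_cycle G C \<and> int (card C) \<le> g - 1}"

definition essentially_large_girth :: "(nat \<Rightarrow> 'v graph) \<Rightarrow> bool" where
  "essentially_large_girth G \<longleftrightarrow>
     (\<forall>g. (\<lambda>n. real (num_short_cycles (G n) g) / real (card (verts (G n)))) \<longlonglongrightarrow> 0)"

definition labelled_regular_graphs :: "nat \<Rightarrow> nat \<Rightarrow> nat graph set" where
  "labelled_regular_graphs d n = {G. regular_graph d G \<and> verts G = {..<n}}"

text \<open>The orders of \<open>d\<close>-regular graphs; for \<open>n \<le> d\<close> there is none, so no uniform one.\<close>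

definition admissible_orders :: "nat \<Rightarrow> nat set" where
  "admissible_orders d = {n. d < n \<and> even (n * d)}"

text \<open>Only the marginal laws are prescribed; the joint law of the sequence is arbitrary
  (independence in particular is allowed but not required). At other
  orders than the admissible ones \<open>G n\<close> is irrelevant.\<close>

definition random_regular_graphs ::
    "'a measure \<Rightarrow> nat \<Rightarrow> (nat \<Rightarrow> 'a \<Rightarrow> nat graph) \<Rightarrow> bool" where
  "random_regular_graphs M d G \<longleftrightarrow> prob_space M \<and>
     (\<forall>n\<in>admissible_orders d.
        G n \<in> measurable M (count_space (labelled_regular_graphs d n)) \<and>
        distr M (count_space (labelled_regular_graphs d n)) (G n) =
          uniform_count_measure (labelled_regular_graphs d n))"

definition Phi_fun :: "nat \<Rightarrow> real \<Rightarrow> real \<Rightarrow> real \<Rightarrow> real" where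
  "Phi_fun d q w t =
     (sqrt (1 + w / q) * cos t + sqrt ((q - 1) * w / q) * sin t) ^ d +
     (q - 1) * (sqrt (1 + w / q) * cos t - sqrt (w / (q * (q - 1))) * sin t) ^ d"

definition Phi_max :: "nat \<Rightarrow> real \<Rightarrow> real \<Rightarrow> real" where
  "Phi_max d q w = (SUP t\<in>{-pi..pi}. Phi_fun d q w t)"

text \<open>The supremum is a maximum.\<close>

lemma Phi_max_attained:
  "\<exists>t\<in>{-pi..pi}. Phi_max d q w = Phi_fun d q w t \<and>
     (\<forall>s\<in>{-pi..pi}. Phi_fun d q w s \<le> Phi_fun d q w t)"
proof -
  have "continuous_on {-pi..pi} (Phi_fun d q w)"
    unfolding Phi_fun_def by (intro continuous_intros)
  then obtain t where t: "t \<in> {-pi..pi}" "\<forall>s\<in>{-pi..pi}. Phi_fun d q w s \<le> Phi_fun d q w t"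
    using continuous_attains_sup[of "{-pi..pi}" "Phi_fun d q w"] by auto
  have "Phi_max d q w = Phi_fun d q w t"
    unfolding Phi_max_def by (rule cSup_eq_maximum) (use t in auto)
  with t show ?thesis by blast
qed

end

theory Submission
  imports Defs "HOL-Real_Asymp.Real_Asymp"
begin

text \<open>Merging the colours other than the first one turns the random cluster model into a two-spin
  model. In the expansion of both partition functions over edge sets \<open>A\<close>, the weights differ only by a
  factor between \<open>1\<close> and \<open>q\<close> for every component of \<open>A\<close> that contains a cycle, and there are at most
  \<open>L(G, g) + v(G) / g\<close> such components, so that the free energies agree in the limit.
  The interaction matrix of the two-spin model is a Gram matrix of two plane vectors. Expanding in the
  orthonormal basis given by a maximizer \<open>t\<close> of \<open>\<Phi>\<close> (where the coefficient of degree one vanishes)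
  yields a sum of nonnegative terms, one of which is \<open>\<Phi> ^ v(G)\<close>: this is the lower bound.
  For the upper bound, the two-spin model on a regular graph is a ferromagnetic Ising model whose minus
  spins have activity \<open>\<mu> \<le> 1\<close>. By Griffiths' inequality the density of minus spins is at most the one on
  a finite tree with free boundary, given by iterates of the cavity recursion. Integrating this
  bound from activity \<open>0\<close> up to \<open>\<mu>\<close> gives the Bethe functional at a fixed point, which is a value of \<open>\<Phi>\<close>.
  For random graphs, edge switchings show that the expected number of pairs of disjoint short cycles
  is bounded, so that the probability of having more than \<open>\<delta> n\<close> short cycles is summable.\<close>

section \<open>Correlation inequalities for the Ising model\<close>

text \<open>With \<open>x = q - 1\<close>, a component \<open>C\<close> gets the weight
  \<open>1 + x ^ (card C - e)\<close> in the two-spin expansion, \<open>e\<close> being its number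
  of edges, against \<open>1 + x = q\<close> in the random cluster model. On trees the two agree,
  and \<open>x \<ge> 1\<close> keeps the first below the second. Griffiths' inequality compares spin
  densities, not partition functions, so the density bound has to be integrated over the activity.
  The Bethe functional must keep pace at every activity. This follows from its monotonicity in the
  message below the fixed point, so that the fixed point never has to be differentiated in the
  activity. That monotonicity is available for activities below 1 only; hence the integral is a sum
  over a grid whose first step is estimated crudely. For random graphs, a bounded expected number of
  short cycles gives by Markov's inequality only a probability of order \<open>1 / n\<close>, which
  is not summable. Pairs of disjoint cycles give order \<open>1 / n^2\<close>, and summability
  suffices for Borel-Cantelli under an arbitrary joint law.\<close>

definition chi :: "'v set \<Rightarrow> 'v set \<Rightarrow> real" where
  "chi A S = (\<Prod>v\<in>S. if v \<in> A then - 1 else 1)"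

lemma chi_alt:
  assumes "finite S" shows "chi A S = (- 1) ^ card (A \<inter> S)"
proof -
  have "chi A S = (\<Prod>v\<in>S \<inter> A. - 1)"
    unfolding chi_def using assms by (subst prod.inter_restrict) auto
  then show ?thesis by (simp add: Int_commute)
qed

lemma chi_square:
  assumes "finite S" shows "chi A S * chi A S = 1"
  by (simp add: chi_alt[OF assms] flip: power_mult_distrib)

lemma chi_cases:
  assumes "finite S" shows "chi A S = 1 \<or> chi A S = - 1"
  using chi_square[OF assms] by (simp add: square_eq_1_iff)

text \<open>With \<open>S\<close> the set of minus spins, \<open>chi A S\<close> is the product of
  the spins over \<open>A\<close>. It depends on the parity of \<open>card (A \<inter> S)\<close>
  only, so it is a character in either argument: the left law multiplies observables, the right law
  serves the substitution in \<open>griffiths_second\<close>.\<close>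

lemma chi_sym_diff_left:
  assumes "finite S" shows "chi (sym_diff A B) S = chi A S * chi B S"
  unfolding chi_def using assms
  by (subst prod.distrib[symmetric]) (auto intro!: prod.cong)

lemma chi_sym_diff_right:
  assumes "finite S" "finite T" shows "chi A (sym_diff S T) = chi A S * chi A T"
proof -
  have *: "chi A S = chi A (S - T) * chi A (S \<inter> T)" "chi A T = chi A (T - S) * chi A (S \<inter> T)"
    unfolding chi_def using assms
    by (subst prod.union_disjoint[symmetric]; force intro!: prod.cong)+
  have "chi A (sym_diff S T) = chi A (S - T) * chi A (T - S)"
    unfolding chi_def using assms by (subst prod.union_disjoint) auto
  with * chi_square[of "S \<inter> T" A] assms show ?thesis
    by (simp add: algebra_simps)
qed

lemma sum_Pow_prod:
  fixes f g :: "'v \<Rightarrow> real"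
  assumes "finite V"
  shows "(\<Sum>S\<in>Pow V. (\<Prod>v\<in>V. if v \<in> S then f v else g v)) = (\<Prod>v\<in>V. f v + g v)"
proof -
  have "(\<Prod>v\<in>V. if v \<in> S then f v else g v) = prod f S * prod g (V - S)" if "S \<in> Pow V" for S
  proof -
    have "(\<Prod>v\<in>V. if v \<in> S then f v else g v)
      = (\<Prod>v\<in>S. if v \<in> S then f v else g v) * (\<Prod>v\<in>V - S. if v \<in> S then f v else g v)"
      using prod.subset_diff[of S V "\<lambda>v. if v \<in> S then f v else g v"] that assms by (simp add: mult.commute)
    then show ?thesis by simp
  qed
  then show ?thesis by (simp add: prod_add[OF assms])
qed

text \<open>The sum factorizes over the vertices, with factor \<open>0\<close> at a vertex of
  \<open>A\<close> and \<open>2\<close> elsewhere.\<close>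

lemma sum_chi_nonneg:
  assumes "finite V"
  shows "(\<Sum>S\<in>Pow V. chi A S) \<ge> 0"
proof -
  have "chi A S = (\<Prod>v\<in>V. if v \<in> S then (if v \<in> A then - 1 else 1) else 1)" if "S \<in> Pow V" for S
    unfolding chi_def using that assms by (intro prod.mono_neutral_cong_left) auto
  then have "(\<Sum>S\<in>Pow V. chi A S) = (\<Prod>v\<in>V. (if v \<in> A then - 1 else 1) + 1)"
    by (subst sum_Pow_prod[OF assms, symmetric]) simp
  also have "\<dots> \<ge> 0" by (intro prod_nonneg) auto
  finally show ?thesis .
qed

text \<open>Multiplying out one factor at a time turns the weight into a nonnegative combination of
  characters. Each factor may replace \<open>A\<close> by \<open>sym_diff A B\<close>, hence
  \<open>A\<close> is arbitrary in the induction.\<close>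

lemma griffiths_first:
  fixes a b :: "'v set \<Rightarrow> real"
  assumes V: "finite V" and I: "finite I" "\<And>B. B \<in> I \<Longrightarrow> a B \<ge> 0 \<and> b B \<ge> 0"
  shows "0 \<le> (\<Sum>S\<in>Pow V. chi A S * (\<Prod>B\<in>I. a B + b B * chi B S))"
  using I
proof (induction I arbitrary: A rule: finite_induct)
  case empty
  then show ?case using sum_chi_nonneg[OF V] by simp
next
  case (insert B I)
  let ?P = "\<lambda>S. \<Prod>B\<in>I. a B + b B * chi B S"
  have "chi A S * (\<Prod>B\<in>insert B I. a B + b B * chi B S)
      = a B * (chi A S * ?P S) + b B * (chi (sym_diff A B) S * ?P S)" if "S \<in> Pow V" for S
  proof -
    have "finite S" using that V finite_subset by auto
    with insert.hyps show ?thesis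
      unfolding chi_sym_diff_left[OF \<open>finite S\<close>] by (simp add: algebra_simps)
  qed
  then have "(\<Sum>S\<in>Pow V. chi A S * (\<Prod>B\<in>insert B I. a B + b B * chi B S))
    = (\<Sum>S\<in>Pow V. a B * (chi A S * ?P S) + b B * (chi (sym_diff A B) S * ?P S))"
    by (rule sum.cong[OF refl])
  also have "\<dots> = a B * (\<Sum>S\<in>Pow V. chi A S * ?P S) + b B * (\<Sum>S\<in>Pow V. chi (sym_diff A B) S * ?P S)"
    by (simp add: sum.distrib sum_distrib_left)
  also have "\<dots> \<ge> 0"
    using insert.IH[of A] insert.IH[of "sym_diff A B"] insert.prems
    by (intro add_nonneg_nonneg mult_nonneg_nonneg) auto
  finally show ?case .
qed

text \<open>The duplicate-variables trick: in a pair \<open>(S, T)\<close> of configurations, substitute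
  \<open>T = sym_diff S Q\<close>; for fixed \<open>Q\<close> the weights are again of the form required by the first inequality.\<close>

lemma griffiths_second:
  fixes a b :: "'v set \<Rightarrow> real"
  assumes V: "finite V" and I: "finite I" "\<And>B. B \<in> I \<Longrightarrow> a B \<ge> b B \<and> b B \<ge> 0"
  defines "W \<equiv> \<lambda>S. \<Prod>B\<in>I. a B + b B * chi B S"
  shows "(\<Sum>S\<in>Pow V. chi A S * W S) * (\<Sum>S\<in>Pow V. chi B S * W S)
       \<le> (\<Sum>S\<in>Pow V. chi A S * chi B S * W S) * (\<Sum>S\<in>Pow V. W S)"
proof -
  have fin: "finite S" if "S \<in> Pow V" for S using that V finite_subset by auto
  have inner: "0 \<le> (\<Sum>S\<in>Pow V. chi A S * (chi B S - chi B (sym_diff S Q)) * (W S * W (sym_diff S Q)))"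
    if Q: "Q \<in> Pow V" for Q
  proof -
    \<comment> \<open>For \<open>x = chi C S\<close> the two factors multiply to
      \<open>(a + b x)^2\<close> or to \<open>(a + b x) (a - b x)\<close>, depending on
      \<open>chi C Q\<close>. By \<open>x * x = 1\<close> both are affine in \<open>x\<close>, and
      \<open>a \<ge> b \<ge> 0\<close> makes the coefficients nonnegative.\<close>
    define a' where "a' C = (if chi C Q = 1 then a C * a C + b C * b C else a C * a C - b C * b C)" for C
    define b' where "b' C = (if chi C Q = 1 then 2 * a C * b C else 0)" for C
    have "W S * W (sym_diff S Q) = (\<Prod>C\<in>I. a' C + b' C * chi C S)" if S: "S \<in> Pow V" for S
    proof -
      have "(a C + b C * chi C S) * (a C + b C * chi C (sym_diff S Q)) = a' C + b' C * chi C S" for C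
      proof -
        have 1: "chi C (sym_diff S Q) = chi C S * chi C Q"
          by (rule chi_sym_diff_right) (use S Q fin in auto)
        have 2: "chi C S * chi C S = 1" by (rule chi_square) (use S fin in auto)
        have 3: "chi C Q = 1 \<or> chi C Q = - 1" by (rule chi_cases) (use Q fin in auto)
        have 4: "(a C + b C * x) * (a C + b C * x) = a C * a C + b C * b C * (x * x) + 2 * a C * b C * x"
          "(a C + b C * x) * (a C - b C * x) = a C * a C - b C * b C * (x * x)" for x
          by (simp_all add: algebra_simps)
        show ?thesis
          using 3 unfolding 1 a'_def b'_def
          by (elim disjE) (use 4[of "chi C S"] 2 in simp_all)
      qed
      then show ?thesis unfolding W_def by (subst prod.distrib[symmetric]) simp
    qed
    \<comment> \<open>The antisymmetrized observable is a single character times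
      \<open>1 - chi B Q\<close>, a constant \<open>0\<close> or \<open>2\<close> for fixed
      \<open>Q\<close>.\<close>
    moreover have "chi A S * (chi B S - chi B (sym_diff S Q)) = (1 - chi B Q) * chi (sym_diff A B) S"
      if S: "S \<in> Pow V" for S
    proof -
      have 1: "chi B (sym_diff S Q) = chi B S * chi B Q"
        by (rule chi_sym_diff_right) (use S Q fin in auto)
      have 2: "chi (sym_diff A B) S = chi A S * chi B S"
        by (rule chi_sym_diff_left) (use S fin in auto)
      show ?thesis unfolding 1 2 by (simp add: algebra_simps)
    qed
    ultimately have "(\<Sum>S\<in>Pow V. chi A S * (chi B S - chi B (sym_diff S Q)) * (W S * W (sym_diff S Q)))
      = (\<Sum>S\<in>Pow V. (1 - chi B Q) * chi (sym_diff A B) S * (\<Prod>C\<in>I. a' C + b' C * chi C S))"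
      by (intro sum.cong) auto
    also have "\<dots> = (1 - chi B Q) * (\<Sum>S\<in>Pow V. chi (sym_diff A B) S * (\<Prod>C\<in>I. a' C + b' C * chi C S))"
      by (simp add: sum_distrib_left mult.assoc)
    also have "\<dots> \<ge> 0"
    proof (rule mult_nonneg_nonneg)
      show "0 \<le> 1 - chi B Q" using chi_cases[OF fin[OF Q], of B] by auto
      show "0 \<le> (\<Sum>S\<in>Pow V. chi (sym_diff A B) S * (\<Prod>C\<in>I. a' C + b' C * chi C S))"
      proof (rule griffiths_first[OF V I(1)])
        fix C assume "C \<in> I"
        then have "a C \<ge> b C" "b C \<ge> 0" using I by auto
        then show "0 \<le> a' C \<and> 0 \<le> b' C" unfolding a'_def b'_def by (auto intro: mult_mono)
      qed
    qed
    finally show ?thesis .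
  qed
  have bij: "(\<Sum>Q\<in>Pow V. g (sym_diff S Q)) = (\<Sum>T\<in>Pow V. g T)" if "S \<in> Pow V" for S and g :: "'v set \<Rightarrow> real"
    by (rule sum.reindex_bij_witness[of _ "\<lambda>T. sym_diff S T" "\<lambda>T. sym_diff S T"]) (use that in auto)
  have "0 \<le> (\<Sum>Q\<in>Pow V. \<Sum>S\<in>Pow V. chi A S * (chi B S - chi B (sym_diff S Q)) * (W S * W (sym_diff S Q)))"
    by (intro sum_nonneg inner)
  also have "\<dots> = (\<Sum>S\<in>Pow V. \<Sum>Q\<in>Pow V. chi A S * (chi B S - chi B (sym_diff S Q)) * (W S * W (sym_diff S Q)))"
    by (rule sum.swap)
  also have "\<dots> = (\<Sum>S\<in>Pow V. \<Sum>T\<in>Pow V. chi A S * (chi B S - chi B T) * (W S * W T))"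
  proof (rule sum.cong)
    fix S assume "S \<in> Pow V"
    show "(\<Sum>Q\<in>Pow V. chi A S * (chi B S - chi B (sym_diff S Q)) * (W S * W (sym_diff S Q))) =
       (\<Sum>T\<in>Pow V. chi A S * (chi B S - chi B T) * (W S * W T))"
      using bij[OF \<open>S \<in> Pow V\<close>, of "\<lambda>T. chi A S * (chi B S - chi B T) * (W S * W T)"] .
  qed simp
  also have "\<dots> = (\<Sum>S\<in>Pow V. chi A S * chi B S * W S) * (\<Sum>S\<in>Pow V. W S)
      - (\<Sum>S\<in>Pow V. chi A S * W S) * (\<Sum>S\<in>Pow V. chi B S * W S)"
    unfolding sum_product sum_subtractf[symmetric] by (intro sum.cong) (simp_all add: algebra_simps)
  finally show ?thesis by simp
qed

text \<open>A new factor at \<open>e\<close> moves the mean of \<open>chi A\<close> in the direction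
  of its covariance with \<open>chi e\<close>, which is nonnegative by the second inequality; the
  factors of \<open>J - I\<close> are added one by one. The means are cross-multiplied because
  \<open>a = b\<close> is allowed and normalizations may vanish.\<close>

lemma griffiths_monotone:
  fixes a b :: "'v set \<Rightarrow> real"
  assumes V: "finite V" and J: "finite J" "\<And>B. B \<in> J \<Longrightarrow> a B \<ge> b B \<and> b B \<ge> 0" and IJ: "I \<subseteq> J"
  defines "W \<equiv> \<lambda>I S. \<Prod>B\<in>I. a B + b B * chi B S"
  shows "(\<Sum>S\<in>Pow V. chi A S * W I S) * (\<Sum>S\<in>Pow V. W J S)
       \<le> (\<Sum>S\<in>Pow V. chi A S * W J S) * (\<Sum>S\<in>Pow V. W I S)"
proof -
  have "finite (J - I)" using J by simp
  have W0: "W K S \<ge> 0" if "K \<subseteq> J" "S \<in> Pow V" for K S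
    unfolding W_def
  proof (rule prod_nonneg)
    fix B assume "B \<in> K"
    have "finite S" using that V finite_subset by auto
    from chi_cases[OF this, of B] J(2)[of B] \<open>B \<in> K\<close> that show "0 \<le> a B + b B * chi B S" by auto
  qed
  have "\<And>D. finite D \<Longrightarrow> D \<subseteq> J - I \<Longrightarrow>
      (\<Sum>S\<in>Pow V. chi A S * W I S) * (\<Sum>S\<in>Pow V. W (I \<union> D) S)
       \<le> (\<Sum>S\<in>Pow V. chi A S * W (I \<union> D) S) * (\<Sum>S\<in>Pow V. W I S)"
  proof -
    fix D assume "finite D" "D \<subseteq> J - I"
    then show "?thesis D"
    proof (induction D rule: finite_induct)
      case empty then show ?case by (simp add: mult.commute)
    next
      case (insert e D)
      let ?K = "I \<union> D"
      let ?X = "\<lambda>K. \<Sum>S\<in>Pow V. W K S" and ?Y = "\<lambda>K. \<Sum>S\<in>Pow V. chi A S * W K S"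
      have K: "?K \<subseteq> J" "finite ?K" "e \<notin> ?K" "e \<in> J" using insert IJ J finite_subset by auto
      have We: "W (I \<union> insert e D) S = (a e + b e * chi e S) * W ?K S" for S
        unfolding W_def using K by simp
      have g2: "?Y ?K * (\<Sum>S\<in>Pow V. chi e S * W ?K S) \<le> (\<Sum>S\<in>Pow V. chi A S * chi e S * W ?K S) * ?X ?K"
        unfolding W_def by (rule griffiths_second) (use V K J in auto)
      have X: "?X (I \<union> insert e D) = a e * ?X ?K + b e * (\<Sum>S\<in>Pow V. chi e S * W ?K S)"
        unfolding We by (simp add: algebra_simps sum.distrib sum_distrib_left)
      have Y: "?Y (I \<union> insert e D) = a e * ?Y ?K + b e * (\<Sum>S\<in>Pow V. chi A S * chi e S * W ?K S)"
        unfolding We by (simp add: algebra_simps sum.distrib sum_distrib_left)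
      have step: "?Y ?K * ?X (I \<union> insert e D) \<le> ?Y (I \<union> insert e D) * ?X ?K"
        unfolding X Y using mult_left_mono[OF g2, of "b e"] J(2)[OF \<open>e \<in> J\<close>] by (simp add: algebra_simps)
      have IH: "?Y I * ?X ?K \<le> ?Y ?K * ?X I" using insert by auto
      have nn: "?X I \<ge> 0" "?X ?K \<ge> 0" "?X (I \<union> insert e D) \<ge> 0"
        using IJ K insert.prems by (auto intro!: sum_nonneg W0)
      show ?case
      proof (cases "?X ?K = 0")
        case True
        then have "W ?K S = 0" if "S \<in> Pow V" for S
          using sum_nonneg_eq_0_iff[of "Pow V" "W ?K"] W0[OF K(1)] V that by auto
        then have "W (I \<union> insert e D) S = 0" if "S \<in> Pow V" for S using that We by simp
        then show ?thesis by simp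
      next
        case False
        have "?Y I * ?X (I \<union> insert e D) * ?X ?K \<le> ?Y (I \<union> insert e D) * ?X I * ?X ?K"
          using mult_right_mono[OF IH nn(3)] mult_right_mono[OF step nn(1)] by (simp add: algebra_simps)
        with False nn(2) show ?thesis by (simp add: mult_le_cancel_right)
      qed
    qed
  qed
  from this[of "J - I"] \<open>finite (J - I)\<close> IJ show ?thesis
    by (simp add: Un_absorb1)
qed

section \<open>Balls in graphs\<close>

abbreviation "edges_in A X \<equiv> {e \<in> A. e \<subseteq> X}"
abbreviation "edges_at A v \<equiv> {e \<in> A. v \<in> e}"

primrec ball_in :: "'v set set \<Rightarrow> 'v \<Rightarrow> nat \<Rightarrow> 'v set" where
  "ball_in E v 0 = {v}"
| "ball_in E v (Suc k) = ball_in E v k \<union> {y. \<exists>x\<in>ball_in E v k. {x, y} \<in> E}"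

lemma ball_in_mono: "j \<le> k \<Longrightarrow> ball_in E v j \<subseteq> ball_in E v k"
  by (induction k) (auto simp: le_Suc_eq)

lemma ball_in_self: "v \<in> ball_in E v k"
  using ball_in_mono[of 0 k E v] by auto

lemma fin_graph_edge:
  assumes "fin_graph (V, E)" "{x, y} \<in> E"
  shows "x \<in> V" "y \<in> V" "x \<noteq> y"
proof -
  have "{x, y} \<subseteq> V" "card {x, y} = 2" using assms by (auto simp: fin_graph_def)
  then show "x \<in> V" "y \<in> V" "x \<noteq> y" by auto
qed

lemma fin_graph_edgeE:
  assumes "fin_graph (V, E)" "e \<in> E"
  obtains x y where "e = {x, y}" "x \<noteq> y" "x \<in> V" "y \<in> V"
proof -
  have "e \<subseteq> V" "card e = 2" using assms by (auto simp: fin_graph_def)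
  then show ?thesis using that by (auto simp: card_2_iff)
qed

lemma fin_graph_finite_edges: "fin_graph (V, E) \<Longrightarrow> finite E"
  by (rule finite_subset[of E "Pow V"]) (auto simp: fin_graph_def)

lemma ball_in_subset:
  assumes "fin_graph (V, E)" "v \<in> V" shows "ball_in E v k \<subseteq> V"
  using assms fin_graph_edge[OF assms(1)] by (induction k) auto

lemma finite_ball_in:
  assumes "fin_graph (V, E)" "v \<in> V" shows "finite (ball_in E v k)"
  using ball_in_subset[OF assms] assms(1) finite_subset by (fastforce simp: fin_graph_def)

lemma card_nbrs:
  assumes "fin_graph (V, E)"
  shows "card {y. {x, y} \<in> E} = card (edges_at E x)"
proof -
  have "bij_betw (\<lambda>y. {x, y}) {y. {x, y} \<in> E} (edges_at E x)"
    unfolding bij_betw_def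
  proof
    show "inj_on (\<lambda>y. {x, y}) {y. {x, y} \<in> E}" by (auto simp: inj_on_def doubleton_eq_iff)
    have "\<exists>y. e = {x, y}" if "e \<in> E" "x \<in> e" for e
      using fin_graph_edgeE[OF assms that(1)] that(2) by (metis insertE insert_commute singletonD)
    then show "(\<lambda>y. {x, y}) ` {y. {x, y} \<in> E} = edges_at E x" by (auto simp: image_iff)
  qed
  then show ?thesis by (rule bij_betw_same_card)
qed

lemma regular_card_nbrs:
  assumes "regular_graph d (V, E)" "x \<in> V" shows "card {y. {x, y} \<in> E} = d"
  using assms card_nbrs[of V E x] by (simp add: regular_graph_def)

lemma finite_nbrs:
  assumes "fin_graph (V, E)" shows "finite {y. {x, y} \<in> E}"
  by (rule finite_subset[of _ V]) (use assms fin_graph_edge[OF assms] in \<open>auto simp: fin_graph_def\<close>)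

lemma card_ball_in:
  assumes "regular_graph d (V, E)" "v \<in> V" shows "card (ball_in E v k) \<le> (d + 1) ^ k"
proof (induction k)
  case (Suc k)
  have G: "fin_graph (V, E)" using assms by (simp add: regular_graph_def)
  have sub: "ball_in E v k \<subseteq> V" using ball_in_subset[OF G assms(2)] .
  have fin: "finite (ball_in E v k)" using sub G finite_subset by (auto simp: fin_graph_def)
  have "card (ball_in E v (Suc k)) \<le> card (ball_in E v k) + card (\<Union>x\<in>ball_in E v k. {y. {x, y} \<in> E})"
    by (simp, rule order.trans[OF _ card_Un_le], rule eq_refl, rule arg_cong[of _ _ card]) auto
  also have "card (\<Union>x\<in>ball_in E v k. {y. {x, y} \<in> E}) \<le> (\<Sum>x\<in>ball_in E v k. card {y. {x, y} \<in> E})"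
    by (rule card_UN_le[OF fin])
  also have "\<dots> = (\<Sum>x\<in>ball_in E v k. d)"
    using sub regular_card_nbrs[OF assms(1)] by (intro sum.cong) auto
  finally have "card (ball_in E v (Suc k)) \<le> (d + 1) * card (ball_in E v k)" by (simp add: mult.commute)
  also have "\<dots> \<le> (d + 1) * (d + 1) ^ k" using Suc by (intro mult_left_mono) auto
  finally show ?case by simp
qed simp

section \<open>The Ising model on a tree-like neighbourhood\<close>

text \<open>A configuration is the set of its minus spins; \<open>m v\<close> is the activity of a minus spin at \<open>v\<close>,
  and \<open>\<kappa>\<close> is the weight of an edge with two different spins.\<close>

definition ising_wt :: "'v set set \<Rightarrow> ('v \<Rightarrow> real) \<Rightarrow> real \<Rightarrow> 'v set \<Rightarrow> real" where
  "ising_wt E m \<kappa> S = (\<Prod>v\<in>S. m v) * \<kappa> ^ card {e \<in> E. card (e \<inter> S) = 1}"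

abbreviation "ising_hom E \<kappa> \<mu> \<equiv> ising_wt E (\<lambda>_. \<mu>) \<kappa>"

section \<open>Deleting edges favours minus spins\<close>

lemma chi_two:
  assumes "card e = 2" "finite S"
  shows "chi e S = (if card (e \<inter> S) = 1 then - 1 else 1)"
proof -
  have "finite e" using assms card.infinite by fastforce
  then have "card (e \<inter> S) \<le> 2" using card_mono[of e "e \<inter> S"] assms by auto
  then have "card (e \<inter> S) = 0 \<or> card (e \<inter> S) = 1 \<or> card (e \<inter> S) = 2" by auto
  then show ?thesis unfolding chi_alt[OF assms(2)] by auto
qed

lemma card_doubleton_Int:
  assumes "x \<noteq> y" shows "card ({x, y} \<inter> S) = 1 \<longleftrightarrow> (x \<in> S) \<noteq> (y \<in> S)"
  using assms by (cases "x \<in> S"; cases "y \<in> S") (auto simp: Int_insert_left)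

lemma prod_if_power:
  fixes \<kappa> :: real
  assumes "finite A" shows "(\<Prod>x\<in>A. if P x then \<kappa> else 1) = \<kappa> ^ card {x \<in> A. P x}"
  using assms by (simp add: prod.If_cases Int_def)

text \<open>A factor that is \<open>1\<close> or \<open>c\<close> according to a sign equals
  \<open>(1 + c) / 2 + (1 - c) / 2 * chi B S\<close>, which for \<open>0 \<le> c \<le> 1\<close> has
  the form required by Griffiths' inequalities. Singletons carry the activities and edges the
  couplings; \<open>c\<close> tells them apart by their size.\<close>

lemma ising_wt_prod:
  fixes \<kappa> \<mu> :: real
  assumes G: "fin_graph (V, E)" and S: "S \<subseteq> V"
  defines "c \<equiv> \<lambda>B. if card B = 2 then \<kappa> else \<mu>"
  shows "ising_hom E \<kappa> \<mu> S
    = (\<Prod>B\<in>(\<lambda>v. {v}) ` V \<union> E. (1 + c B) / 2 + (1 - c B) / 2 * chi B S)"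
proof -
  have fin: "finite V" "finite E" "finite S"
    using G S fin_graph_finite_edges[OF G] finite_subset by (auto simp: fin_graph_def)
  have "(\<lambda>v. {v}) ` V \<inter> E = {}" using G by (auto simp: fin_graph_def)
  then have "(\<Prod>B\<in>(\<lambda>v. {v}) ` V \<union> E. (1 + c B) / 2 + (1 - c B) / 2 * chi B S)
    = (\<Prod>B\<in>(\<lambda>v. {v}) ` V. (1 + c B) / 2 + (1 - c B) / 2 * chi B S)
      * (\<Prod>B\<in>E. (1 + c B) / 2 + (1 - c B) / 2 * chi B S)"
    using fin by (intro prod.union_disjoint) auto
  also have "(\<Prod>B\<in>(\<lambda>v. {v}) ` V. (1 + c B) / 2 + (1 - c B) / 2 * chi B S)
    = (\<Prod>v\<in>V. (1 + \<mu>) / 2 + (1 - \<mu>) / 2 * chi {v} S)"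
    by (subst prod.reindex) (auto simp: c_def)
  also have "\<dots> = (\<Prod>v\<in>V. if v \<in> S then \<mu> else 1)"
    by (intro prod.cong) (auto simp: chi_alt[OF fin(3)] field_simps Int_insert_left)
  also have "\<dots> = \<mu> ^ card S"
    using S by (simp add: prod_if_power[OF fin(1)] Collect_conj_eq Int_absorb1 inf.absorb2)
  also have "(\<Prod>B\<in>E. (1 + c B) / 2 + (1 - c B) / 2 * chi B S)
    = (\<Prod>B\<in>E. if card (B \<inter> S) = 1 then \<kappa> else 1)"
  proof (rule prod.cong[OF refl])
    fix B assume "B \<in> E"
    then have "card B = 2" using G by (auto simp: fin_graph_def)
    then show "(1 + c B) / 2 + (1 - c B) / 2 * chi B S = (if card (B \<inter> S) = 1 then \<kappa> else 1)"
      using chi_two[of B S] fin by (auto simp: c_def field_simps)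
  qed
  also have "\<dots> = \<kappa> ^ card {e \<in> E. card (e \<inter> S) = 1}" by (rule prod_if_power[OF fin(2)])
  finally show ?thesis by (simp add: ising_wt_def)
qed

text \<open>\<open>M\<close> and \<open>P\<close> are the unnormalized weights of a minus and of a
  plus spin at \<open>v\<close>, so the mean spin is \<open>(P - M) / (P + M)\<close>. Activities at
  most 1 are fields towards plus; hence \<open>griffiths_monotone\<close> applies and deleting edges
  lowers the mean spin.\<close>

lemma ising_delete_edges:
  fixes \<kappa> \<mu> :: real
  assumes G: "fin_graph (V, E)" and E': "E' \<subseteq> E" and v: "v \<in> V"
    and \<mu>: "0 \<le> \<mu>" "\<mu> \<le> 1" and \<kappa>: "0 \<le> \<kappa>" "\<kappa> \<le> 1"
  defines "M \<equiv> \<lambda>E. \<Sum>S\<in>{S \<in> Pow V. v \<in> S}. ising_hom E \<kappa> \<mu> S"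
  defines "P \<equiv> \<lambda>E. \<Sum>S\<in>{S \<in> Pow V. v \<notin> S}. ising_hom E \<kappa> \<mu> S"
  shows "M E * P E' \<le> M E' * P E"
proof -
  have fV: "finite V" using G by (simp add: fin_graph_def)
  have G': "fin_graph (V, E')" using G E' by (auto simp: fin_graph_def)
  define c where "c = (\<lambda>B::'a set. if card B = 2 then \<kappa> else \<mu>)"
  define W where "W = (\<lambda>I S. \<Prod>B\<in>I. (1 + c B) / 2 + (1 - c B) / 2 * chi B S)"
  define I where "I = (\<lambda>E. (\<lambda>v. {v}) ` V \<union> E)"
  have W: "W (I F) S = ising_hom F \<kappa> \<mu> S" if "fin_graph (V, F)" "S \<in> Pow V" for F S
    unfolding W_def I_def c_def using ising_wt_prod[OF that(1)] that by simp
  have gm: "(\<Sum>S\<in>Pow V. chi {v} S * W (I E') S) * (\<Sum>S\<in>Pow V. W (I E) S)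
       \<le> (\<Sum>S\<in>Pow V. chi {v} S * W (I E) S) * (\<Sum>S\<in>Pow V. W (I E') S)"
    unfolding W_def
    by (rule griffiths_monotone[OF fV])
      (use fin_graph_finite_edges[OF G] fV E' \<mu> \<kappa> in \<open>auto simp: I_def c_def\<close>)
  have split: "(\<Sum>S\<in>Pow V. f S) = (\<Sum>S\<in>{S \<in> Pow V. v \<in> S}. f S) + (\<Sum>S\<in>{S \<in> Pow V. v \<notin> S}. f S)" for f :: "'a set \<Rightarrow> real"
    using fV by (subst sum.union_disjoint[symmetric]) (auto intro!: sum.cong)
  have chi: "chi {v} S = (if v \<in> S then - 1 else 1)" if "S \<in> Pow V" for S
    using that fV finite_subset by (subst chi_alt) (auto simp: Int_insert_left)
  have X: "(\<Sum>S\<in>Pow V. W (I F) S) = M F + P F" if "fin_graph (V, F)" for F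
    unfolding split M_def P_def using W[OF that] by (intro arg_cong2[of _ _ _ _ "(+)"] sum.cong) auto
  have Y: "(\<Sum>S\<in>Pow V. chi {v} S * W (I F) S) = - M F + P F" if "fin_graph (V, F)" for F
    unfolding split M_def P_def sum_negf[symmetric] using W[OF that] chi
    by (intro arg_cong2[of _ _ _ _ "(+)"] sum.cong) auto
  from gm show ?thesis unfolding X[OF G] X[OF G'] Y[OF G] Y[OF G'] by (simp add: algebra_simps)
qed

section \<open>Summing out the spins of outer vertices\<close>

lemma sum_Pow_Un:
  fixes g :: "'v set \<Rightarrow> real"
  assumes "finite B" "finite L" "B \<inter> L = {}"
  shows "(\<Sum>S\<in>Pow (B \<union> L). g S) = (\<Sum>S\<in>Pow B. \<Sum>T\<in>Pow L. g (S \<union> T))"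
proof -
  have "(\<Sum>S\<in>Pow B. \<Sum>T\<in>Pow L. g (S \<union> T)) = (\<Sum>(S, T)\<in>Pow B \<times> Pow L. g (S \<union> T))"
    using assms by (intro sum.cartesian_product) 
  also have "\<dots> = (\<Sum>S\<in>Pow (B \<union> L). g S)"
    by (rule sum.reindex_bij_witness[of _ "\<lambda>S. (S \<inter> B, S \<inter> L)" "\<lambda>(S, T). S \<union> T"])
      (use assms(3) in \<open>auto simp: Int_Un_distrib\<close>)
  finally show ?thesis by simp
qed

text \<open>Taking \<open>Q\<close> as the identity and as \<open>Not\<close> treats the minus and
  the plus sum at \<open>v\<close> by the same argument.\<close>

lemma sum_Pow_Un_restrict:
  fixes g :: "'v set \<Rightarrow> real"
  assumes "finite B" "finite L" "B \<inter> L = {}" "v \<notin> L"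
  shows "(\<Sum>S\<in>{S \<in> Pow (B \<union> L). Q (v \<in> S)}. g S)
    = (\<Sum>S\<in>{S \<in> Pow B. Q (v \<in> S)}. \<Sum>T\<in>Pow L. g (S \<union> T))"
proof -
  have "(\<Sum>S\<in>{S \<in> Pow (B \<union> L). Q (v \<in> S)}. g S) = (\<Sum>S\<in>Pow (B \<union> L). if Q (v \<in> S) then g S else 0)"
    using assms by (intro sum.mono_neutral_cong_left) auto
  also have "\<dots> = (\<Sum>S\<in>Pow B. \<Sum>T\<in>Pow L. if Q (v \<in> S \<union> T) then g (S \<union> T) else 0)"
    by (rule sum_Pow_Un) (use assms in auto)
  also have "\<dots> = (\<Sum>S\<in>Pow B. \<Sum>T\<in>Pow L. if Q (v \<in> S) then g (S \<union> T) else 0)"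
    using assms(4) by (intro sum.cong refl if_cong arg_cong[of _ _ Q]) auto
  also have "\<dots> = (\<Sum>S\<in>Pow B. if Q (v \<in> S) then (\<Sum>T\<in>Pow L. g (S \<union> T)) else 0)"
    by (intro sum.cong) auto
  also have "\<dots> = (\<Sum>S\<in>{S \<in> Pow B. Q (v \<in> S)}. \<Sum>T\<in>Pow L. g (S \<union> T))"
    using assms by (intro sum.mono_neutral_cong_right) auto
  finally show ?thesis .
qed

text \<open>A leaf interacts with its parent only; summing over its two spins leaves
  \<open>\<kappa> + m x\<close> at a minus parent and \<open>1 + \<kappa> * m x\<close> at a plus
  parent.\<close>

lemma ising_attach_leaves:
  assumes fin: "finite B" "finite L" "finite E0" and disj: "B \<inter> L = {}"
    and par: "\<And>x. x \<in> L \<Longrightarrow> par x \<in> B" and E0: "\<And>e. e \<in> E0 \<Longrightarrow> e \<subseteq> B" and S: "S \<subseteq> B"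
  shows "(\<Sum>T\<in>Pow L. ising_wt (E0 \<union> (\<lambda>x. {x, par x}) ` L) m \<kappa> (S \<union> T))
    = ising_wt E0 m \<kappa> S * (\<Prod>x\<in>L. if par x \<in> S then \<kappa> + m x else 1 + \<kappa> * m x)"
proof -
  have "ising_wt (E0 \<union> (\<lambda>x. {x, par x}) ` L) m \<kappa> (S \<union> T)
    = ising_wt E0 m \<kappa> S * (\<Prod>x\<in>L. if x \<in> T then m x * (if par x \<in> S then 1 else \<kappa>) else (if par x \<in> S then \<kappa> else 1))"
    if T: "T \<in> Pow L" for T
  proof -
    have fS: "finite S" "finite T" using S T fin finite_subset by auto
    have ST: "S \<inter> T = {}" using S T disj by auto
    have inj: "inj_on (\<lambda>x. {x, par x}) L"
      using par disj by (auto simp: inj_on_def doubleton_eq_iff)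
    have "{e \<in> E0 \<union> (\<lambda>x. {x, par x}) ` L. card (e \<inter> (S \<union> T)) = 1}
      = {e \<in> E0. card (e \<inter> S) = 1} \<union> (\<lambda>x. {x, par x}) ` {x \<in> L. (x \<in> T) \<noteq> (par x \<in> S)}"
    proof -
      have 1: "e \<inter> (S \<union> T) = e \<inter> S" if "e \<in> E0" for e using E0[OF that] T disj by auto
      have 2: "card ({x, par x} \<inter> (S \<union> T)) = 1 \<longleftrightarrow> (x \<in> T) \<noteq> (par x \<in> S)" if "x \<in> L" for x
      proof -
        have "x \<noteq> par x" "x \<notin> S" "par x \<notin> T" using par[OF that] that S T disj by auto
        then show ?thesis by (subst card_doubleton_Int) auto
      qed
      show ?thesis using 1 2 by auto
    qed
    moreover have "{e \<in> E0. card (e \<inter> S) = 1} \<inter> (\<lambda>x. {x, par x}) ` {x \<in> L. (x \<in> T) \<noteq> (par x \<in> S)} = {}"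
      using E0 disj by auto
    ultimately have "card {e \<in> E0 \<union> (\<lambda>x. {x, par x}) ` L. card (e \<inter> (S \<union> T)) = 1}
      = card {e \<in> E0. card (e \<inter> S) = 1} + card {x \<in> L. (x \<in> T) \<noteq> (par x \<in> S)}"
      using fin inj by (simp add: card_Un_disjoint card_image inj_on_subset)
    then have "ising_wt (E0 \<union> (\<lambda>x. {x, par x}) ` L) m \<kappa> (S \<union> T)
      = ising_wt E0 m \<kappa> S * ((\<Prod>x\<in>T. m x) * \<kappa> ^ card {x \<in> L. (x \<in> T) \<noteq> (par x \<in> S)})"
      using fS ST by (simp add: ising_wt_def power_add prod.union_disjoint)
    also have "(\<Prod>x\<in>T. m x) = (\<Prod>x\<in>L. if x \<in> T then m x else 1)"
      using T fin by (intro prod.mono_neutral_cong_left) auto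
    also have "\<kappa> ^ card {x \<in> L. (x \<in> T) \<noteq> (par x \<in> S)} = (\<Prod>x\<in>L. if (x \<in> T) \<noteq> (par x \<in> S) then \<kappa> else 1)"
      by (rule prod_if_power[symmetric, OF fin(2)])
    also have "(\<Prod>x\<in>L. if x \<in> T then m x else 1) * (\<Prod>x\<in>L. if (x \<in> T) \<noteq> (par x \<in> S) then \<kappa> else 1)
      = (\<Prod>x\<in>L. if x \<in> T then m x * (if par x \<in> S then 1 else \<kappa>) else (if par x \<in> S then \<kappa> else 1))"
      unfolding prod.distrib[symmetric] by (intro prod.cong) auto
    finally show ?thesis .
  qed
  then have "(\<Sum>T\<in>Pow L. ising_wt (E0 \<union> (\<lambda>x. {x, par x}) ` L) m \<kappa> (S \<union> T))
    = ising_wt E0 m \<kappa> S * (\<Sum>T\<in>Pow L. \<Prod>x\<in>L. if x \<in> T then m x * (if par x \<in> S then 1 else \<kappa>) else (if par x \<in> S then \<kappa> else 1))"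
    by (simp add: sum_distrib_left)
  also have "(\<Sum>T\<in>Pow L. \<Prod>x\<in>L. if x \<in> T then m x * (if par x \<in> S then 1 else \<kappa>) else (if par x \<in> S then \<kappa> else 1))
    = (\<Prod>x\<in>L. if par x \<in> S then \<kappa> + m x else 1 + \<kappa> * m x)"
    by (subst sum_Pow_prod[OF fin(2)]) (auto intro!: prod.cong)
  finally show ?thesis .
qed

lemma ising_attach_isolated:
  assumes fin: "finite B" "finite L" and disj: "B \<inter> L = {}"
    and E0: "\<And>e. e \<in> E0 \<Longrightarrow> e \<subseteq> B" and S: "S \<subseteq> B"
  shows "(\<Sum>T\<in>Pow L. ising_wt E0 m \<kappa> (S \<union> T)) = ising_wt E0 m \<kappa> S * (\<Prod>x\<in>L. m x + 1)"
proof -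
  have "ising_wt E0 m \<kappa> (S \<union> T) = ising_wt E0 m \<kappa> S * (\<Prod>x\<in>L. if x \<in> T then m x else 1)"
    if T: "T \<in> Pow L" for T
  proof -
    have fS: "finite S" "finite T" using S T fin finite_subset by auto
    have ST: "S \<inter> T = {}" using S T disj by auto
    have "e \<inter> (S \<union> T) = e \<inter> S" if "e \<in> E0" for e using E0[OF that] T disj by auto
    then have "{e \<in> E0. card (e \<inter> (S \<union> T)) = 1} = {e \<in> E0. card (e \<inter> S) = 1}" by auto
    moreover have "(\<Prod>x\<in>T. m x) = (\<Prod>x\<in>L. if x \<in> T then m x else 1)"
      using T fin by (intro prod.mono_neutral_cong_left) auto
    ultimately show ?thesis using fS ST by (simp add: ising_wt_def prod.union_disjoint)
  qed
  then show ?thesis by (simp add: sum_distrib_left[symmetric] sum_Pow_prod[OF fin(2)])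
qed

text \<open>A vertex first reached at distance \<open>j + 1\<close> has its parent as only neighbour
  within that distance: no second parent and no edge inside the sphere. This levelwise form of the
  ball being a tree is what peeling off spheres uses.\<close>

definition tree_ball :: "'v set set \<Rightarrow> 'v \<Rightarrow> nat \<Rightarrow> bool" where
  "tree_ball E v k \<longleftrightarrow> (\<forall>j<k. \<forall>x\<in>ball_in E v (Suc j) - ball_in E v j.
     card {y \<in> ball_in E v (Suc j). {x, y} \<in> E} \<le> 1)"

text \<open>The factor that a neighbour with minus to plus ratio \<open>s\<close> contributes to the
  minus to plus ratio across an edge. With \<open>d - 1\<close> children below a vertex this yields
  the belief propagation map \<open>cavity_step\<close>.\<close>

definition edge_ratio :: "real \<Rightarrow> real \<Rightarrow> real" where
  "edge_ratio \<kappa> s = (s + \<kappa>) / (1 + \<kappa> * s)"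

definition cavity_step :: "nat \<Rightarrow> real \<Rightarrow> real \<Rightarrow> real \<Rightarrow> real" where
  "cavity_step d \<kappa> \<mu> s = \<mu> * edge_ratio \<kappa> s ^ (d - 1)"

text \<open>The vertices of the outer sphere are leaves of activity \<open>s\<close>, and each
  multiplies the activity of its parent by \<open>edge_ratio \<kappa> s\<close>. In
  \<open>m'\<close> the root has \<open>d\<close> children (\<open>j = 0\<close>), a vertex of the
  sphere of radius \<open>j > 0\<close> has \<open>d - 1\<close>, and vertices further inside have
  none in the outer sphere.\<close>

lemma tree_ball_peel:
  fixes \<kappa> \<mu> s :: real
  assumes R: "regular_graph d (V, E)" and v: "v \<in> V" and T: "tree_ball E v k" and j: "j < k"
    and \<kappa>: "0 < \<kappa>" and s: "0 \<le> s" and S: "S \<subseteq> ball_in E v j"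
  defines "B \<equiv> ball_in E v j" and "B' \<equiv> ball_in E v (Suc j)"
  defines "m' \<equiv> \<lambda>x. if j = 0 then \<mu> * edge_ratio \<kappa> s ^ d
     else if x \<in> ball_in E v (j - 1) then \<mu> else cavity_step d \<kappa> \<mu> s"
  shows "(\<Sum>T\<in>Pow (B' - B). ising_wt (edges_in E B') (\<lambda>x. if x \<in> B then \<mu> else s) \<kappa> (S \<union> T))
    = (1 + \<kappa> * s) ^ card (B' - B) * ising_wt (edges_in E B) m' \<kappa> S"
proof -
  have G: "fin_graph (V, E)" using R by (simp add: regular_graph_def)
  have BV: "ball_in E v i \<subseteq> V" for i by (rule ball_in_subset[OF G v])
  have fin: "finite (ball_in E v i)" for i by (rule finite_ball_in[OF G v])
  have fE: "finite E" by (rule fin_graph_finite_edges[OF G])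
  have BB': "B \<subseteq> B'" unfolding B_def B'_def by auto
  define L where "L = B' - B"
  define par where "par x = (SOME y. y \<in> B \<and> {y, x} \<in> E)" for x
  have par: "par x \<in> B \<and> {par x, x} \<in> E" if "x \<in> L" for x
    unfolding par_def by (rule someI_ex) (use that in \<open>auto simp: L_def B'_def B_def\<close>)
  have uniq: "y = par x" if "x \<in> L" "y \<in> B'" "{x, y} \<in> E" for x y
  proof -
    have "card {y \<in> B'. {x, y} \<in> E} \<le> 1"
      using T j that unfolding tree_ball_def L_def B_def B'_def by auto
    moreover have "{y, par x} \<subseteq> {y \<in> B'. {x, y} \<in> E}"
      using par[OF that(1)] that BB' by (auto simp: insert_commute)
    moreover have "finite {y \<in> B'. {x, y} \<in> E}" using fin[of "Suc j"] finite_subset unfolding B'_def by (simp del: ball_in.simps)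
    ultimately have "card {y, par x} \<le> 1" using card_mono order.trans by blast
    then show ?thesis by (cases "y = par x") auto
  qed
  have edges: "edges_in E B' = edges_in E B \<union> (\<lambda>x. {x, par x}) ` L"
  proof (intro equalityI subsetI)
    fix e assume e: "e \<in> edges_in E B'"
    show "e \<in> edges_in E B \<union> (\<lambda>x. {x, par x}) ` L"
    proof (cases "e \<subseteq> B")
      case False
      from e obtain a b where ab: "e = {a, b}" using fin_graph_edgeE[OF G] by blast
      then obtain x y where xy: "e = {x, y}" "x \<in> L"
        using False e by (auto simp: L_def insert_commute)
      then have "y = par x" using uniq e by auto
      with xy show ?thesis by auto
    qed (use e in auto)
  next
    fix e assume "e \<in> edges_in E B \<union> (\<lambda>x. {x, par x}) ` L"
    then show "e \<in> edges_in E B'"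
      using par BB' by (auto simp: L_def insert_commute)
  qed
  have SB: "S \<subseteq> B" using S by (simp add: B_def)
  have fS: "finite S" using SB fin B_def finite_subset by blast
  let ?m = "\<lambda>x. if x \<in> B then \<mu> else s"
  have "(\<Sum>T\<in>Pow L. ising_wt (edges_in E B') ?m \<kappa> (S \<union> T))
    = ising_wt (edges_in E B) ?m \<kappa> S * (\<Prod>x\<in>L. if par x \<in> S then \<kappa> + ?m x else 1 + \<kappa> * ?m x)"
    unfolding edges
    by (rule ising_attach_leaves) (use fin fE par SB finite_nbrs[OF G] in \<open>auto simp: L_def B_def B'_def\<close>)
  also have "(\<Prod>x\<in>L. if par x \<in> S then \<kappa> + ?m x else 1 + \<kappa> * ?m x)
    = (\<Prod>x\<in>L. (1 + \<kappa> * s) * (if par x \<in> S then edge_ratio \<kappa> s else 1))"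
  proof -
    have "1 + \<kappa> * s > 0" using \<kappa> s by (simp add: add_pos_nonneg)
    then show ?thesis by (intro prod.cong) (auto simp: L_def edge_ratio_def)
  qed
  also have "\<dots> = (1 + \<kappa> * s) ^ card L * (\<Prod>x\<in>L. if par x \<in> S then edge_ratio \<kappa> s else 1)"
    by (simp add: prod.distrib)
  also have "(\<Prod>x\<in>L. if par x \<in> S then edge_ratio \<kappa> s else 1) = (\<Prod>y\<in>S. edge_ratio \<kappa> s ^ card {x \<in> L. par x = y})"
  proof -
    have fL: "finite L" using fin[of "Suc j"] by (simp add: L_def B'_def del: ball_in.simps)
    have "(\<Prod>x\<in>L. if par x \<in> S then edge_ratio \<kappa> s else 1) = (\<Prod>x\<in>{x \<in> L. par x \<in> S}. edge_ratio \<kappa> s)"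
      using fL by (simp add: prod.If_cases Int_def)
    also have "\<dots> = (\<Prod>y\<in>S. \<Prod>x\<in>{x \<in> {x \<in> L. par x \<in> S}. par x = y}. edge_ratio \<kappa> s)"
      by (rule prod.group[symmetric]) (use fL fS in auto)
    also have "\<dots> = (\<Prod>y\<in>S. edge_ratio \<kappa> s ^ card {x \<in> L. par x = y})"
    proof (rule prod.cong[OF refl])
      fix y assume "y \<in> S"
      then have "{x \<in> {x \<in> L. par x \<in> S}. par x = y} = {x \<in> L. par x = y}" by auto
      then show "(\<Prod>x\<in>{x \<in> {x \<in> L. par x \<in> S}. par x = y}. edge_ratio \<kappa> s) = edge_ratio \<kappa> s ^ card {x \<in> L. par x = y}"
        by simp
    qed
    finally show ?thesis .
  qed
  also have "ising_wt (edges_in E B) ?m \<kappa> S * ((1 + \<kappa> * s) ^ card L * (\<Prod>y\<in>S. edge_ratio \<kappa> s ^ card {x \<in> L. par x = y}))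
     = (1 + \<kappa> * s) ^ card L * ising_wt (edges_in E B) m' \<kappa> S"
  proof -
    have "?m y * edge_ratio \<kappa> s ^ card {x \<in> L. par x = y} = m' y" if "y \<in> S" for y
    proof -
      have yB: "y \<in> B" using that SB by auto
      then have yV: "y \<in> V" using BV B_def by auto
      have ch: "{x \<in> L. par x = y} = {x. {y, x} \<in> E} - B"
      proof (intro equalityI subsetI)
        fix x assume "x \<in> {x \<in> L. par x = y}"
        then show "x \<in> {x. {y, x} \<in> E} - B" using par[of x] by (auto simp: L_def)
      next
        fix x assume x: "x \<in> {x. {y, x} \<in> E} - B"
        then have "x \<in> L" using yB by (auto simp: L_def B'_def B_def)
        moreover have "y = par x" using x yB BB' by (intro uniq[OF \<open>x \<in> L\<close>]) (auto simp: insert_commute)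
        ultimately show "x \<in> {x \<in> L. par x = y}" by auto
      qed
      have cd: "card {x. {y, x} \<in> E} = d" by (rule regular_card_nbrs[OF R yV])
      show ?thesis
      proof (cases "j = 0")
        case True
        then have "B = {y}" using yB by (auto simp: B_def)
        then have "{x. {y, x} \<in> E} - B = {x. {y, x} \<in> E}" using fin_graph_edge(3)[OF G, of y y] by auto
        then show ?thesis using True yB unfolding ch by (simp add: cd m'_def)
      next
        case False
        then obtain i where i: "j = Suc i" using not0_implies_Suc by auto
        show ?thesis
        proof (cases "y \<in> ball_in E v i")
          case True
          then have e0: "{x. {y, x} \<in> E} - B = {}" by (auto simp: B_def i)
          show ?thesis using True yB unfolding ch e0 by (simp add: m'_def i)
        next
          case F: False
          have Bi: "B = ball_in E v (Suc i)" unfolding B_def i ..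
          have "i < k" using j i by simp
          \<comment> \<open>At most one neighbour in \<open>B\<close> by \<open>tree_ball\<close>,
            at least one because \<open>y\<close> was reached at step \<open>j\<close>; this leaves
            \<open>d - 1\<close> children.\<close>
          with T yB F have le: "card {x \<in> B. {y, x} \<in> E} \<le> 1"
            unfolding tree_ball_def Bi by blast
          have "{x \<in> B. {y, x} \<in> E} \<noteq> {}"
            using yB F unfolding Bi by (auto simp: insert_commute)
          moreover have "finite {x \<in> B. {y, x} \<in> E}" using fin[of j] B_def by simp
          ultimately have "card {x \<in> B. {y, x} \<in> E} \<noteq> 0" by simp
          then have "card {x \<in> B. {y, x} \<in> E} = 1" using le by linarith
          then have "card ({x. {y, x} \<in> E} \<inter> B) = 1" by (simp add: Int_def conj_commute)
          then have "card ({x. {y, x} \<in> E} - B) = d - 1"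
            using cd by (simp add: card_Diff_subset_Int fin B_def)
          then show ?thesis using F yB unfolding ch by (simp add: m'_def i cavity_step_def)
        qed
      qed
    qed
    then have "(\<Prod>y\<in>S. m' y) = (\<Prod>y\<in>S. ?m y) * (\<Prod>y\<in>S. edge_ratio \<kappa> s ^ card {x \<in> L. par x = y})"
      unfolding prod.distrib[symmetric] by (intro prod.cong) auto
    then show ?thesis by (simp add: ising_wt_def)
  qed
  finally show ?thesis unfolding L_def .
qed

text \<open>Each peeled sphere turns the boundary activity \<open>s\<close> into
  \<open>cavity_step d \<kappa> \<mu> s\<close>, hence \<open>s\<close> varies in the induction. The
  factor in front is the same for both signs at the root and cancels in the ratio.\<close>

lemma tree_ball_ratio:
  fixes \<kappa> \<mu> s :: real
  assumes R: "regular_graph d (V, E)" and v: "v \<in> V" and T: "tree_ball E v k" and j: "j < k"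
    and \<kappa>: "0 < \<kappa>" and s: "0 \<le> s" and \<mu>: "0 \<le> \<mu>"
  defines "W \<equiv> \<lambda>Q j s. \<Sum>S\<in>{S \<in> Pow (ball_in E v (Suc j)). Q (v \<in> S)}.
    ising_wt (edges_in E (ball_in E v (Suc j))) (\<lambda>x. if x \<in> ball_in E v j then \<mu> else s) \<kappa> S"
  shows "W (\<lambda>b. b) j s = \<mu> * edge_ratio \<kappa> ((cavity_step d \<kappa> \<mu> ^^ j) s) ^ d * W Not j s"
proof -
  have G: "fin_graph (V, E)" using R by (simp add: regular_graph_def)
  have fin: "finite (ball_in E v i)" for i by (rule finite_ball_in[OF G v])
  let ?B = "ball_in E v"
  let ?m = "\<lambda>j s x. if j = 0 then \<mu> * edge_ratio \<kappa> s ^ d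
     else if x \<in> ?B (j - 1) then \<mu> else cavity_step d \<kappa> \<mu> s"
  have peel: "W Q j s = (1 + \<kappa> * s) ^ card (?B (Suc j) - ?B j) *
     (\<Sum>S\<in>{S \<in> Pow (?B j). Q (v \<in> S)}. ising_wt (edges_in E (?B j)) (?m j s) \<kappa> S)"
    if "j < k" "0 \<le> s" for j s Q
  proof -
    let ?w = "ising_wt (edges_in E (?B (Suc j))) (\<lambda>x. if x \<in> ?B j then \<mu> else s) \<kappa>"
    have "(\<Sum>S\<in>{S \<in> Pow (?B j \<union> (?B (Suc j) - ?B j)). Q (v \<in> S)}. ?w S) =
      (\<Sum>S\<in>{S \<in> Pow (?B j). Q (v \<in> S)}. \<Sum>T\<in>Pow (?B (Suc j) - ?B j). ?w (S \<union> T))"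
      by (rule sum_Pow_Un_restrict) (use fin[of j] fin[of "Suc j"] ball_in_self[of v E j] in auto)
    moreover have "?B j \<union> (?B (Suc j) - ?B j) = ?B (Suc j)" by auto
    ultimately show ?thesis
      using tree_ball_peel[OF R v T that(1) \<kappa> that(2), of _ \<mu>]
      unfolding W_def sum_distrib_left by (simp del: ball_in.simps)
  qed
  show ?thesis using j s
  proof (induction j arbitrary: s)
    case (0 s)
    have S1: "{S \<in> Pow (?B 0). v \<in> S} = {{v}}" "{S \<in> Pow (?B 0). v \<notin> S} = {{}}" by auto
    have E0: "edges_in E (?B 0) = {}" using G by (auto elim!: fin_graph_edgeE)
    show ?case unfolding peel[OF 0] S1 E0 by (simp add: ising_wt_def)
  next
    case (Suc j s)
    have "0 \<le> cavity_step d \<kappa> \<mu> s"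
      using \<mu> Suc.prems \<kappa> by (simp add: cavity_step_def edge_ratio_def)
    then have "W (\<lambda>b. b) j (cavity_step d \<kappa> \<mu> s) = \<mu> * edge_ratio \<kappa> ((cavity_step d \<kappa> \<mu> ^^ Suc j) s) ^ d
        * W Not j (cavity_step d \<kappa> \<mu> s)"
      using Suc by (simp only: funpow_Suc_right o_def Suc_lessD)
    moreover have "W Q (Suc j) s = (1 + \<kappa> * s) ^ card (?B (Suc (Suc j)) - ?B (Suc j)) * W Q j (cavity_step d \<kappa> \<mu> s)" for Q
      unfolding peel[OF Suc.prems] unfolding W_def by (simp del: ball_in.simps)
    ultimately show ?case by simp
  qed
qed

text \<open>Deleting all edges that are not inside the ball can only raise the ratio. The outside
  then consists of isolated vertices, whose factors cancel, and the free boundary has activity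
  \<open>\<mu>\<close>, which is why the iteration starts at \<open>\<mu>\<close>.\<close>

lemma tree_ball_bound:
  fixes \<kappa> \<mu> :: real
  assumes R: "regular_graph d (V, E)" and v: "v \<in> V" and T: "tree_ball E v (Suc k)"
    and \<kappa>: "0 < \<kappa>" "\<kappa> \<le> 1" and \<mu>: "0 < \<mu>" "\<mu> \<le> 1"
  shows "(\<Sum>S\<in>{S \<in> Pow V. v \<in> S}. ising_hom E \<kappa> \<mu> S)
    \<le> \<mu> * edge_ratio \<kappa> ((cavity_step d \<kappa> \<mu> ^^ k) \<mu>) ^ d *
      (\<Sum>S\<in>{S \<in> Pow V. v \<notin> S}. ising_hom E \<kappa> \<mu> S)"
proof -
  have G: "fin_graph (V, E)" using R by (simp add: regular_graph_def)
  define B where "B = ball_in E v (Suc k)"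
  define E' where "E' = edges_in E B"
  have BV: "B \<subseteq> V" unfolding B_def by (rule ball_in_subset[OF G v])
  have fV: "finite V" using G by (simp add: fin_graph_def)
  have fin: "finite B" "finite (V - B)" using BV fV finite_subset by auto
  have vB: "v \<in> B" unfolding B_def by (rule ball_in_self)
  let ?w = "ising_hom E' \<kappa> \<mu>"
  have split: "(\<Sum>S\<in>{S \<in> Pow V. Q (v \<in> S)}. ?w S) =
     (\<Sum>S\<in>{S \<in> Pow B. Q (v \<in> S)}. ?w S) * (\<mu> + 1) ^ card (V - B)" for Q
  proof -
    have "(\<Sum>S\<in>{S \<in> Pow (B \<union> (V - B)). Q (v \<in> S)}. ?w S) =
      (\<Sum>S\<in>{S \<in> Pow B. Q (v \<in> S)}. \<Sum>T\<in>Pow (V - B). ?w (S \<union> T))"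
      by (rule sum_Pow_Un_restrict) (use fin vB in auto)
    also have "\<dots> = (\<Sum>S\<in>{S \<in> Pow B. Q (v \<in> S)}. ?w S * (\<mu> + 1) ^ card (V - B))"
    proof (rule sum.cong[OF refl])
      fix S assume "S \<in> {S \<in> Pow B. Q (v \<in> S)}"
      then have "(\<Sum>T\<in>Pow (V - B). ?w (S \<union> T)) = ?w S * (\<Prod>x\<in>V - B. \<mu> + 1)"
        by (intro ising_attach_isolated) (use fin in \<open>auto simp: E'_def\<close>)
      then show "(\<Sum>T\<in>Pow (V - B). ?w (S \<union> T)) = ?w S * (\<mu> + 1) ^ card (V - B)" by simp
    qed
    finally show ?thesis using BV by (simp add: sum_distrib_right Un_absorb1)
  qed
  let ?r = "\<mu> * edge_ratio \<kappa> ((cavity_step d \<kappa> \<mu> ^^ k) \<mu>) ^ d"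
  let ?M = "\<lambda>E. \<Sum>S\<in>{S \<in> Pow V. v \<in> S}. ising_hom E \<kappa> \<mu> S"
  let ?P = "\<lambda>E. \<Sum>S\<in>{S \<in> Pow V. v \<notin> S}. ising_hom E \<kappa> \<mu> S"
  have "(\<Sum>S\<in>{S \<in> Pow B. v \<in> S}. ?w S) = ?r * (\<Sum>S\<in>{S \<in> Pow B. v \<notin> S}. ?w S)"
    using tree_ball_ratio[OF R v T, of k \<kappa> \<mu> \<mu>] \<kappa> \<mu> unfolding B_def E'_def by simp
  then have eq: "?M E' = ?r * ?P E'" using split[of "\<lambda>b. b"] split[of Not] by simp
  have pos: "?P E' > 0"
  proof (rule sum_pos)
    show "finite {S \<in> Pow V. v \<notin> S}" using fV by auto
    show "{S \<in> Pow V. v \<notin> S} \<noteq> {}" by auto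
    show "0 < ising_hom E' \<kappa> \<mu> S" for S using \<mu> \<kappa> by (simp add: ising_wt_def)
  qed
  have "?M E * ?P E' \<le> ?M E' * ?P E"
    by (rule ising_delete_edges[OF G _ v]) (use \<mu> \<kappa> in \<open>auto simp: E'_def\<close>)
  then have "?M E * ?P E' \<le> (?r * ?P E) * ?P E'" unfolding eq by (simp add: algebra_simps)
  with pos show ?thesis using mult_le_cancel_right_pos by blast
qed

section \<open>Short cycles\<close>

lemma cycle_of_list:
  assumes "distinct zs" "3 \<le> length zs" "successively (\<lambda>a b. {a, b} \<in> E) zs" "{last zs, hd zs} \<in> E"
  obtains C where "is_cycle (V, E) C" "set zs \<subseteq> \<Union>C" "card C \<le> length zs"
proof -
  define C where "C = {{zs ! i, zs ! ((i + 1) mod length zs)} | i. i < length zs}"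
  have C: "C = (\<lambda>i. {zs ! i, zs ! ((i + 1) mod length zs)}) ` {..<length zs}"
    unfolding C_def by auto
  have "{zs ! i, zs ! ((i + 1) mod length zs)} \<in> E" if i: "i < length zs" for i
  proof (cases "i + 1 < length zs")
    case True
    then show ?thesis using assms(3) by (simp add: successively_conv_nth)
  next
    case False
    then have "i + 1 = length zs" using i by simp
    then have "i = length zs - 1" "(i + 1) mod length zs = 0" by auto
    moreover have "zs \<noteq> []" using assms(2) by auto
    ultimately show ?thesis using assms(4) by (simp add: last_conv_nth hd_conv_nth)
  qed
  then have "C \<subseteq> E" unfolding C by auto
  then have "is_cycle (V, E) C"
    unfolding is_cycle_def using assms(1,2) C_def by auto
  moreover have "set zs \<subseteq> \<Union>C" unfolding C by (auto simp: in_set_conv_nth)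
  moreover have "card C \<le> length zs" unfolding C using card_image_le[of "{..<length zs}"] by simp
  ultimately show ?thesis using that by blast
qed

text \<open>Follow the first path from \<open>x\<close> to its first vertex on the second one and
  return along the second. As the paths leave \<open>x\<close> to different neighbours, at least
  three vertices are visited.\<close>

lemma cycle_of_two_paths:
  assumes xs: "xs \<noteq> []" "distinct xs" "successively (\<lambda>a b. {a, b} \<in> E) xs"
    and ys: "ys \<noteq> []" "distinct ys" "successively (\<lambda>a b. {a, b} \<in> E) ys"
    and x: "x \<notin> set xs" "x \<notin> set ys" "{x, hd xs} \<in> E" "{x, hd ys} \<in> E"
    and eq: "hd xs \<noteq> hd ys" "last xs = last ys"
  obtains C where "is_cycle (V, E) C" "x \<in> \<Union>C" "card C \<le> length xs + length ys + 1"
proof -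
  have "\<exists>a\<in>set xs. a \<in> set ys" using eq xs ys by (metis last_in_set)
  then obtain p z r where p: "xs = p @ z # r" "z \<in> set ys" "\<forall>a\<in>set p. a \<notin> set ys"
    using split_list_first_prop[of xs "\<lambda>a. a \<in> set ys"] by blast
  obtain p' r' where p': "ys = p' @ z # r'" using split_list[OF p(2)] by blast
  define zs where "zs = x # p @ z # rev p'"
  have ne: "p \<noteq> [] \<or> p' \<noteq> []" using eq p p' by auto
  have 1: "distinct zs" using xs ys x p p' unfolding zs_def by auto
  have 2: "3 \<le> length zs" using ne unfolding zs_def by (cases p; cases p') auto
  have sp: "successively (\<lambda>a b. {a, b} \<in> E) (p @ [z])"
    using xs(3) unfolding p by (auto simp: successively_append_iff)
  have sp': "successively (\<lambda>a b. {a, b} \<in> E) (p' @ [z])"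
    using ys(3) unfolding p' by (auto simp: successively_append_iff)
  then have "successively (\<lambda>a b. {a, b} \<in> E) (rev (p' @ [z]))"
    by (simp only: successively_rev insert_commute)
  then have "successively (\<lambda>a b. {a, b} \<in> E) (z # rev p')" by simp
  then have "successively (\<lambda>a b. {a, b} \<in> E) (p @ z # rev p')"
    using sp by (auto simp: successively_append_iff)
  moreover have "hd (p @ z # rev p') = hd xs" unfolding p by (cases p) auto
  ultimately have 3: "successively (\<lambda>a b. {a, b} \<in> E) zs"
    using x(3) unfolding zs_def by (simp add: successively_Cons)
  have "last zs = hd ys" unfolding zs_def p' by (cases p') auto
  then have 4: "{last zs, hd zs} \<in> E" using x(4) unfolding zs_def by (simp add: insert_commute)
  from cycle_of_list[OF 1 2 3 4, of V] obtain C where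
    "is_cycle (V, E) C" "set zs \<subseteq> \<Union>C" "card C \<le> length zs" .
  moreover have "length zs \<le> length xs + length ys + 1" unfolding zs_def p p' by simp
  moreover have "x \<in> set zs" unfolding zs_def by simp
  ultimately show ?thesis using that by (meson order_trans subsetD)
qed

text \<open>The clause on the tail keeps a vertex of the next sphere off the paths that start at its
  neighbours, as \<open>cycle_of_two_paths\<close> demands.\<close>

lemma ball_in_path:
  assumes "y \<in> ball_in E v i"
  shows "\<exists>xs. xs \<noteq> [] \<and> hd xs = y \<and> last xs = v \<and> distinct xs \<and> length xs \<le> i + 1 \<and>
    successively (\<lambda>a b. {a, b} \<in> E) xs \<and> set (tl xs) \<subseteq> ball_in E v (i - 1)"
  using assms
proof (induction i arbitrary: y)
  case 0
  then show ?case by (intro exI[of _ "[v]"]) auto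
next
  case (Suc i)
  show ?case
  proof (cases "y \<in> ball_in E v i")
    case True
    then obtain xs where "xs \<noteq> [] \<and> hd xs = y \<and> last xs = v \<and> distinct xs \<and> length xs \<le> i + 1 \<and>
      successively (\<lambda>a b. {a, b} \<in> E) xs \<and> set (tl xs) \<subseteq> ball_in E v (i - 1)" using Suc.IH by blast
    moreover have "ball_in E v (i - 1) \<subseteq> ball_in E v (Suc i - 1)" by (rule ball_in_mono) simp
    ultimately show ?thesis by (intro exI[of _ xs]) auto
  next
    case False
    then obtain x where x: "x \<in> ball_in E v i" "{x, y} \<in> E" using Suc.prems by auto
    then obtain xs where xs: "xs \<noteq> [] \<and> hd xs = x \<and> last xs = v \<and> distinct xs \<and> length xs \<le> i + 1 \<and>
      successively (\<lambda>a b. {a, b} \<in> E) xs \<and> set (tl xs) \<subseteq> ball_in E v (i - 1)" using Suc.IH by blast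
    have "ball_in E v (i - 1) \<subseteq> ball_in E v i" by (rule ball_in_mono) simp
    then have sub: "set xs \<subseteq> ball_in E v i" using xs x(1) by (cases xs) auto
    then show ?thesis using xs x False
      by (intro exI[of _ "y # xs"]) (auto simp: successively_Cons insert_commute)
  qed
qed

text \<open>Two neighbours of \<open>x\<close> in the ball of radius \<open>j + 1\<close> are joined
  to \<open>v\<close> by paths with at most \<open>j + 2 \<le> k + 1\<close> vertices; together with
  \<open>x\<close> this gives the length \<open>2 * k + 3\<close>.\<close>

lemma tree_ball_if_no_short_cycle:
  assumes "\<not> tree_ball E v k" and G: "fin_graph (V, E)"
  obtains x C where "x \<in> ball_in E v k" "is_cycle (V, E) C" "x \<in> \<Union>C" "card C \<le> 2 * k + 3"
proof -
  from assms(1) obtain j x where j: "j < k" and x: "x \<in> ball_in E v (Suc j)" "x \<notin> ball_in E v j"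
    and c: "\<not> card {y \<in> ball_in E v (Suc j). {x, y} \<in> E} \<le> 1"
    unfolding tree_ball_def by blast
  let ?A = "{y \<in> ball_in E v (Suc j). {x, y} \<in> E}"
  have "finite ?A"
  proof (rule ccontr)
    assume "infinite ?A" then have "card ?A = 0" by (rule card.infinite) with c show False by linarith
  qed
  then have "\<not> (\<forall>a\<in>?A. \<forall>b\<in>?A. a = b)" using c by (simp only: card_le_Suc0_iff_eq One_nat_def not_False_eq_True)
  then obtain y y' where y: "y \<in> ball_in E v (Suc j)" "{x, y} \<in> E" "y' \<in> ball_in E v (Suc j)" "{x, y'} \<in> E" "y \<noteq> y'"
    by blast
  from ball_in_path[OF y(1)] obtain xs where xs: "xs \<noteq> []" "hd xs = y" "last xs = v" "distinct xs"
    "length xs \<le> j + 2" "successively (\<lambda>a b. {a, b} \<in> E) xs" "set (tl xs) \<subseteq> ball_in E v j" by auto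
  from ball_in_path[OF y(3)] obtain ys where ys: "ys \<noteq> []" "hd ys = y'" "last ys = v" "distinct ys"
    "length ys \<le> j + 2" "successively (\<lambda>a b. {a, b} \<in> E) ys" "set (tl ys) \<subseteq> ball_in E v j" by auto
  have "x \<noteq> y" "x \<noteq> y'" using y fin_graph_edge[OF G] by blast+
  then have "x \<notin> set xs" "x \<notin> set ys"
    using xs ys x(2) by (metis list.collapse set_ConsD subsetD)+
  then obtain C where "is_cycle (V, E) C" "x \<in> \<Union>C" "card C \<le> length xs + length ys + 1"
    using cycle_of_two_paths[of xs E ys x V] xs ys y by metis
  moreover have "x \<in> ball_in E v k" using x(1) ball_in_mono[of "Suc j" k E v] j by auto
  ultimately show ?thesis using that xs(5) ys(5) j by force
qed

lemma ball_in_Suc_nbr: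
  assumes "{v, x} \<in> E" "y \<in> ball_in E x k" shows "y \<in> ball_in E v (Suc k)"
  using assms by (induction k arbitrary: y) auto

lemma ball_in_sym: "x \<in> ball_in E v k \<Longrightarrow> v \<in> ball_in E x k"
proof (induction k arbitrary: x)
  case (Suc k)
  show ?case
  proof (cases "x \<in> ball_in E v k")
    case False
    then obtain y where "y \<in> ball_in E v k" "{y, x} \<in> E" using Suc.prems by auto
    then show ?thesis using Suc.IH ball_in_Suc_nbr[of x y E v k] by (simp add: insert_commute)
  qed (use Suc.IH in auto)
qed simp

lemma finite_short_cycles:
  assumes "fin_graph (V, E)" shows "finite {C. is_cycle (V, E) C \<and> Q C}"
  by (rule finite_subset[of _ "Pow E"])
    (use fin_graph_finite_edges[OF assms] in \<open>auto simp: is_cycle_def\<close>)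

lemma card_Union_cycle:
  assumes "fin_graph (V, E)" "is_cycle (V, E) C"
  shows "card (\<Union>C) \<le> 2 * card C" "\<Union>C \<subseteq> V"
proof -
  have CE: "C \<subseteq> E" using assms(2) by (simp add: is_cycle_def)
  have "card (\<Union>C) \<le> (\<Sum>e\<in>C. card e)" by (rule card_Union_le_sum_card)
  also have "\<dots> = (\<Sum>e\<in>C. 2)" using CE assms(1) by (intro sum.cong) (auto simp: fin_graph_def)
  finally show "card (\<Union>C) \<le> 2 * card C" by simp
  show "\<Union>C \<subseteq> V" using CE assms(1) by (auto simp: fin_graph_def)
qed

abbreviation "num_bad V E k \<equiv> card {v \<in> V. \<not> tree_ball E v k}"

text \<open>Every bad vertex is within distance \<open>k\<close> of a cycle of length at most
  \<open>2 * k + 3\<close>, the range counted for \<open>g = 2 * k + 4\<close>. Such a cycle has at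
  most \<open>4 * k + 6\<close> vertices, at two per edge, and each is near at most
  \<open>(d + 1) ^ k\<close> others.\<close>

lemma card_not_tree_ball:
  assumes R: "regular_graph d (V, E)"
  shows "num_bad V E k
    \<le> num_short_cycles (V, E) (2 * int k + 4) * ((4 * k + 6) * (d + 1) ^ k)"
proof -
  have G: "fin_graph (V, E)" using R by (simp add: regular_graph_def)
  define CC where "CC = {C. is_cycle (V, E) C \<and> int (card C) \<le> 2 * int k + 4 - 1}"
  have fCC: "finite CC" unfolding CC_def by (rule finite_short_cycles[OF G])
  have fV: "finite V" using G by (simp add: fin_graph_def)
  have UV: "\<Union>C \<subseteq> V" "card (\<Union>C) \<le> 4 * k + 6" if "C \<in> CC" for C
    using card_Union_cycle[OF G, of C] that unfolding CC_def by auto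
  have "{v \<in> V. \<not> tree_ball E v k} \<subseteq> (\<Union>C\<in>CC. \<Union>x\<in>\<Union>C. ball_in E x k)"
  proof
    fix v assume "v \<in> {v \<in> V. \<not> tree_ball E v k}"
    then have "\<not> tree_ball E v k" by simp
    from tree_ball_if_no_short_cycle[OF this G] obtain x C
      where "x \<in> ball_in E v k" "is_cycle (V, E) C" "x \<in> \<Union>C" "card C \<le> 2 * k + 3" .
    then show "v \<in> (\<Union>C\<in>CC. \<Union>x\<in>\<Union>C. ball_in E x k)" unfolding CC_def using ball_in_sym by fastforce
  qed
  moreover have "finite (\<Union>C\<in>CC. \<Union>x\<in>\<Union>C. ball_in E x k)"
  proof (rule finite_UN_I[OF fCC], rule finite_UN_I)
    fix C assume C: "C \<in> CC"
    show "finite (\<Union>C)" by (rule finite_subset[OF UV(1)[OF C] fV])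
    fix x assume "x \<in> \<Union>C"
    then show "finite (ball_in E x k)" using UV(1)[OF C] by (intro finite_ball_in[OF G]) auto
  qed
  ultimately have "num_bad V E k \<le> card (\<Union>C\<in>CC. \<Union>x\<in>\<Union>C. ball_in E x k)"
    by (rule card_mono[rotated])
  also have "\<dots> \<le> (\<Sum>C\<in>CC. card (\<Union>x\<in>\<Union>C. ball_in E x k))" by (rule card_UN_le[OF fCC])
  also have "\<dots> \<le> (\<Sum>C\<in>CC. (4 * k + 6) * (d + 1) ^ k)"
  proof (rule sum_mono)
    fix C assume C: "C \<in> CC"
    have fU: "finite (\<Union>C)" using UV(1)[OF C] fV finite_subset by blast
    have "card (\<Union>x\<in>\<Union>C. ball_in E x k) \<le> (\<Sum>x\<in>\<Union>C. card (ball_in E x k))" by (rule card_UN_le[OF fU])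
    also have "\<dots> \<le> (\<Sum>x\<in>\<Union>C. (d + 1) ^ k)"
      by (rule sum_mono) (use card_ball_in[OF R] UV(1)[OF C] in blast)
    also have "\<dots> \<le> (4 * k + 6) * (d + 1) ^ k" using UV(2)[OF C] by simp
    finally show "card (\<Union>x\<in>\<Union>C. ball_in E x k) \<le> (4 * k + 6) * (d + 1) ^ k" .
  qed
  also have "\<dots> = card CC * ((4 * k + 6) * (d + 1) ^ k)" by simp
  also have "card CC = num_short_cycles (V, E) (2 * int k + 4)"
    unfolding CC_def num_short_cycles_def ..
  finally show ?thesis .
qed

section \<open>The cavity recursion and the Bethe functional\<close>

lemma edge_ratio_pos: "0 < \<kappa> \<Longrightarrow> 0 \<le> s \<Longrightarrow> 0 < edge_ratio \<kappa> s"
  by (simp add: edge_ratio_def add_nonneg_pos add_pos_nonneg)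

lemma edge_ratio_mono:
  assumes "0 < \<kappa>" "\<kappa> \<le> 1" "0 \<le> s" "s \<le> t" shows "edge_ratio \<kappa> s \<le> edge_ratio \<kappa> t"
proof -
  have "\<kappa> * \<kappa> \<le> 1" using assms mult_le_one[of \<kappa> \<kappa>] by simp
  then have "0 \<le> (1 - \<kappa> * \<kappa>) * (t - s)" using assms by (intro mult_nonneg_nonneg) auto
  then have "(s + \<kappa>) * (1 + \<kappa> * t) \<le> (t + \<kappa>) * (1 + \<kappa> * s)" by (simp add: algebra_simps)
  moreover have "0 < 1 + \<kappa> * s" "0 < 1 + \<kappa> * t" using assms by (auto intro: add_pos_nonneg)
  ultimately show ?thesis unfolding edge_ratio_def by (simp add: frac_le_eq divide_le_0_iff)
qed

lemma edge_ratio_le_1: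
  assumes "0 < \<kappa>" "\<kappa> \<le> 1" "0 \<le> s" "s \<le> 1" shows "edge_ratio \<kappa> s \<le> 1"
  using edge_ratio_mono[of \<kappa> s 1] assms by (simp add: edge_ratio_def add.commute)

locale cavity =
  fixes d :: nat and \<kappa> \<mu> :: real
  assumes d: "0 < d" and \<kappa>: "0 < \<kappa>" "\<kappa> \<le> 1" and \<mu>: "0 < \<mu>" "\<mu> \<le> 1"
begin

abbreviation "F \<equiv> cavity_step d \<kappa> \<mu>"

lemma F_pos: "0 \<le> s \<Longrightarrow> 0 < F s"
  using \<mu> edge_ratio_pos[OF \<kappa>(1)] by (simp add: cavity_step_def)

lemma F_mono: "0 \<le> s \<Longrightarrow> s \<le> t \<Longrightarrow> F s \<le> F t"
  unfolding cavity_step_def using \<mu> \<kappa> edge_ratio_mono[of \<kappa> s t] edge_ratio_pos[of \<kappa> s]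
  by (intro mult_left_mono power_mono) auto

lemma F_le: "0 \<le> s \<Longrightarrow> s \<le> 1 \<Longrightarrow> F s \<le> \<mu>"
  unfolding cavity_step_def using \<mu> \<kappa> edge_ratio_le_1[of \<kappa> s] edge_ratio_pos[of \<kappa> s]
  by (simp add: mult_left_le power_le_one)

lemma iter_bounds: "F 0 \<le> (F ^^ k) \<mu> \<and> (F ^^ k) \<mu> \<le> \<mu>"
proof (induction k)
  case 0 then show ?case using F_le[of 0] by simp
next
  case (Suc k)
  then have "0 \<le> (F ^^ k) \<mu>" using F_pos[of 0] by simp
  with Suc show ?case using F_mono[of 0] F_le[of "(F ^^ k) \<mu>"] \<mu> by auto
qed

lemma iter_nonneg: "0 \<le> (F ^^ k) \<mu>" using iter_bounds[of k] F_pos[of 0] by simp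

lemma iter_decseq: "decseq (\<lambda>k. (F ^^ k) \<mu>)"
proof (rule decseq_SucI)
  fix k show "(F ^^ Suc k) \<mu> \<le> (F ^^ k) \<mu>"
  proof (induction k)
    case 0 then show ?case using F_le[of \<mu>] \<mu> by simp
  next
    case (Suc k)
    then show ?case using F_mono[OF iter_nonneg Suc] by simp
  qed
qed

text \<open>Since \<open>F\<close> is increasing and the iteration starts at the message
  \<open>\<mu>\<close> of a free leaf, this is the largest fixed point in
  \<open>[0, \<mu>]\<close>.\<close>

definition fixpt :: real where "fixpt = lim (\<lambda>k. (F ^^ k) \<mu>)"

lemma iter_tendsto: "(\<lambda>k. (F ^^ k) \<mu>) \<longlonglongrightarrow> fixpt"
proof -
  have "convergent (\<lambda>k. (F ^^ k) \<mu>)"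
    using decseq_convergent[OF iter_decseq, of "F 0"] iter_bounds convergentI by metis
  then show ?thesis unfolding fixpt_def convergent_LIMSEQ_iff .
qed

lemma fixpt_pos: "0 < fixpt"
  using LIMSEQ_le_const[OF iter_tendsto, of "F 0"] iter_bounds F_pos[of 0] by force

lemma fixpt_le: "fixpt \<le> \<mu>"
  using LIMSEQ_le_const2[OF iter_tendsto, of \<mu>] iter_bounds by blast

lemma F_tendsto: "X \<longlonglongrightarrow> s \<Longrightarrow> 0 \<le> s \<Longrightarrow> (\<lambda>n. F (X n)) \<longlonglongrightarrow> F s"
  unfolding cavity_step_def edge_ratio_def using \<kappa> by (intro tendsto_intros) (auto simp: add_nonneg_eq_0_iff)

lemma fixpt: "F fixpt = fixpt"
proof -
  have "(\<lambda>k. (F ^^ Suc k) \<mu>) \<longlonglongrightarrow> F fixpt"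
    using F_tendsto[OF iter_tendsto] fixpt_pos by simp
  moreover have "(\<lambda>k. (F ^^ Suc k) \<mu>) \<longlonglongrightarrow> fixpt"
    using LIMSEQ_Suc[OF iter_tendsto] by simp
  ultimately show ?thesis using LIMSEQ_unique by blast
qed

end

text \<open>In the logarithmic variable \<open>\<tau> = - ln s\<close> the map \<open>ln (edge_ratio \<kappa> s)\<close> is convex.\<close>

lemma convex_ln_edge_ratio:
  assumes "0 < \<kappa>" "\<kappa> \<le> 1"
  shows "convex_on {0..} (\<lambda>\<tau>. ln (exp (- \<tau>) + \<kappa>) - ln (1 + \<kappa> * exp (- \<tau>)))"
proof (rule convex_on_realI[where f' = "\<lambda>\<tau>. - ((1 - \<kappa> * \<kappa>) * (exp (- \<tau>) / ((exp (- \<tau>) + \<kappa>) * (1 + \<kappa> * exp (- \<tau>)))))"])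
  show "((\<lambda>\<tau>. ln (exp (- \<tau>) + \<kappa>) - ln (1 + \<kappa> * exp (- \<tau>))) has_real_derivative
    - ((1 - \<kappa> * \<kappa>) * (exp (- x) / ((exp (- x) + \<kappa>) * (1 + \<kappa> * exp (- x)))))) (at x)" for x
  proof -
    have p: "0 < exp (- x) + \<kappa>" "0 < 1 + \<kappa> * exp (- x)" using assms by (auto intro: add_pos_pos)
    show ?thesis
      by (rule derivative_eq_intros refl | use p in \<open>simp; fail\<close>)+
        (use p in \<open>simp add: divide_simps, simp add: algebra_simps\<close>)
  qed
next
  fix x y :: real assume "x \<in> {0..}" "y \<in> {0..}" "x \<le> y"
  define s t where "s = exp (- x)" and "t = exp (- y)"
  have st: "0 < t" "t \<le> s" "s \<le> 1" using \<open>x \<in> {0..}\<close> \<open>x \<le> y\<close> by (auto simp: s_def t_def)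
  \<comment> \<open>The cross-multiplied difference of the derivatives is
    \<open>\<kappa> * (s - t) * (1 - s * t)\<close>, so convexity rests on
    \<open>s, t \<le> 1\<close>, that is on \<open>\<tau> \<ge> 0\<close>.\<close>
  have "s * t \<le> 1" using st by (intro mult_le_one) auto
  then have "0 \<le> \<kappa> * ((s - t) * (1 - s * t))" using assms st by simp
  then have "t * ((s + \<kappa>) * (1 + \<kappa> * s)) \<le> s * ((t + \<kappa>) * (1 + \<kappa> * t))" by (simp add: algebra_simps)
  moreover have "0 < (s + \<kappa>) * (1 + \<kappa> * s)" "0 < (t + \<kappa>) * (1 + \<kappa> * t)"
    using assms st by (auto intro!: mult_pos_pos add_pos_pos)
  ultimately have "t / ((t + \<kappa>) * (1 + \<kappa> * t)) \<le> s / ((s + \<kappa>) * (1 + \<kappa> * s))"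
    by (simp only: pos_divide_le_eq pos_le_divide_eq times_divide_eq_left)
  moreover have "\<kappa> * \<kappa> \<le> 1" using assms mult_le_one[of \<kappa> \<kappa>] by simp
  ultimately show "- ((1 - \<kappa> * \<kappa>) * (exp (- x) / ((exp (- x) + \<kappa>) * (1 + \<kappa> * exp (- x)))))
     \<le> - ((1 - \<kappa> * \<kappa>) * (exp (- y) / ((exp (- y) + \<kappa>) * (1 + \<kappa> * exp (- y)))))"
    unfolding s_def t_def by (intro le_imp_neg_le mult_left_mono) auto
qed auto

text \<open>The exponential of the Bethe free energy per vertex: the numerator is the weight of a
  vertex receiving \<open>s\<close> from \<open>d\<close> neighbours, and
  \<open>1 + 2 * \<kappa> * s + s\<^sup>2\<close> that of an edge receiving \<open>s\<close> at both
  ends, with \<open>d / 2\<close> edges per vertex.\<close>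

definition bethe :: "nat \<Rightarrow> real \<Rightarrow> real \<Rightarrow> real \<Rightarrow> real" where
  "bethe d \<kappa> \<mu> s = ((1 + \<kappa> * s) ^ d + \<mu> * (s + \<kappa>) ^ d) / sqrt (1 + 2 * \<kappa> * s + s\<^sup>2) ^ d"

lemma bethe_factors_pos:
  assumes "0 < (\<kappa>::real)" "0 \<le> s"
  shows "0 < 1 + \<kappa> * s" "0 < s + \<kappa>" "0 < 1 + 2 * \<kappa> * s + s\<^sup>2"
proof -
  have "0 \<le> \<kappa> * s" using assms by simp
  then show "0 < 1 + \<kappa> * s" "0 < s + \<kappa>" "0 < 1 + 2 * \<kappa> * s + s\<^sup>2"
    using assms by (auto simp: add_pos_nonneg)
qed

context cavity
begin

text \<open>In \<open>\<tau> = - ln s\<close>, the convex function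
  \<open>ln (edge_ratio \<kappa> s)\<close> vanishes at \<open>0\<close>, so at \<open>fixpt\<close>
  it lies below the chord from \<open>0\<close> to \<open>- ln s\<close>. Inserted in the fixed
  point equation with \<open>c = ln fixpt / ln s\<close> this gives
  \<open>c * ln s \<le> c * ln (F s)\<close>, as \<open>c \<le> 1\<close> and
  \<open>ln \<mu> \<le> 0\<close>. Strictness of \<open>\<mu> < 1\<close> keeps
  \<open>ln fixpt\<close> away from \<open>0\<close>.\<close>

lemma F_ge:
  assumes \<mu>1: "\<mu> < 1" and s: "0 \<le> s" "s \<le> fixpt"
  shows "s \<le> F s"
proof (cases "s = 0")
  case True then show ?thesis using F_pos[of 0] by simp
next
  case False
  then have s0: "0 < s" using s by simp
  let ?f = "\<lambda>\<tau>. ln (exp (- \<tau>) + \<kappa>) - ln (1 + \<kappa> * exp (- \<tau>))"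
  let ?t = "fixpt"
  have t: "0 < ?t" "?t < 1" using fixpt_pos fixpt_le \<mu>1 by auto
  have lt: "ln ?t < 0" "ln s \<le> ln ?t" using t s0 s by auto
  define c where "c = ln ?t / ln s"
  have c: "0 < c" "c \<le> 1" using lt by (auto simp: c_def divide_simps)
  have f: "?f (- ln u) = ln (edge_ratio \<kappa> u)" if "0 < u" for u
  proof -
    have "0 < u + \<kappa>" "0 < 1 + \<kappa> * u" using that \<kappa> by (auto intro: add_pos_pos)
    then show ?thesis using that by (simp add: edge_ratio_def ln_div)
  qed
  have "?f ((1 - c) *\<^sub>R 0 + c *\<^sub>R (- ln s)) \<le> (1 - c) * ?f 0 + c * ?f (- ln s)"
    using c lt by (intro convex_onD[OF convex_ln_edge_ratio[OF \<kappa>]]) auto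
  moreover have "(1 - c) *\<^sub>R 0 + c *\<^sub>R (- ln s) = - ln ?t" using lt by (simp add: c_def)
  moreover have "?f 0 = 0" by (simp add: add.commute)
  ultimately have conv: "ln (edge_ratio \<kappa> ?t) \<le> c * ln (edge_ratio \<kappa> s)"
    using f[OF t(1)] f[OF s0] by simp
  have lnF: "ln (F u) = ln \<mu> + real (d - 1) * ln (edge_ratio \<kappa> u)" if "0 < u" for u
    using that edge_ratio_pos[OF \<kappa>(1), of u] \<mu> by (simp add: cavity_step_def ln_mult ln_realpow)
  have "c * ln s = ln ?t" using lt by (simp add: c_def)
  also have "\<dots> = ln (F ?t)" by (simp add: fixpt)
  also have "\<dots> \<le> ln \<mu> + real (d - 1) * (c * ln (edge_ratio \<kappa> s))"
    unfolding lnF[OF t(1)] using conv by (intro add_left_mono mult_left_mono) auto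
  also have "\<dots> \<le> c * ln \<mu> + real (d - 1) * (c * ln (edge_ratio \<kappa> s))"
    using c \<mu> by (simp add: mult_le_cancel_right1)
  also have "\<dots> = c * ln (F s)" unfolding lnF[OF s0] by (simp add: algebra_simps)
  finally have "ln s \<le> ln (F s)" using c by simp
  then show ?thesis using s0 F_pos[of s] by simp
qed

lemma bethe_pos: 
  assumes "0 \<le> s" shows "0 < bethe d \<kappa> \<mu> s"
proof -
  have "0 < 1 + \<kappa> * s" "0 < 1 + 2 * \<kappa> * s + s\<^sup>2" "0 < s + \<kappa>"
    using bethe_factors_pos[OF \<kappa>(1) assms] by auto
  then show ?thesis unfolding bethe_def using \<mu> by (simp add: add_pos_pos)
qed

lemma ln_bethe:
  assumes "0 \<le> s"
  shows "ln (bethe d \<kappa> \<mu> s) = ln ((1 + \<kappa> * s) ^ d + \<mu> * (s + \<kappa>) ^ d) - d / 2 * ln (1 + 2 * \<kappa> * s + s\<^sup>2)"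
proof -
  have p: "0 < 1 + 2 * \<kappa> * s + s\<^sup>2" "0 < (1 + \<kappa> * s) ^ d + \<mu> * (s + \<kappa>) ^ d"
    using \<mu> bethe_factors_pos[OF \<kappa>(1) assms] by (auto intro: add_pos_pos)
  then show ?thesis unfolding bethe_def
    by (simp add: ln_div ln_realpow ln_sqrt)
qed

text \<open>The derivative of the logarithm is a nonnegative multiple of \<open>Q - x * P\<close>,
  where \<open>Q / P = F x\<close>; so \<open>bethe\<close> increases as long as
  \<open>x \<le> F x\<close>, which \<open>F_ge\<close> guarantees up to the fixed point.\<close>

lemma bethe_mono:
  assumes \<mu>1: "\<mu> < 1" and s: "0 \<le> s" "s \<le> t" "t \<le> fixpt"
  shows "bethe d \<kappa> \<mu> s \<le> bethe d \<kappa> \<mu> t"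
proof -
  let ?N = "\<lambda>s. (1 + \<kappa> * s) ^ d + \<mu> * (s + \<kappa>) ^ d" and ?D = "\<lambda>s. 1 + 2 * \<kappa> * s + s\<^sup>2"
  let ?L = "\<lambda>s. ln (?N s) - d / 2 * ln (?D s)"
  obtain e where e: "d = Suc e" using d not0_implies_Suc by auto
  have "?L s \<le> ?L t"
  proof (rule DERIV_nonneg_imp_nondecreasing[OF s(2)])
    fix x assume x: "s \<le> x" "x \<le> t"
    have x0: "0 \<le> x" using x s by simp
    define A B P Q where "A = 1 + \<kappa> * x" and "B = x + \<kappa>" and "P = A ^ e" and "Q = \<mu> * B ^ e"
    have pos: "0 < A" "0 < B" unfolding A_def B_def using \<kappa> x0 by (auto intro: add_pos_nonneg add_nonneg_pos)
    have PQ: "0 < P" "0 < Q" unfolding P_def Q_def using pos \<mu> by auto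
    have N: "?N x = P * A + Q * B" unfolding e P_def Q_def A_def B_def by simp
    have D: "?D x = x * B + A" unfolding A_def B_def by (simp add: power2_eq_square algebra_simps)
    have Npos: "0 < ?N x" unfolding N using pos PQ by (simp add: add_pos_pos)
    have Dpos: "0 < ?D x" unfolding D using pos x0 by (simp add: add_nonneg_pos)
    have "F x = Q / P * 1" unfolding cavity_step_def edge_ratio_def e P_def Q_def A_def B_def
      by (simp add: power_divide)
    then have QP: "x * P \<le> Q" using F_ge[OF \<mu>1 x0] x s PQ by (simp add: pos_le_divide_eq)
    have der: "(?L has_real_derivative (d * (\<kappa> * P + Q)) / ?N x - d / 2 * (2 * B / ?D x)) (at x)"
    proof -
      have dN: "(?N has_real_derivative d * (\<kappa> * P + Q)) (at x)"
        by (rule derivative_eq_intros refl)+ (simp add: e P_def Q_def A_def B_def algebra_simps)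
      have dD: "(?D has_real_derivative 2 * B) (at x)"
        by (rule derivative_eq_intros refl)+ (simp add: B_def algebra_simps)
      show ?thesis
        by (rule DERIV_cong[OF DERIV_diff[OF DERIV_chain2[OF DERIV_ln_divide[OF Npos] dN]
            DERIV_cmult[OF DERIV_chain2[OF DERIV_ln_divide[OF Dpos] dD]]]]) simp
    qed
    have "(\<kappa> * P + Q) * ?D x - B * ?N x = (1 - \<kappa> * \<kappa>) * (Q - x * P)"
      unfolding N D A_def B_def by (simp add: algebra_simps)
    moreover have "\<kappa> * \<kappa> \<le> 1" using \<kappa> mult_le_one[of \<kappa> \<kappa>] by simp
    ultimately have "B * ?N x \<le> (\<kappa> * P + Q) * ?D x"
      using QP mult_nonneg_nonneg[of "1 - \<kappa> * \<kappa>" "Q - x * P"] by linarith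
    then have "B / ?D x \<le> (\<kappa> * P + Q) / ?N x"
      using Npos Dpos by (simp only: pos_divide_le_eq pos_le_divide_eq times_divide_eq_left)
    then have "0 \<le> d * ((\<kappa> * P + Q) / ?N x - B / ?D x)" by (intro mult_nonneg_nonneg) auto
    then have "0 \<le> (d * (\<kappa> * P + Q)) / ?N x - d / 2 * (2 * B / ?D x)" by (simp add: algebra_simps)
    with der show "\<exists>y. (?L has_real_derivative y) (at x) \<and> 0 \<le> y" by blast
  qed
  then have "ln (bethe d \<kappa> \<mu> s) \<le> ln (bethe d \<kappa> \<mu> t)"
    using ln_bethe[of s] ln_bethe[of t] s by simp
  then show ?thesis using bethe_pos[of s] bethe_pos[of t] s by simp
qed

text \<open>The probability that a vertex of the infinite tree carries a minus spin, when the
  minus to plus ratio of the cavity messages is \<open>s\<close>.\<close>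

definition minus_prob :: "real \<Rightarrow> real" where
  "minus_prob s = \<mu> * edge_ratio \<kappa> s ^ d / (1 + \<mu> * edge_ratio \<kappa> s ^ d)"

lemma minus_prob_bounds:
  assumes "0 \<le> s" shows "0 \<le> minus_prob s \<and> minus_prob s \<le> 1"
proof -
  have "0 \<le> \<mu> * edge_ratio \<kappa> s ^ d" using edge_ratio_pos[OF \<kappa>(1) assms] \<mu> by simp
  then show ?thesis unfolding minus_prob_def by simp
qed

lemma minus_prob_iter_tendsto: "(\<lambda>k. minus_prob ((F ^^ k) \<mu>)) \<longlonglongrightarrow> minus_prob fixpt"
proof -
  have "0 < edge_ratio \<kappa> fixpt" using edge_ratio_pos[OF \<kappa>(1)] fixpt_pos by simp
  then have "1 + \<mu> * edge_ratio \<kappa> fixpt ^ d > 0" using \<mu> by (simp add: add_pos_nonneg)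
  moreover have "1 + \<kappa> * fixpt > 0" using \<kappa> fixpt_pos by (simp add: add_pos_nonneg)
  ultimately show ?thesis unfolding minus_prob_def edge_ratio_def
    by (intro tendsto_intros iter_tendsto) (auto simp: edge_ratio_def)
qed

text \<open>At fixed \<open>s\<close>, \<open>ln (bethe d \<kappa> \<mu> s)\<close> is convex in
  \<open>ln \<mu>\<close> with slope \<open>minus_prob s\<close>, and a convex function lies above
  its tangent.\<close>

lemma ln_bethe_activity:
  assumes \<mu>': "\<mu> \<le> \<mu>'" and s: "0 \<le> s"
  shows "ln (bethe d \<kappa> \<mu> s) + ln (\<mu>' / \<mu>) * minus_prob s \<le> ln (bethe d \<kappa> \<mu>' s)"
proof -
  define X Y L p where "X = (s + \<kappa>) ^ d" and "Y = (1 + \<kappa> * s) ^ d" and "L = ln (\<mu>' / \<mu>)" and "p = minus_prob s"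
  have XY: "0 < X" "0 < Y" unfolding X_def Y_def using \<kappa> s by (auto intro!: zero_less_power add_nonneg_pos add_pos_nonneg)
  have p: "p = \<mu> * X / (Y + \<mu> * X)"
    unfolding p_def minus_prob_def edge_ratio_def X_def[symmetric] Y_def[symmetric] power_divide
    using XY \<mu> by (simp add: field_simps)
  have eL: "exp L = \<mu>' / \<mu>" unfolding L_def using \<mu> \<mu>' by simp
  have p01: "0 \<le> p" "p \<le> 1" using minus_prob_bounds[OF s] unfolding p_def by auto
  have "exp ((1 - p) *\<^sub>R 0 + p *\<^sub>R L) \<le> (1 - p) * exp 0 + p * exp L"
    using p01 by (intro convex_onD[OF exp_convex]) auto
  also have "\<dots> = (Y + \<mu>' * X) / (Y + \<mu> * X)"
  proof -
    have "0 < Y + \<mu> * X" using XY \<mu> by (simp add: add_pos_pos)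
    then have "1 - p = Y / (Y + \<mu> * X)" "p * (\<mu>' / \<mu>) = \<mu>' * X / (Y + \<mu> * X)"
      unfolding p using \<mu> by (simp_all add: diff_divide_eq_iff)
    then show ?thesis unfolding eL by (simp add: add_divide_distrib)
  qed
  finally have "exp (L * p) * (Y + \<mu> * X) \<le> Y + \<mu>' * X"
    using XY \<mu> by (simp add: pos_le_divide_eq add_pos_pos mult.commute)
  then have "ln (exp (L * p) * (Y + \<mu> * X)) \<le> ln (Y + \<mu>' * X)"
    using XY \<mu> by (subst ln_le_cancel_iff) (auto intro!: mult_pos_pos add_pos_pos simp: \<mu>' order.strict_trans2)
  moreover have "Y + \<mu> * X > 0" using XY \<mu> by (simp add: add_pos_pos)
  ultimately have "L * p + ln (Y + \<mu> * X) \<le> ln (Y + \<mu>' * X)" by (simp add: ln_mult)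
  moreover have "ln (bethe d \<kappa> m s) = ln (Y + m * X) - d / 2 * ln (1 + 2 * \<kappa> * s + s\<^sup>2)" if "0 < m" for m
  proof -
    have "0 < 1 + 2 * \<kappa> * s + s\<^sup>2" "0 < Y + m * X"
      using bethe_factors_pos[OF \<kappa>(1) s] XY that by (auto intro: add_pos_pos)
    then show ?thesis unfolding bethe_def X_def Y_def by (simp add: ln_div ln_realpow ln_sqrt)
  qed
  ultimately show ?thesis unfolding L_def p_def using \<mu> \<mu>' by simp
qed

end

lemma fixpt_activity_mono:
  assumes "cavity d \<kappa> \<mu>" "cavity d \<kappa> \<mu>'" "\<mu> \<le> \<mu>'"
  shows "cavity.fixpt d \<kappa> \<mu> \<le> cavity.fixpt d \<kappa> \<mu>'"
proof -
  interpret A: cavity d \<kappa> \<mu> by fact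
  interpret B: cavity d \<kappa> \<mu>' by fact
  have step: "A.F t \<le> B.F t" if "0 \<le> t" for t
    unfolding cavity_step_def using assms(3) edge_ratio_pos[OF A.\<kappa>(1) that]
    by (intro mult_right_mono) auto
  have "(A.F ^^ k) \<mu> \<le> (B.F ^^ k) \<mu>'" for k
  proof (induction k)
    case (Suc k)
    have "A.F ((A.F ^^ k) \<mu>) \<le> A.F ((B.F ^^ k) \<mu>')"
      using A.F_mono[OF A.iter_nonneg Suc] .
    also have "\<dots> \<le> B.F ((B.F ^^ k) \<mu>')"
      using step[OF B.iter_nonneg[of k]] .
    finally show ?case by simp
  qed (use assms in simp)
  then show ?thesis using LIMSEQ_le[OF A.iter_tendsto B.iter_tendsto] by blast
qed

section \<open>Interpolation in the activity\<close>

definition ising_Z :: "'v set \<Rightarrow> 'v set set \<Rightarrow> real \<Rightarrow> real \<Rightarrow> real" where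
  "ising_Z V E \<kappa> \<mu> = (\<Sum>S\<in>Pow V. ising_hom E \<kappa> \<mu> S)"

lemma ising_wt_pos: "0 < \<kappa> \<Longrightarrow> 0 < \<mu> \<Longrightarrow> 0 < ising_hom E \<kappa> \<mu> S"
  by (simp add: ising_wt_def)

lemma ising_Z_pos: "finite V \<Longrightarrow> 0 < \<kappa> \<Longrightarrow> 0 < \<mu> \<Longrightarrow> 0 < ising_Z V E \<kappa> \<mu>"
  unfolding ising_Z_def by (intro sum_pos ising_wt_pos) auto

text \<open>Dropping the edge weights leaves \<open>(1 + \<mu>) ^ card V\<close>. This closes the
  interpolation at its low end, in place of a limit \<open>\<mu> \<rightarrow> 0\<close>.\<close>

lemma ising_Z_le:
  fixes \<kappa> \<mu> :: real
  assumes "finite V" "0 < \<kappa>" "\<kappa> \<le> 1" "0 < \<mu>"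
  shows "ln (ising_Z V E \<kappa> \<mu>) \<le> card V * \<mu>"
proof -
  have "ising_hom E \<kappa> \<mu> S \<le> (\<Prod>v\<in>V. if v \<in> S then \<mu> else 1)" if "S \<in> Pow V" for S
  proof -
    have "(\<Prod>v\<in>S. \<mu>) = (\<Prod>v\<in>V. if v \<in> S then \<mu> else 1)"
      using that assms(1) by (intro prod.mono_neutral_cong_left) auto
    moreover have "(\<Prod>v\<in>S. \<mu>) * \<kappa> ^ card {e \<in> E. card (e \<inter> S) = 1} \<le> (\<Prod>v\<in>S. \<mu>)"
      using assms by (intro mult_left_le power_le_one prod_nonneg) auto
    ultimately show ?thesis by (simp add: ising_wt_def)
  qed
  then have "ising_Z V E \<kappa> \<mu> \<le> (\<Prod>v\<in>V. \<mu> + 1)"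
    unfolding ising_Z_def sum_Pow_prod[OF assms(1), symmetric] by (rule sum_mono)
  then have "ln (ising_Z V E \<kappa> \<mu>) \<le> ln ((1 + \<mu>) ^ card V)"
    using ising_Z_pos[OF assms(1,2,4), of E] assms by (simp add: add.commute)
  also have "\<dots> = card V * ln (1 + \<mu>)" using assms by (simp add: ln_realpow)
  also have "\<dots> \<le> card V * \<mu>" using assms ln_add_one_self_le_self[of \<mu>] by (intro mult_left_mono) auto
  finally show ?thesis .
qed

text \<open>\<open>ln Z\<close> is convex in \<open>ln \<mu>\<close>, and its slope at
  \<open>\<mu>\<close> is the mean number of minus spins; the claim is the tangent inequality,
  obtained from \<open>1 + y \<le> exp y\<close> for each configuration. The mean is needed at the
  larger activity only.\<close>

lemma ising_Z_jensen:
  fixes V :: "'v set" and \<kappa> \<mu> \<mu>' m :: real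
  assumes V: "finite V" and \<kappa>: "0 < \<kappa>" and \<mu>: "0 < \<mu>'" "\<mu>' \<le> \<mu>"
    and mean: "(\<Sum>S\<in>Pow V. card S * ising_hom E \<kappa> \<mu> S) \<le> m * ising_Z V E \<kappa> \<mu>"
  shows "ln (ising_Z V E \<kappa> \<mu>) \<le> ln (ising_Z V E \<kappa> \<mu>') + ln (\<mu> / \<mu>') * m"
proof -
  define L where "L = ln (\<mu> / \<mu>')"
  have L: "0 \<le> L" "exp (- L) = \<mu>' / \<mu>" unfolding L_def using \<mu> by (simp_all add: exp_minus)
  let ?w = "ising_hom E \<kappa> \<mu>" and ?Z = "ising_Z V E \<kappa>"
  have "exp (- (L * m)) * ?Z \<mu> \<le> exp (- (L * m)) * (?Z \<mu> + L * (m * ?Z \<mu> - (\<Sum>S\<in>Pow V. card S * ?w S)))"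
    using mean L by (intro mult_left_mono) auto
  also have "\<dots> = (\<Sum>S\<in>Pow V. ?w S * (exp (- (L * m)) * (1 + L * (m - card S))))"
    unfolding ising_Z_def by (simp add: algebra_simps sum.distrib sum_distrib_left sum_subtractf)
  also have "\<dots> \<le> (\<Sum>S\<in>Pow V. ising_hom E \<kappa> \<mu>' S)"
  proof (rule sum_mono)
    fix S :: "'v set"
    have "exp (- (L * m)) * (1 + L * (m - card S)) \<le> exp (- (L * m)) * exp (L * (m - card S))"
      by (intro mult_left_mono exp_ge_add_one_self) auto
    also have "\<dots> = exp (- L) ^ card S"
      by (simp add: exp_add[symmetric] exp_of_nat_mult[symmetric] algebra_simps)
    also have "\<dots> = (\<mu>' / \<mu>) ^ card S" by (simp add: L)
    finally have "?w S * (exp (- (L * m)) * (1 + L * (m - card S))) \<le> ?w S * (\<mu>' / \<mu>) ^ card S"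
      using ising_wt_pos[of \<kappa> \<mu> E S] \<kappa> \<mu> by (intro mult_left_mono) auto
    also have "\<dots> = ising_hom E \<kappa> \<mu>' S"
      using \<mu> by (simp add: ising_wt_def power_divide)
    finally show "?w S * (exp (- (L * m)) * (1 + L * (m - card S))) \<le> ising_hom E \<kappa> \<mu>' S" .
  qed
  finally have "exp (- (L * m)) * ?Z \<mu> \<le> ?Z \<mu>'" unfolding ising_Z_def .
  moreover have "0 < ?Z \<mu>" "0 < ?Z \<mu>'" using \<mu> \<kappa> V by (auto intro: ising_Z_pos)
  ultimately have "ln (exp (- (L * m)) * ?Z \<mu>) \<le> ln (?Z \<mu>')" by simp
  then have "- (L * m) + ln (?Z \<mu>) \<le> ln (?Z \<mu>')" using \<open>0 < ?Z \<mu>\<close> by (simp add: ln_mult)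
  then show ?thesis unfolding L_def by simp
qed

lemma ising_mean_eq:
  assumes "finite V"
  shows "(\<Sum>S\<in>Pow V. card S * ising_wt E m \<kappa> S) = (\<Sum>v\<in>V. \<Sum>S\<in>{S \<in> Pow V. v \<in> S}. ising_wt E m \<kappa> S)"
proof -
  have "(\<Sum>S\<in>Pow V. card S * ising_wt E m \<kappa> S) = (\<Sum>S\<in>Pow V. \<Sum>v\<in>{v \<in> V. v \<in> S}. ising_wt E m \<kappa> S)"
    by (intro sum.cong) (auto simp: Int_absorb1 inf.absorb2 Collect_conj_eq)
  also have "\<dots> = (\<Sum>v\<in>V. \<Sum>S\<in>{S \<in> Pow V. v \<in> S}. ising_wt E m \<kappa> S)"
    using assms by (intro sum.swap_restrict) auto
  finally show ?thesis .
qed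

lemma ising_mean_le_card:
  assumes "finite V" "0 < \<kappa>" "0 < \<mu>"
  shows "(\<Sum>S\<in>Pow V. card S * ising_hom E \<kappa> \<mu> S) \<le> card V * ising_Z V E \<kappa> \<mu>"
  unfolding ising_Z_def sum_distrib_left
  by (intro sum_mono mult_right_mono) (use assms ising_wt_pos[of \<kappa> \<mu> E] in \<open>auto intro: card_mono less_imp_le\<close>)

text \<open>At a vertex with a tree ball, the ratio bound \<open>r\<close> gives the probability
  bound \<open>r / (1 + r)\<close>; every other vertex is charged probability 1.\<close>

lemma ising_mean_bound:
  assumes R: "regular_graph d (V, E)" and "cavity d \<kappa> \<mu>"
  shows "(\<Sum>S\<in>Pow V. card S * ising_hom E \<kappa> \<mu> S) \<le>
    (card V * cavity.minus_prob d \<kappa> \<mu> ((cavity_step d \<kappa> \<mu> ^^ k) \<mu>) +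
      num_bad V E (Suc k)) * ising_Z V E \<kappa> \<mu>"
proof -
  interpret cavity d \<kappa> \<mu> by fact
  have fV: "finite V" using R by (simp add: regular_graph_def fin_graph_def)
  let ?w = "ising_hom E \<kappa> \<mu>" and ?Z = "ising_Z V E \<kappa> \<mu>"
  define p where "p = minus_prob ((F ^^ k) \<mu>)"
  have p: "0 \<le> p" unfolding p_def using minus_prob_bounds[OF iter_nonneg] by blast
  let ?M = "\<lambda>v. \<Sum>S\<in>{S \<in> Pow V. v \<in> S}. ?w S" and ?P = "\<lambda>v. \<Sum>S\<in>{S \<in> Pow V. v \<notin> S}. ?w S"
  have Z: "?Z = ?M v + ?P v" for v
    unfolding ising_Z_def using fV by (subst sum.union_disjoint[symmetric]) (auto intro!: sum.cong)
  have P: "0 \<le> ?P v" "0 \<le> ?M v" for v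
    by (intro sum_nonneg less_imp_le[OF ising_wt_pos[OF \<kappa>(1) \<mu>(1)]])+
  have "?M v \<le> (p + (if tree_ball E v (Suc k) then 0 else 1)) * ?Z" if v: "v \<in> V" for v
  proof (cases "tree_ball E v (Suc k)")
    case True
    define r where "r = \<mu> * edge_ratio \<kappa> ((F ^^ k) \<mu>) ^ d"
    have r: "0 \<le> r" unfolding r_def using edge_ratio_pos[OF \<kappa>(1) iter_nonneg] \<mu> by (simp add: less_imp_le)
    have "?M v \<le> r * ?P v" unfolding r_def by (rule tree_ball_bound[OF R v True \<kappa> \<mu>])
    then have "?M v * (1 + r) \<le> r * ?Z" unfolding Z[of v] by (simp add: algebra_simps)
    then have "?M v \<le> r * ?Z / (1 + r)" using r by (simp add: pos_le_divide_eq)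
    then show ?thesis using True unfolding p_def minus_prob_def r_def by simp
  next
    case False
    have "?M v \<le> ?Z" using Z[of v] P[of v] by simp
    also have "\<dots> \<le> (p + 1) * ?Z" using p ising_Z_pos[OF fV \<kappa>(1) \<mu>(1), of E] by (simp add: algebra_simps)
    finally show ?thesis using False by simp
  qed
  then have "(\<Sum>v\<in>V. ?M v) \<le> (\<Sum>v\<in>V. (p + (if tree_ball E v (Suc k) then 0 else 1)) * ?Z)"
    by (rule sum_mono)
  also have "\<dots> = (card V * p + num_bad V E (Suc k)) * ?Z"
  proof -
    have "(\<Sum>v\<in>V. if tree_ball E v (Suc k) then 0 else (1::real)) = num_bad V E (Suc k)"
      using fV by (simp add: sum.If_cases Int_def)
    then show ?thesis by (simp add: sum_distrib_right[symmetric] sum.distrib)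
  qed
  finally show ?thesis unfolding ising_mean_eq[OF fV] p_def .
qed

text \<open>On a geometric grid of activities, a decrement of \<open>ln Z\<close> is bounded by the
  tree density and the latter by a decrement of the Bethe functional. The message \<open>s\<close>
  need not be a fixed point at \<open>\<mu>\<close> itself, since \<open>bethe_le_Phi_max\<close>
  covers every \<open>s \<ge> 0\<close>.\<close>

lemma ising_upper:
  assumes d: "0 < d" and \<kappa>: "0 < \<kappa>" "\<kappa> \<le> 1" and \<mu>: "0 < \<mu>" "\<mu> \<le> 1" and \<epsilon>: "0 < \<epsilon>"
  shows "\<exists>s K (C::real). 0 \<le> s \<and> s \<le> 1 \<and> 0 \<le> C \<and> (\<forall>(V :: 'v set) E. regular_graph d (V, E) \<longrightarrow>
    ln (ising_Z V E \<kappa> \<mu>) \<le> card V * (ln (bethe d \<kappa> \<mu> s) + \<epsilon>) + C * num_bad V E (Suc K))"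
proof -
  \<comment> \<open>Two losses of \<open>\<delta>\<close> per vertex occur: the crude first step,
    and the mismatch between densities at neighbouring grid points.\<close>
  define \<delta> where "\<delta> = \<epsilon> / 8"
  have \<delta>: "0 < \<delta>" using \<epsilon> by (simp add: \<delta>_def)
  define m where "m i = \<mu> * exp (- (real i * \<delta>))" for i
  have mpos: "0 < m i" for i using \<mu> by (simp add: m_def)
  have mSuc: "m (Suc i) \<le> m i" "ln (m i / m (Suc i)) = \<delta>" for i
    using \<mu> \<delta> unfolding m_def by (simp_all add: exp_add[symmetric] exp_diff[symmetric] algebra_simps flip: exp_diff)
  have mle: "m i \<le> \<mu>" for i using \<mu> \<delta> by (simp add: m_def)
  have cav: "cavity d \<kappa> (m i)" for i
    using d \<kappa> mpos[of i] mle[of i] \<mu> by unfold_locales auto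
  have "(\<lambda>i. \<mu> * exp (- (real i * \<delta>))) \<longlonglongrightarrow> 0" using \<delta> by real_asymp
  then have "eventually (\<lambda>i. m i < \<epsilon> / 4) sequentially"
    unfolding m_def using \<epsilon> by (auto dest!: order_tendstoD(2)[of _ _ _ "\<epsilon> / 4"])
  then obtain N where N: "m N < \<epsilon> / 4" "1 \<le> N"
    by (metis eventually_sequentially le_cases)
  \<comment> \<open>The error \<open>\<eta>\<close> of the density at depth \<open>K\<close> is
    incurred over a total length of at most \<open>N * \<delta>\<close> in \<open>ln \<mu>\<close>,
    which makes \<open>\<epsilon> / 4\<close> per vertex. One \<open>K\<close> serves all grid
    points because they are finitely many.\<close>
  define \<eta> where "\<eta> = \<epsilon> / (4 * (N * \<delta>))"
  have N\<delta>: "0 < N * \<delta>" using N \<delta> by simp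
  have \<eta>: "0 < \<eta>" unfolding \<eta>_def using \<epsilon> N\<delta> by simp
  define s p \<psi> where "s i = cavity.fixpt d \<kappa> (m i)" and "p i = cavity.minus_prob d \<kappa> (m i) (s i)"
    and "\<psi> i = ln (bethe d \<kappa> (m i) (s i))" for i
  have s: "0 < s i" "s i \<le> m i" for i
    unfolding s_def using cavity.fixpt_pos[OF cav] cavity.fixpt_le[OF cav] by auto
  have p01: "0 \<le> p i \<and> p i \<le> 1" for i
    unfolding p_def using cavity.minus_prob_bounds[OF cav] s[of i] by simp
  have "\<forall>i\<in>{1..N}. eventually (\<lambda>k. cavity.minus_prob d \<kappa> (m i) ((cavity_step d \<kappa> (m i) ^^ k) (m i)) < p i + \<eta>) sequentially"
    using cavity.minus_prob_iter_tendsto[OF cav] \<eta> unfolding p_def s_def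
    by (auto intro!: order_tendstoD(2))
  then have "eventually (\<lambda>k. \<forall>i\<in>{1..N}. cavity.minus_prob d \<kappa> (m i) ((cavity_step d \<kappa> (m i) ^^ k) (m i)) < p i + \<eta>) sequentially"
    by (intro eventually_ball_finite) auto
  then obtain K where K: "\<And>i. i \<in> {1..N} \<Longrightarrow>
      cavity.minus_prob d \<kappa> (m i) ((cavity_step d \<kappa> (m i) ^^ K) (m i)) < p i + \<eta>"
    unfolding eventually_sequentially by blast
  have "ln (ising_Z V E \<kappa> \<mu>) \<le> card V * (ln (bethe d \<kappa> \<mu> (s 1)) + \<epsilon>) +
      N * \<delta> * num_bad V E (Suc K)"
    if R: "regular_graph d (V, E)" for V :: "'v set" and E
  proof -
    have fV: "finite V" using R by (simp add: regular_graph_def fin_graph_def)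
    define f n b where "f i = ln (ising_Z V E \<kappa> (m i))" and "n = real (card V)"
      and "b = real (num_bad V E (Suc K))" for i
    have n: "0 \<le> n" "0 \<le> b" by (auto simp: n_def b_def)
    have f0: "f 0 \<le> f 1 + \<delta> * n"
      using ising_Z_jensen[OF fV \<kappa>(1) mpos mSuc(1) ising_mean_le_card[OF fV \<kappa>(1) mpos], of E 0]
      unfolding mSuc(2) f_def n_def by simp
    have fstep: "f i \<le> f (Suc i) + \<delta> * (n * (p i + \<eta>) + b)" if i: "i \<in> {1..N}" for i
    proof -
      have "f i \<le> f (Suc i) + \<delta> * (n * cavity.minus_prob d \<kappa> (m i) ((cavity_step d \<kappa> (m i) ^^ K) (m i)) + b)"
        using ising_Z_jensen[OF fV \<kappa>(1) mpos mSuc(1) ising_mean_bound[OF R cav], of i K]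
        unfolding mSuc(2) f_def n_def b_def by simp
      also have "\<dots> \<le> f (Suc i) + \<delta> * (n * (p i + \<eta>) + b)"
        using K[OF i] \<delta> n by (intro add_left_mono mult_left_mono add_right_mono) auto
      finally show ?thesis .
    qed
    \<comment> \<open>First raise the activity from \<open>m (Suc i)\<close> to \<open>m i\<close>
      at the fixed message \<open>s (Suc i)\<close>, then raise the message to \<open>s i\<close> at
      the fixed activity.\<close>
    have \<psi>step: "\<psi> (Suc i) + \<delta> * p (Suc i) \<le> \<psi> i" if i: "1 \<le> i" for i
    proof -
      have "m i < 1"
      proof -
        have "exp (- (real i * \<delta>)) < 1" using i \<delta> by simp
        then have "m i < \<mu>" unfolding m_def using \<mu> by simp
        with \<mu> show ?thesis by simp
      qed
      moreover have "s (Suc i) \<le> s i"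
        unfolding s_def by (rule fixpt_activity_mono[OF cav cav mSuc(1)])
      ultimately have "bethe d \<kappa> (m i) (s (Suc i)) \<le> bethe d \<kappa> (m i) (s i)"
        using cavity.bethe_mono[OF cav, of i "s (Suc i)" "s i"] s[of "Suc i"] unfolding s_def by simp
      then have "ln (bethe d \<kappa> (m i) (s (Suc i))) \<le> \<psi> i"
        unfolding \<psi>_def using cavity.bethe_pos[OF cav, of "s (Suc i)" i] s[of "Suc i"] by simp
      moreover have "\<psi> (Suc i) + \<delta> * p (Suc i) \<le> ln (bethe d \<kappa> (m i) (s (Suc i)))"
        using cavity.ln_bethe_activity[OF cav mSuc(1), of "s (Suc i)" i] s[of "Suc i"]
        unfolding \<psi>_def p_def mSuc(2) by simp
      ultimately show ?thesis by simp
    qed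
    \<comment> \<open>\<open>fstep\<close> involves the density \<open>p i\<close> and
      \<open>\<psi>step\<close> the density \<open>p (Suc i)\<close>; the differences telescope to
      \<open>p 1 - p (Suc i)\<close>.\<close>
    have tele: "f 1 - n * \<psi> 1 \<le> f (Suc i) - n * \<psi> (Suc i) + \<delta> * n * (p 1 - p (Suc i)) + i * \<delta> * (n * \<eta> + b)"
      if "i < N" for i
      using that
    proof (induction i)
      case (Suc i)
      have "n * (\<psi> (Suc (Suc i)) + \<delta> * p (Suc (Suc i))) \<le> n * \<psi> (Suc i)"
        using \<psi>step[of "Suc i"] n by (intro mult_left_mono) auto
      with Suc fstep[of "Suc i"] show ?case by (simp add: algebra_simps)
    qed simp
    obtain N' where N': "N = Suc N'" using N by (cases N) auto
    \<comment> \<open>Compare with the message \<open>0\<close>, where \<open>bethe\<close> is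
      \<open>1 + m N * \<kappa> ^ d\<close>.\<close>
    have "0 \<le> \<psi> N"
    proof -
      have "m N < 1"
      proof -
        have "exp (- (real N * \<delta>)) < 1" using N\<delta> by simp
        then have "m N < \<mu>" unfolding m_def using \<mu> by simp
        with \<mu> show ?thesis by simp
      qed
      then have "bethe d \<kappa> (m N) 0 \<le> bethe d \<kappa> (m N) (s N)"
        using cavity.bethe_mono[OF cav, of N 0 "s N"] s[of N] unfolding s_def by simp
      moreover have "1 \<le> bethe d \<kappa> (m N) 0" using mpos[of N] \<kappa> by (simp add: bethe_def)
      ultimately show ?thesis unfolding \<psi>_def by simp
    qed
    then have n\<psi>N: "0 \<le> n * \<psi> N" using n by simp
    have fN: "f N \<le> n * m N" unfolding f_def n_def by (rule ising_Z_le[OF fV \<kappa> mpos])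
    have "n * m N \<le> n * (\<epsilon> / 4)" using N n by (intro mult_left_mono) auto
    have pp: "\<delta> * n * (p 1 - p N) \<le> \<delta> * n" using p01[of 1] p01[of N] \<delta> n by (simp add: mult_left_le)
    have N'N: "N' * \<delta> * (n * \<eta> + b) \<le> N * \<delta> * (n * \<eta> + b)"
      using \<delta> n \<eta> unfolding N' by (intro mult_right_mono) auto
    have e: "N * \<delta> * (n * \<eta> + b) = n * (\<epsilon> / 4) + N * \<delta> * b"
    proof -
      have "N * \<delta> * \<eta> = \<epsilon> / 4" unfolding \<eta>_def using N \<delta> by simp
      then have "n * (N * \<delta> * \<eta>) = n * (\<epsilon> / 4)" by simp
      then show ?thesis by (simp only: distrib_left mult.commute mult.left_commute mult.assoc)
    qed
    have "\<psi> 1 \<le> ln (bethe d \<kappa> \<mu> (s 1))"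
    proof -
      have "0 \<le> ln (\<mu> / m 1) * cavity.minus_prob d \<kappa> (m 1) (s 1)"
        using mle[of 1] mpos[of 1] p01[of 1] unfolding p_def by (intro mult_nonneg_nonneg) auto
      then show ?thesis
        using cavity.ln_bethe_activity[OF cav mle, of "s 1" 1] s[of 1] unfolding \<psi>_def by simp
    qed
    then have "n * \<psi> 1 \<le> n * ln (bethe d \<kappa> \<mu> (s 1))" using n by (intro mult_left_mono)
    moreover have eps: "\<epsilon> = 8 * \<delta>" by (simp add: \<delta>_def)
    moreover have "f 0 = ln (ising_Z V E \<kappa> \<mu>)" by (simp add: f_def m_def)
    moreover have "0 \<le> n * \<epsilon>" using n \<epsilon> by simp
    ultimately have "ln (ising_Z V E \<kappa> \<mu>) \<le> n * (ln (bethe d \<kappa> \<mu> (s 1)) + \<epsilon>) + N * \<delta> * b"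
      using f0 tele[of N'] n\<psi>N fN pp N'N e \<open>n * m N \<le> n * (\<epsilon> / 4)\<close> unfolding N' eps
      by (simp add: algebra_simps)
    then show ?thesis unfolding n_def b_def .
  qed
  moreover have "0 \<le> s 1" "s 1 \<le> 1" using s[of 1] mle[of 1] \<mu> by auto
  ultimately show ?thesis using N\<delta>
    by - (rule exI[of _ "s 1"], rule exI[of _ K], rule exI[of _ "N * \<delta>"], auto)
qed

section \<open>Comparison with the two-spin model\<close>

lemma cycle_card_le:
  assumes G: "fin_graph (V, E)" and C: "is_cycle (V, E) C"
  shows "card C \<le> card (\<Union>C)" "C \<noteq> {}"
proof -
  obtain xs where xs: "3 \<le> length xs" "distinct xs"
    "C = {{xs ! i, xs ! ((i + 1) mod length xs)} | i. i < length xs}"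
    using C by (auto simp: is_cycle_def)
  have C_eq: "C = (\<lambda>i. {xs ! i, xs ! ((i + 1) mod length xs)}) ` {..<length xs}" using xs by auto
  show "C \<noteq> {}" unfolding C_eq using xs(1) by (cases xs) auto
  have "finite (\<Union>C)" using card_Union_cycle(2)[OF G C] G finite_subset by (auto simp: fin_graph_def)
  moreover have "set xs \<subseteq> \<Union>C" unfolding C_eq by (auto simp: in_set_conv_nth)
  ultimately have "length xs \<le> card (\<Union>C)" using xs(2) distinct_card card_mono by metis
  moreover have "card C \<le> length xs" unfolding C_eq using card_image_le[of "{..<length xs}"] by simp
  ultimately show "card C \<le> card (\<Union>C)" by simp
qed

lemma is_cycle_mono: "is_cycle (V, E) C \<Longrightarrow> E \<subseteq> E' \<Longrightarrow> is_cycle (V', E') C"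
  by (auto simp: is_cycle_def)

text \<open>An end vertex of a longest path has all its neighbours on the path.\<close>

lemma cycle_if_min_degree_2:
  assumes G: "fin_graph (V, E)" and deg: "\<And>v. v \<in> V \<Longrightarrow> 2 \<le> card {y. {v, y} \<in> E}"
  obtains C where "is_cycle (V, E) C"
proof -
  define P where "P xs \<longleftrightarrow> xs \<noteq> [] \<and> distinct xs \<and> set xs \<subseteq> V \<and> successively (\<lambda>a b. {a, b} \<in> E) xs" for xs
  have fV: "finite V" "V \<noteq> {}" using G by (auto simp: fin_graph_def)
  then obtain v where "P [v]" unfolding P_def by auto
  moreover have "length xs < Suc (card V)" if "P xs" for xs
    using that fV card_mono[of V "set xs"] distinct_card[of xs] unfolding P_def by auto
  ultimately obtain xs where xs: "P xs" and mx: "\<And>ys. P ys \<Longrightarrow> length ys \<le> length xs"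
    using ex_has_greatest_nat[of P "[v]" length "Suc (card V)"] by blast
  obtain x r where xr: "xs = x # r" using xs unfolding P_def by (cases xs) auto
  have xV: "x \<in> V" using xs xr unfolding P_def by auto
  have nb: "y \<in> set xs" if "{x, y} \<in> E" for y
  proof (rule ccontr)
    assume "y \<notin> set xs"
    then have "P (y # xs)" using xs that fin_graph_edge[OF G that] xr
      unfolding P_def by (auto simp: insert_commute)
    with mx[of "y # xs"] show False by simp
  qed
  have "\<not> {y. {x, y} \<in> E} \<subseteq> {hd r}"
  proof
    assume "{y. {x, y} \<in> E} \<subseteq> {hd r}"
    then have "card {y. {x, y} \<in> E} \<le> card {hd r}" by (intro card_mono) auto
    with deg[OF xV] show False by simp
  qed
  then obtain y where y: "{x, y} \<in> E" "y \<noteq> hd r" by auto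
  have "x \<noteq> y" using fin_graph_edge[OF G y(1)] by simp
  then have "y \<in> set r" using nb[OF y(1)] xr by auto
  then obtain r1 r2 where r: "r = r1 @ y # r2" using split_list by metis
  have "r1 \<noteq> []" using y r by auto
  define zs where "zs = x # r1 @ [y]"
  have xs_eq: "xs = zs @ r2" unfolding zs_def xr r by simp
  have "distinct zs" "successively (\<lambda>a b. {a, b} \<in> E) zs"
    using xs unfolding P_def xs_eq by (auto simp: successively_append_iff)
  moreover have "3 \<le> length zs" unfolding zs_def using \<open>r1 \<noteq> []\<close> by (cases r1) auto
  moreover have "{last zs, hd zs} \<in> E" unfolding zs_def using y(1) by (simp add: insert_commute)
  ultimately show ?thesis using cycle_of_list that by metis
qed

text \<open>Without cycles some vertex has degree at most one, and deleting it loses at most one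
  edge.\<close>

lemma acyclic_card_edges:
  assumes "finite A" "finite X" "X \<noteq> {}" "\<And>e. e \<in> A \<Longrightarrow> card e = 2"
    and "\<nexists>C. is_cycle (X, edges_in A X) C"
  shows "card (edges_in A X) + 1 \<le> card X"
  using assms(2,3,5)
proof (induction "card X" arbitrary: X rule: less_induct)
  case less
  let ?A = "\<lambda>X. edges_in A X"
  have G: "fin_graph (X, ?A X)" using less assms by (auto simp: fin_graph_def)
  obtain v where v: "v \<in> X" "card {y. {v, y} \<in> ?A X} \<le> 1"
  proof -
    have "\<exists>v\<in>X. \<not> 2 \<le> card {y. {v, y} \<in> ?A X}"
    proof (rule ccontr)
      assume "\<not> (\<exists>v\<in>X. \<not> 2 \<le> card {y. {v, y} \<in> ?A X})"
      then show False using cycle_if_min_degree_2[OF G] less.prems(3) by blast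
    qed
    then show ?thesis using that by force
  qed
  show ?case
  proof (cases "X = {v}")
    case True
    then have "?A X = {}" using assms(4)[of "{}"] assms(4)[of "{v}"] by (auto simp: subset_singleton_iff)
    then show ?thesis using True by simp
  next
    case False
    let ?Y = "X - {v}"
    have Y: "card ?Y + 1 = card X" using card_Suc_Diff1[OF less.prems(1) v(1)] by simp
    have IH: "card (?A ?Y) + 1 \<le> card ?Y"
    proof (rule less.hyps)
      show "\<nexists>C. is_cycle (?Y, ?A ?Y) C"
      proof
        assume "\<exists>C. is_cycle (?Y, ?A ?Y) C"
        then obtain C where "is_cycle (?Y, ?A ?Y) C" ..
        then have "is_cycle (X, ?A X) C" by (rule is_cycle_mono) auto
        with less.prems(3) show False by blast
      qed
    qed (use Y less.prems(1) False v in auto)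
    have "?A X = ?A ?Y \<union> edges_at (?A X) v" by auto
    then have "card (?A X) \<le> card (?A ?Y \<union> edges_at (?A X) v)"
      by (rule arg_cong[THEN eq_refl])
    also have "\<dots> \<le> card (?A ?Y) + card (edges_at (?A X) v)" by (rule card_Un_le)
    also have "card (edges_at (?A X) v) \<le> 1" using v card_nbrs[OF G, of v] by simp
    finally show ?thesis using IH Y by simp
  qed
qed

section \<open>Components of an edge set\<close>

lemma connected_in_equiv: "equiv V (connected_in V A)"
proof (rule equivI)
  show "connected_in V A \<subseteq> V \<times> V" by (auto simp: connected_in_def)
  show "refl_on V (connected_in V A)" by (auto simp: connected_in_def refl_on_def)
  have "sym ({(a, b). {a, b} \<in> A}\<^sup>*)" by (rule sym_rtrancl) (auto simp: sym_def insert_commute)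
  then show "sym (connected_in V A)" by (auto simp: connected_in_def sym_def)
  show "trans (connected_in V A)" by (auto simp: connected_in_def trans_def)
qed

text \<open>The weight of a component coloured with the merged spin: \<open>x\<close> per vertex,
  and \<open>1 / x\<close> per edge because there \<open>w / x\<close> replaces \<open>w\<close>.
  For connected \<open>C\<close> the exponent of \<open>x\<close> is one minus the cyclomatic
  number, so a tree has weight \<open>x\<close>.\<close>

abbreviation comp_wt :: "real \<Rightarrow> 'v set set \<Rightarrow> 'v set \<Rightarrow> real" where
  "comp_wt x A C \<equiv> x ^ card C * (1 / x) ^ card (edges_in A C)"

context
  fixes V :: "'v set" and A :: "'v set set"
  assumes G: "fin_graph (V, A)"
begin

abbreviation "comps \<equiv> V // connected_in V A"

lemma comps_facts:
  shows "\<Union>comps = V" "C \<in> comps \<Longrightarrow> C \<subseteq> V \<and> C \<noteq> {}" "C \<in> comps \<Longrightarrow> D \<in> comps \<Longrightarrow> C \<noteq> D \<Longrightarrow> C \<inter> D = {}"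
    "finite comps"
proof -
  show U: "\<Union>comps = V" by (rule Union_quotient[OF connected_in_equiv])
  show C: "C \<subseteq> V \<and> C \<noteq> {}" if "C \<in> comps" for C
    using that U in_quotient_imp_non_empty[OF connected_in_equiv] by blast
  show "C \<in> comps \<Longrightarrow> D \<in> comps \<Longrightarrow> C \<noteq> D \<Longrightarrow> C \<inter> D = {}"
    using quotient_disj[OF connected_in_equiv] by blast
  show "finite comps" by (rule finite_subset[of _ "Pow V"]) (use C G in \<open>auto simp: fin_graph_def\<close>)
qed

lemma comp_closed:
  assumes "C \<in> comps" "e \<in> A" "x \<in> e" "x \<in> C" shows "e \<subseteq> C"
proof -
  obtain u where u: "u \<in> V" "C = connected_in V A `` {u}" using assms(1) by (auto simp: quotient_def)
  obtain a b where e: "e = {a, b}" "a \<in> V" "b \<in> V" using fin_graph_edgeE[OF G assms(2)] by metis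
  have ux: "(u, x) \<in> {(a, b). {a, b} \<in> A}\<^sup>*" using assms(4) u by (auto simp: connected_in_def)
  have "y \<in> C" if "y \<in> e" for y
  proof (cases "y = x")
    case False
    then have "{x, y} = e" using e assms(3) that by auto
    then have "(u, y) \<in> {(a, b). {a, b} \<in> A}\<^sup>*" using ux assms(2) by (auto intro: rtrancl_into_rtrancl)
    then show ?thesis using u e that by (auto simp: connected_in_def)
  qed (use assms in simp)
  then show ?thesis by auto
qed

lemma comp_leaving_edge:
  assumes C: "C \<in> comps" and X: "X \<subset> C" "X \<noteq> {}"
  obtains x y where "x \<in> X" "y \<in> C - X" "{x, y} \<in> A"
proof -
  obtain u where u: "u \<in> X" using X by auto
  obtain v where v: "v \<in> C" "v \<notin> X" using X by auto
  have "(u, v) \<in> connected_in V A"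
    using quotient_eq_iff[OF connected_in_equiv C C, of u v] u v X by auto
  then have "(u, v) \<in> {(a, b). {a, b} \<in> A}\<^sup>*" by (simp add: connected_in_def)
  then have "v \<in> X \<or> (\<exists>x y. x \<in> X \<and> y \<in> C - X \<and> {x, y} \<in> A)"
  proof (induction rule: rtrancl_induct)
    case (step a b)
    show ?case
    proof (cases "a \<in> X \<and> b \<notin> X")
      case True
      then have "b \<in> C" using comp_closed[OF C, of "{a, b}" a] step(2) X by auto
      then show ?thesis using True step(2) by blast
    next
      case False then show ?thesis using step(3) by blast
    qed
  qed (use u in simp)
  then show ?thesis using v that by blast
qed

text \<open>A connected set is grown from one vertex along leaving edges, each new vertex bringing
  at least one edge.\<close>

lemma comp_card_le:
  assumes C: "C \<in> comps" shows "card C \<le> card (edges_in A C) + 1"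
proof -
  have fC: "finite C" using comps_facts(2)[OF C] G finite_subset by (auto simp: fin_graph_def)
  have fA: "finite A" by (rule fin_graph_finite_edges[OF G])
  have "1 \<le> n \<Longrightarrow> n \<le> card C \<Longrightarrow> \<exists>X\<subseteq>C. card X = n \<and> n \<le> card (edges_in A X) + 1" for n
  proof (induction n)
    case (Suc n)
    show ?case
    proof (cases "n = 0")
      case True
      obtain x where "x \<in> C" using comps_facts(2)[OF C] by auto
      then show ?thesis using True by (intro exI[of _ "{x}"]) auto
    next
      case False
      then obtain X where X: "X \<subseteq> C" "card X = n" "n \<le> card (edges_in A X) + 1" using Suc by auto
      then have "X \<subset> C" "X \<noteq> {}" using Suc.prems False by auto
      from comp_leaving_edge[OF C this] obtain x y where xy: "x \<in> X" "y \<in> C - X" "{x, y} \<in> A" .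
      have fX: "finite X" using X fC finite_subset by auto
      have "insert {x, y} (edges_in A X) \<subseteq> edges_in A (insert y X)" using xy by auto
      then have "card (insert {x, y} (edges_in A X)) \<le> card (edges_in A (insert y X))"
        using fA by (intro card_mono) auto
      moreover have "card (insert {x, y} (edges_in A X)) = card (edges_in A X) + 1"
        using xy fA by (subst card_insert_disjoint) auto
      ultimately show ?thesis using X xy fX by (intro exI[of _ "insert y X"]) auto
    qed
  qed simp
  from this[of "card C"] comps_facts(2)[OF C] fC obtain X where
    "X \<subseteq> C" "card X = card C" "card C \<le> card (edges_in A X) + 1"
    by (metis card_0_eq le_refl not_less_eq_eq One_nat_def le_zero_eq)
  moreover have "X = C" using calculation fC card_subset_eq by metis
  ultimately show ?thesis by simp
qed

definition cyclic_comps :: "'v set set" where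
  "cyclic_comps = {C \<in> comps. \<exists>c. is_cycle (V, edges_in A C) c}"

text \<open>Choose one cycle in each cyclic component; these cycles are vertex-disjoint. Those
  shorter than \<open>g\<close> are distinct short cycles of the graph, and the others sit in
  disjoint components with at least \<open>g\<close> vertices each, at most
  \<open>card V / g\<close> of them.\<close>

lemma card_cyclic_comps:
  assumes AE: "A \<subseteq> E" and GE: "fin_graph (V, E)" and g: "0 < g"
  shows "real (card cyclic_comps) \<le> num_short_cycles (V, E) (int g) + card V / g"
proof -
  define c where "c C = (SOME c. is_cycle (V, edges_in A C) c)" for C
  have c: "is_cycle (V, edges_in A C) (c C)" if "C \<in> cyclic_comps" for C
    using that someI_ex[of "\<lambda>c. is_cycle (V, edges_in A C) c"] unfolding cyclic_comps_def c_def by blast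
  have cE: "is_cycle (V, E) (c C)" if "C \<in> cyclic_comps" for C
    using is_cycle_mono[OF c[OF that], of E V] AE by blast
  have sub: "\<Union>(c C) \<subseteq> C" "c C \<noteq> {}" "card (c C) \<le> card (\<Union>(c C))" if "C \<in> cyclic_comps" for C
    using c[OF that] cycle_card_le[OF GE cE[OF that]] by (auto simp: is_cycle_def)
  have ne: "\<Union>(c C) \<noteq> {}" if "C \<in> cyclic_comps" for C
    using sub(2)[OF that] cE[OF that] GE by (fastforce simp: is_cycle_def fin_graph_def)
  have inj: "inj_on c cyclic_comps"
  proof (rule inj_onI, rule ccontr)
    fix C D assume CD: "C \<in> cyclic_comps" "D \<in> cyclic_comps" "c C = c D" "C \<noteq> D"
    then have "C \<inter> D = {}" using comps_facts(3) unfolding cyclic_comps_def by blast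
    then show False using sub(1)[OF CD(1)] sub(1)[OF CD(2)] ne[OF CD(1)] CD(3) by auto
  qed
  have fc: "finite cyclic_comps" using comps_facts(4) by (simp add: cyclic_comps_def)
  let ?S = "{C \<in> cyclic_comps. card (c C) < g}" and ?L = "{C \<in> cyclic_comps. g \<le> card (c C)}"
  have "card ?S \<le> num_short_cycles (V, E) (int g)"
    unfolding num_short_cycles_def
  proof (rule card_inj_on_le[of c])
    show "inj_on c ?S" using inj by (rule inj_on_subset) auto
    show "c ` ?S \<subseteq> {C. is_cycle (V, E) C \<and> int (card C) \<le> int g - 1}" using cE by auto
    show "finite {C. is_cycle (V, E) C \<and> int (card C) \<le> int g - 1}" by (rule finite_short_cycles[OF GE])
  qed
  moreover have "g * card ?L \<le> card V"
  proof -
    have fV: "finite V" using G by (simp add: fin_graph_def)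
    have "g * card ?L = (\<Sum>C\<in>?L. g)" by simp
    also have "\<dots> \<le> (\<Sum>C\<in>?L. card C)"
    proof (rule sum_mono)
      fix C assume C: "C \<in> ?L"
      then have "finite C" using comps_facts(2)[of C] fV finite_subset unfolding cyclic_comps_def by blast
      then have "card (\<Union>(c C)) \<le> card C" using sub(1) C by (intro card_mono) auto
      then show "g \<le> card C" using C sub(3)[of C] by auto
    qed
    also have "\<dots> = card (\<Union>?L)"
    proof (rule card_Union_disjoint[symmetric])
      show "disjoint ?L" using comps_facts(3) unfolding cyclic_comps_def disjoint_def by blast
      show "finite C" if "C \<in> ?L" for C
        using that comps_facts(2)[of C] fV finite_subset unfolding cyclic_comps_def by blast
    qed
    also have "\<dots> \<le> card V" using fV comps_facts(2) unfolding cyclic_comps_def by (intro card_mono) blast+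
    finally show ?thesis .
  qed
  then have "real g * real (card ?L) \<le> real (card V)" by (metis of_nat_le_iff of_nat_mult)
  then have "card ?L \<le> card V / g" using g by (simp add: pos_le_divide_eq mult.commute)
  moreover have "card cyclic_comps = card ?S + card ?L"
    using fc by (subst card_Un_disjoint[symmetric]) (auto intro!: arg_cong[of _ _ card])
  ultimately show ?thesis by simp
qed

text \<open>The sets that no edge of \<open>A\<close> leaves are exactly the unions of components,
  and \<open>comp_wt\<close> is multiplicative over components, so the sum factorizes.\<close>

lemma sum_closed_sets:
  fixes h :: "'v set \<Rightarrow> real" and x :: real
  assumes h: "\<And>S. h S = comp_wt x A S"
  shows "(\<Sum>S\<in>{S \<in> Pow V. \<forall>e\<in>A. e \<subseteq> S \<or> e \<subseteq> V - S}. h S) = (\<Prod>C\<in>comps. 1 + h C)"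
proof -
  have fV: "finite V" using G by (simp add: fin_graph_def)
  have fA: "finite A" by (rule fin_graph_finite_edges[OF G])
  have ne: "e \<noteq> {}" if "e \<in> A" for e using G that by (auto simp: fin_graph_def)
  have disj: "disjoint D" if "D \<subseteq> comps" for D
    using comps_facts(3) that unfolding disjoint_def by blast
  have fD: "finite D" "\<And>C. C \<in> D \<Longrightarrow> finite C" if "D \<subseteq> comps" for D
    using comps_facts(2,4) that fV finite_subset by (blast, blast)
  have hU: "h (\<Union>D) = (\<Prod>C\<in>D. h C)" if D: "D \<subseteq> comps" for D
  proof -
    have "card (\<Union>D) = (\<Sum>C\<in>D. card C)"
      by (rule card_Union_disjoint[OF disj[OF D]]) (use fD[OF D] in auto)
    moreover have "edges_in A (\<Union>D) = (\<Union>C\<in>D. edges_in A C)"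
    proof (intro equalityI subsetI)
      fix e assume e: "e \<in> edges_in A (\<Union>D)"
      then obtain u C where "u \<in> e" "C \<in> D" "u \<in> C" using ne by blast
      then show "e \<in> (\<Union>C\<in>D. edges_in A C)" using comp_closed[of C e u] D e by blast
    qed auto
    moreover have "card (\<Union>C\<in>D. edges_in A C) = (\<Sum>C\<in>D. card (edges_in A C))"
    proof (rule card_UN_disjoint)
      show "\<forall>i\<in>D. \<forall>j\<in>D. i \<noteq> j \<longrightarrow> edges_in A i \<inter> edges_in A j = {}"
      proof (intro ballI impI)
        fix i j assume "i \<in> D" "j \<in> D" "i \<noteq> j"
        then have "i \<inter> j = {}" using comps_facts(3)[of i j] D by auto
        then show "edges_in A i \<inter> edges_in A j = {}" using ne by blast
      qed
    qed (use fD[OF D] fA in auto)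
    ultimately show ?thesis unfolding h by (simp add: power_sum prod.distrib)
  qed
  have "bij_betw Union (Pow comps) {S \<in> Pow V. \<forall>e\<in>A. e \<subseteq> S \<or> e \<subseteq> V - S}"
    unfolding bij_betw_def
  proof
    show "inj_on Union (Pow comps)"
    proof (rule inj_onI)
      have "D \<subseteq> D'" if sub: "D \<subseteq> comps" "D' \<subseteq> comps" "\<Union>D = \<Union>D'" for D D'
      proof
        fix C assume C: "C \<in> D"
        then obtain u where u: "u \<in> C" using comps_facts(2)[of C] sub(1) by blast
        then obtain C' where C': "C' \<in> D'" "u \<in> C'" using sub(3) C by blast
        then have "C = C'" using comps_facts(3)[of C C'] u C sub by blast
        then show "C \<in> D'" using C' by simp
      qed
      then show "D = D'" if "D \<in> Pow comps" "D' \<in> Pow comps" "\<Union>D = \<Union>D'" for D D'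
        using that by (simp add: subset_antisym)
    qed
    show "Union ` Pow comps = {S \<in> Pow V. \<forall>e\<in>A. e \<subseteq> S \<or> e \<subseteq> V - S}"
    proof (intro equalityI subsetI)
      fix S assume "S \<in> Union ` Pow comps"
      then obtain D where D: "D \<subseteq> comps" "S = \<Union>D" by auto
      have "e \<subseteq> S \<or> e \<subseteq> V - S" if e: "e \<in> A" for e
      proof (cases "e \<inter> S = {}")
        case True then show ?thesis using G e by (auto simp: fin_graph_def)
      next
        case False
        then obtain u C where "u \<in> e" "C \<in> D" "u \<in> C" using D by blast
        then show ?thesis using comp_closed[of C e u] D e by blast
      qed
      then show "S \<in> {S \<in> Pow V. \<forall>e\<in>A. e \<subseteq> S \<or> e \<subseteq> V - S}" using D comps_facts(2) by blast
    next
      fix S assume S: "S \<in> {S \<in> Pow V. \<forall>e\<in>A. e \<subseteq> S \<or> e \<subseteq> V - S}"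
      have "C \<subseteq> S" if C: "C \<in> comps" "C \<inter> S \<noteq> {}" for C
      proof (rule ccontr)
        assume "\<not> C \<subseteq> S"
        then have "C \<inter> S \<subset> C" by blast
        from comp_leaving_edge[OF C(1) this C(2)] obtain x y
          where xy: "x \<in> C \<inter> S" "y \<in> C - C \<inter> S" "{x, y} \<in> A" .
        have "\<forall>e\<in>A. e \<subseteq> S \<or> e \<subseteq> V - S" using S by simp
        from bspec[OF this xy(3)] show False using xy(1,2) by auto
      qed
      moreover have "\<exists>C\<in>comps. u \<in> C" if "u \<in> S" for u using S that comps_facts(1) by auto
      ultimately have "S = \<Union>{C \<in> comps. C \<subseteq> S}" by blast
      then show "S \<in> Union ` Pow comps" by blast
    qed
  qed
  then have "(\<Sum>S\<in>{S \<in> Pow V. \<forall>e\<in>A. e \<subseteq> S \<or> e \<subseteq> V - S}. h S) = (\<Sum>D\<in>Pow comps. h (\<Union>D))"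
    by (rule sum.reindex_bij_betw[symmetric])
  also have "\<dots> = (\<Sum>D\<in>Pow comps. (\<Prod>C\<in>D. h C) * (\<Prod>C\<in>comps - D. 1))"
    using hU by (intro sum.cong) auto
  also have "\<dots> = (\<Prod>C\<in>comps. h C + 1)" by (rule prod_add[symmetric, OF comps_facts(4)])
  finally show ?thesis by (simp add: add.commute)
qed

text \<open>A connected \<open>C\<close> has at least \<open>card C - 1\<close> edges, so
  \<open>h C \<le> x\<close> by \<open>x \<ge> 1\<close>, with equality for trees. A cyclic
  component still has \<open>1 + h C \<ge> 1\<close> and costs at most one factor
  \<open>1 + x\<close>.\<close>

lemma prod_comps_bounds:
  fixes x :: real
  assumes x: "1 \<le> x"
  defines "h \<equiv> \<lambda>S. comp_wt x A S"
  shows "(\<Prod>C\<in>comps. 1 + h C) \<le> (1 + x) ^ card comps"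
    and "(1 + x) ^ card comps \<le> (1 + x) ^ card cyclic_comps * (\<Prod>C\<in>comps. 1 + h C)"
proof -
  have h0: "0 \<le> h C" for C using x by (simp add: h_def)
  have "h C \<le> x" if "C \<in> comps" for C
  proof -
    have "h C \<le> x ^ (card (edges_in A C) + 1) * (1 / x) ^ card (edges_in A C)"
      unfolding h_def using x comp_card_le[OF that] by (intro mult_right_mono power_increasing) auto
    also have "\<dots> = x" using x by (simp add: power_one_over)
    finally show ?thesis .
  qed
  then have "(\<Prod>C\<in>comps. 1 + h C) \<le> (\<Prod>C\<in>comps. 1 + x)"
    using h0 by (intro prod_mono) (auto intro: add_nonneg_nonneg)
  then show "(\<Prod>C\<in>comps. 1 + h C) \<le> (1 + x) ^ card comps" by simp
  have "1 + x \<le> (if C \<in> cyclic_comps then 1 + x else 1) * (1 + h C)" if C: "C \<in> comps" for C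
  proof (cases "C \<in> cyclic_comps")
    case True
    then show ?thesis using h0[of C] x by simp
  next
    case False
    then have "\<nexists>c. is_cycle (C, edges_in A C) c"
      using C is_cycle_mono[of C "edges_in A C" _ "edges_in A C" V] unfolding cyclic_comps_def by blast
    moreover have "finite C" "C \<noteq> {}"
      using comps_facts(2)[OF C] G finite_subset by (auto simp: fin_graph_def)
    moreover have "card e = 2" if "e \<in> A" for e using that G by (simp add: fin_graph_def)
    ultimately have "card (edges_in A C) + 1 \<le> card C"
      using acyclic_card_edges fin_graph_finite_edges[OF G] by blast
    then have "x ^ (card (edges_in A C) + 1) * (1 / x) ^ card (edges_in A C) \<le> h C"
      unfolding h_def using x by (intro mult_right_mono power_increasing) auto
    then have "x \<le> h C" using x by (simp add: power_one_over)
    then show ?thesis using False by simp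
  qed
  then have "(\<Prod>C\<in>comps. 1 + x) \<le> (\<Prod>C\<in>comps. (if C \<in> cyclic_comps then 1 + x else 1) * (1 + h C))"
    using x by (intro prod_mono) auto
  also have "\<dots> = (\<Prod>C\<in>comps. if C \<in> cyclic_comps then 1 + x else 1) * (\<Prod>C\<in>comps. 1 + h C)"
    by (rule prod.distrib)
  also have "(\<Prod>C\<in>comps. if C \<in> cyclic_comps then 1 + x else 1) = (1 + x) ^ card cyclic_comps"
    by (subst prod_if_power[OF comps_facts(4)]) (auto simp: cyclic_comps_def intro!: arg_cong[of _ _ card])
  finally show "(1 + x) ^ card comps \<le> (1 + x) ^ card cyclic_comps * (\<Prod>C\<in>comps. 1 + h C)" by simp
qed

end

section \<open>The expansion of the two-spin model over edge sets\<close>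

text \<open>The set \<open>S\<close> carries the \<open>q - 1 = x\<close> colours other than the first one, merged into one spin.\<close>

definition two_spin_Z :: "'v set \<Rightarrow> 'v set set \<Rightarrow> real \<Rightarrow> real \<Rightarrow> real" where
  "two_spin_Z V E x w = (\<Sum>S\<in>Pow V. (1 + w) ^ card (edges_in E (V - S)) *
     (x ^ card S * (1 + w / x) ^ card (edges_in E S)))"

text \<open>For fixed \<open>S\<close>, write each edge factor as \<open>1 + g e\<close>. An edge
  between \<open>S\<close> and its complement has factor 1, thus \<open>g e = 0\<close>, so only
  those \<open>A\<close> survive that respect the cut. After exchanging the sums, \<open>S\<close>
  runs over unions of components of \<open>A\<close>.\<close>

lemma two_spin_expand:
  assumes G: "fin_graph (V, E)" and x: "1 \<le> x"
  shows "two_spin_Z V E x w = (\<Sum>A\<in>Pow E. w ^ card A * (\<Prod>C\<in>V // connected_in V A.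
    1 + comp_wt x A C))"
proof -
  have fE: "finite E" by (rule fin_graph_finite_edges[OF G])
  have fV: "finite V" using G by (simp add: fin_graph_def)
  have ne: "e \<noteq> {}" if "e \<in> E" for e using G that by (auto simp: fin_graph_def)
  let ?cl = "\<lambda>A S. \<forall>e\<in>A. e \<subseteq> S \<or> e \<subseteq> V - S"
  have exp: "(1 + w) ^ card (edges_in E (V - S)) * (1 + w / x) ^ card (edges_in E S)
    = (\<Sum>A\<in>Pow E. if ?cl A S then w ^ card A * (1 / x) ^ card (edges_in A S) else 0)" if "S \<in> Pow V" for S
  proof -
    define g where "g e = (if e \<subseteq> V - S then w else if e \<subseteq> S then w * (1 / x) else 0)" for e
    have "(1 + w) ^ card (edges_in E (V - S)) * (1 + w / x) ^ card (edges_in E S)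
      = (\<Prod>e\<in>E. (if e \<subseteq> V - S then 1 + w else 1) * (if e \<subseteq> S then 1 + w / x else 1))"
      unfolding prod.distrib prod_if_power[OF fE] ..
    also have "\<dots> = (\<Prod>e\<in>E. g e + 1)"
      using ne by (intro prod.cong) (auto simp: g_def)
    also have "\<dots> = (\<Sum>A\<in>Pow E. \<Prod>e\<in>A. g e)" by (simp add: prod_add[OF fE])
    also have "\<dots> = (\<Sum>A\<in>Pow E. if ?cl A S then w ^ card A * (1 / x) ^ card (edges_in A S) else 0)"
    proof (rule sum.cong[OF refl])
      fix A assume A: "A \<in> Pow E"
      then have fA: "finite A" using fE finite_subset by auto
      show "(\<Prod>e\<in>A. g e) = (if ?cl A S then w ^ card A * (1 / x) ^ card (edges_in A S) else 0)"
      proof (cases "?cl A S")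
        case True
        have "(\<Prod>e\<in>A. g e) = (\<Prod>e\<in>A. w * (if e \<subseteq> S then 1 / x else 1))"
        proof (rule prod.cong[OF refl])
          fix e assume "e \<in> A"
          then have "e \<noteq> {}" "e \<subseteq> S \<or> e \<subseteq> V - S" using True ne A by auto
          then have "(e \<subseteq> S \<and> \<not> e \<subseteq> V - S) \<or> (\<not> e \<subseteq> S \<and> e \<subseteq> V - S)" by blast
          then show "g e = w * (if e \<subseteq> S then 1 / x else 1)" by (auto simp: g_def)
        qed
        also have "\<dots> = w ^ card A * (1 / x) ^ card (edges_in A S)"
          unfolding prod.distrib prod_if_power[OF fA] by simp
        finally show ?thesis using True by simp
      next
        case False
        then obtain e where "e \<in> A" "\<not> e \<subseteq> S" "\<not> e \<subseteq> V - S" by blast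
        then have "e \<in> A" "g e = 0" by (auto simp: g_def)
        then have "(\<Prod>e\<in>A. g e) = 0" using fA by (intro prod_zero) auto
        then show ?thesis by (simp only: if_not_P[OF False])
      qed
    qed
    finally show ?thesis .
  qed
  have "two_spin_Z V E x w = (\<Sum>S\<in>Pow V. \<Sum>A\<in>Pow E.
      if ?cl A S then w ^ card A * (comp_wt x A S) else 0)"
    unfolding two_spin_Z_def
  proof (rule sum.cong[OF refl])
    fix S assume S: "S \<in> Pow V"
    have "(1 + w) ^ card (edges_in E (V - S)) * (x ^ card S * (1 + w / x) ^ card (edges_in E S))
      = x ^ card S * (\<Sum>A\<in>Pow E. if ?cl A S then w ^ card A * (1 / x) ^ card (edges_in A S) else 0)"
      unfolding exp[OF S, symmetric] by simp
    also have "\<dots> = (\<Sum>A\<in>Pow E. if ?cl A S then w ^ card A * (comp_wt x A S) else 0)"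
      unfolding sum_distrib_left by (intro sum.cong) auto
    finally show "(1 + w) ^ card (edges_in E (V - S)) * (x ^ card S * (1 + w / x) ^ card (edges_in E S))
      = (\<Sum>A\<in>Pow E. if ?cl A S then w ^ card A * (comp_wt x A S) else 0)" .
  qed
  also have "\<dots> = (\<Sum>A\<in>Pow E. \<Sum>S\<in>Pow V.
      if ?cl A S then w ^ card A * (comp_wt x A S) else 0)"
    by (rule sum.swap)
  also have "\<dots> = (\<Sum>A\<in>Pow E. w ^ card A * (\<Prod>C\<in>V // connected_in V A.
    1 + comp_wt x A C))"
  proof (rule sum.cong[OF refl])
    fix A assume A: "A \<in> Pow E"
    then have GA: "fin_graph (V, A)" using G by (auto simp: fin_graph_def)
    have "(\<Sum>S\<in>Pow V. if ?cl A S then w ^ card A * (comp_wt x A S) else 0)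
      = (\<Sum>S\<in>{S \<in> Pow V. ?cl A S}. w ^ card A * (comp_wt x A S))"
      using fV by (intro sum.mono_neutral_cong_right) auto
    also have "\<dots> = w ^ card A * (\<Sum>S\<in>{S \<in> Pow V. ?cl A S}. comp_wt x A S)"
      by (simp only: sum_distrib_left)
    also have "\<dots> = w ^ card A * (\<Prod>C\<in>V // connected_in V A. 1 + comp_wt x A C)"
      by (subst sum_closed_sets[OF GA]) auto
    finally show "(\<Sum>S\<in>Pow V. if ?cl A S then w ^ card A * (comp_wt x A S) else 0)
      = w ^ card A * (\<Prod>C\<in>V // connected_in V A. 1 + comp_wt x A C)" .
  qed
  finally show ?thesis .
qed

lemma two_spin_le_rc_partition:
  assumes G: "fin_graph (V, E)" and q: "2 \<le> q" and w: "0 \<le> w"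
  shows "two_spin_Z V E (q - 1) w \<le> rc_partition (V, E) q w"
proof -
  have x: "1 \<le> q - 1" using q by simp
  show ?thesis
    unfolding two_spin_expand[OF G x] rc_partition_def fst_conv snd_conv
  proof (rule sum_mono)
    fix A assume "A \<in> Pow E"
    then have GA: "fin_graph (V, A)" using G by (auto simp: fin_graph_def)
    show "w ^ card A * (\<Prod>C\<in>V // connected_in V A. 1 + comp_wt (q - 1) A C)
      \<le> q ^ num_components V A * w ^ card A"
      using mult_left_mono[OF prod_comps_bounds(1)[OF GA x], of "w ^ card A"] w
      unfolding num_components_def by (simp add: mult.commute)
  qed
qed

text \<open>The number of cyclic components is bounded through the whole graph, uniformly in
  \<open>A\<close>, so one factor serves all terms. It is a \<open>powr\<close> since
  \<open>card V / g\<close> need not be an integer.\<close>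

lemma rc_partition_le_two_spin:
  assumes G: "fin_graph (V, E)" and q: "2 \<le> q" and w: "0 \<le> w" and g: "0 < g"
  shows "rc_partition (V, E) q w
    \<le> q powr (num_short_cycles (V, E) (int g) + card V / g) * two_spin_Z V E (q - 1) w"
proof -
  have x: "1 \<le> q - 1" using q by simp
  let ?t = "num_short_cycles (V, E) (int g) + card V / g"
  show ?thesis
    unfolding two_spin_expand[OF G x] rc_partition_def fst_conv snd_conv sum_distrib_left
  proof (rule sum_mono)
    fix A assume A: "A \<in> Pow E"
    then have GA: "fin_graph (V, A)" using G by (auto simp: fin_graph_def)
    let ?P = "\<Prod>C\<in>V // connected_in V A. 1 + comp_wt (q - 1) A C"
    have P: "0 \<le> ?P" using x by (intro prod_nonneg) (auto intro!: add_nonneg_nonneg)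
    have "q ^ num_components V A \<le> q ^ card (cyclic_comps V A) * ?P"
      using prod_comps_bounds(2)[OF GA x] unfolding num_components_def by simp
    also have "q ^ card (cyclic_comps V A) \<le> q powr ?t"
    proof -
      have "q ^ card (cyclic_comps V A) = q powr card (cyclic_comps V A)" using q by (simp add: powr_realpow)
      also have "\<dots> \<le> q powr ?t"
        using q card_cyclic_comps[OF GA _ G g] A by (intro powr_mono) auto
      finally show ?thesis .
    qed
    finally have "q ^ num_components V A \<le> q powr ?t * ?P" using P by (simp add: mult_right_mono)
    then have "q ^ num_components V A * w ^ card A \<le> (q powr ?t * ?P) * w ^ card A"
      using w by (intro mult_right_mono) auto
    then show "q ^ num_components V A * w ^ card A \<le> q powr ?t * (w ^ card A * ?P)"
      by (simp add: mult_ac)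
  qed
qed

section \<open>The lower bound for the two-spin model\<close>

lemma prod_edges_vertices:
  fixes f :: "'v \<Rightarrow> real"
  assumes G: "fin_graph (V, A)"
  shows "(\<Prod>e\<in>A. \<Prod>x\<in>e. f x) = (\<Prod>v\<in>V. f v ^ card (edges_at A v))"
proof -
  have fin: "finite V" "finite A" using G fin_graph_finite_edges[OF G] by (auto simp: fin_graph_def)
  have "(\<Prod>e\<in>A. \<Prod>x\<in>e. f x) = (\<Prod>e\<in>A. \<Prod>x\<in>{x \<in> V. x \<in> e}. f x)"
    using G by (intro prod.cong) (auto simp: fin_graph_def)
  also have "\<dots> = (\<Prod>v\<in>V. \<Prod>e\<in>edges_at A v. f v)"
    by (rule prod.swap_restrict[OF fin(2,1)])
  finally show ?thesis by simp
qed

text \<open>The interaction is a sum of two rank one terms, and \<open>A\<close> collects the edges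
  on which the \<open>b\<close> term is chosen. Then the vertices decouple: \<open>v\<close> sees
  one factor \<open>b\<close> per edge of \<open>A\<close> at \<open>v\<close> and one factor
  \<open>a\<close> per remaining edge.\<close>

lemma rank_two_expansion:
  fixes a b \<nu> :: "bool \<Rightarrow> real"
  assumes R: "regular_graph d (V, E)"
  shows "(\<Sum>S\<in>Pow V. (\<Prod>v\<in>V. \<nu> (v \<in> S)) * (\<Prod>e\<in>E. (\<Prod>x\<in>e. a (x \<in> S)) + (\<Prod>x\<in>e. b (x \<in> S))))
    = (\<Sum>A\<in>Pow E. \<Prod>v\<in>V. (\<Sum>\<sigma>\<in>UNIV. \<nu> \<sigma> * a \<sigma> ^ (d - card (edges_at A v)) * b \<sigma> ^ card (edges_at A v)))"
proof -
  have G: "fin_graph (V, E)" using R by (simp add: regular_graph_def)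
  have fin: "finite V" "finite E" using G fin_graph_finite_edges[OF G] by (auto simp: fin_graph_def)
  let ?h = "\<lambda>A v \<sigma>. \<nu> \<sigma> * a \<sigma> ^ (d - card (edges_at A v)) * b \<sigma> ^ card (edges_at A v)"
  have "(\<Prod>v\<in>V. \<nu> (v \<in> S)) * (\<Prod>e\<in>E. (\<Prod>x\<in>e. a (x \<in> S)) + (\<Prod>x\<in>e. b (x \<in> S)))
    = (\<Sum>A\<in>Pow E. \<Prod>v\<in>V. ?h A v (v \<in> S))" for S
  proof -
    have "(\<Prod>e\<in>E. (\<Prod>x\<in>e. a (x \<in> S)) + (\<Prod>x\<in>e. b (x \<in> S)))
      = (\<Sum>A\<in>Pow E. (\<Prod>e\<in>A. \<Prod>x\<in>e. b (x \<in> S)) * (\<Prod>e\<in>E - A. \<Prod>x\<in>e. a (x \<in> S)))"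
      by (subst add.commute) (rule prod_add[OF fin(2)])
    also have "\<dots> = (\<Sum>A\<in>Pow E. \<Prod>v\<in>V. b (v \<in> S) ^ card (edges_at A v) * a (v \<in> S) ^ (d - card (edges_at A v)))"
    proof (rule sum.cong[OF refl])
      fix A assume A: "A \<in> Pow E"
      then have GA: "fin_graph (V, A)" "fin_graph (V, E - A)" using G by (auto simp: fin_graph_def)
      have "card (edges_at (E - A) v) = d - card (edges_at A v)" if "v \<in> V" for v
      proof -
        have "edges_at (E - A) v = edges_at E v - edges_at A v" by auto
        moreover have "card (edges_at E v - edges_at A v) = card (edges_at E v) - card (edges_at A v)"
        proof (rule card_Diff_subset)
          show "finite (edges_at A v)" using A finite_subset[OF _ fin(2), of A] by simp
          show "edges_at A v \<subseteq> edges_at E v" using A by auto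
        qed
        ultimately show ?thesis using R that by (simp add: regular_graph_def)
      qed
      then show "(\<Prod>e\<in>A. \<Prod>x\<in>e. b (x \<in> S)) * (\<Prod>e\<in>E - A. \<Prod>x\<in>e. a (x \<in> S))
        = (\<Prod>v\<in>V. b (v \<in> S) ^ card (edges_at A v) * a (v \<in> S) ^ (d - card (edges_at A v)))"
        unfolding prod_edges_vertices[OF GA(1)] prod_edges_vertices[OF GA(2)] prod.distrib[symmetric]
        by (intro prod.cong) auto
    qed
    finally show ?thesis
      by (simp add: sum_distrib_left prod.distrib[symmetric] mult_ac)
  qed
  then have "(\<Sum>S\<in>Pow V. (\<Prod>v\<in>V. \<nu> (v \<in> S)) * (\<Prod>e\<in>E. (\<Prod>x\<in>e. a (x \<in> S)) + (\<Prod>x\<in>e. b (x \<in> S))))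
    = (\<Sum>A\<in>Pow E. \<Sum>S\<in>Pow V. \<Prod>v\<in>V. ?h A v (v \<in> S))"
    by (simp add: sum.swap[of _ "Pow E"])
  also have "\<dots> = (\<Sum>A\<in>Pow E. \<Prod>v\<in>V. ?h A v True + ?h A v False)"
  proof (rule sum.cong[OF refl])
    fix A
    have "(\<Sum>S\<in>Pow V. \<Prod>v\<in>V. ?h A v (v \<in> S)) = (\<Sum>S\<in>Pow V. \<Prod>v\<in>V. if v \<in> S then ?h A v True else ?h A v False)"
      by (intro sum.cong prod.cong) auto
    then show "(\<Sum>S\<in>Pow V. \<Prod>v\<in>V. ?h A v (v \<in> S)) = (\<Prod>v\<in>V. ?h A v True + ?h A v False)"
      by (simp only: sum_Pow_prod[OF fin(1)])
  qed
  finally show ?thesis by (simp add: UNIV_bool add.commute)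
qed

text \<open>If the coefficient of degree one vanishes, the two summands of each coefficient of odd
  degree have opposite signs, and the dominating one is the same for all degrees.\<close>

lemma rank_two_coeff_nonneg_aux:
  fixes a1 a2 b1 b2 \<nu>1 \<nu>2 :: real
  assumes "0 < a1" "0 < a2" "0 < \<nu>1" "0 < \<nu>2" "0 \<le> b1" "b2 \<le> 0" "- b2 / a2 \<le> b1 / a1"
    and st: "\<nu>1 * a1 ^ (d - 1) * b1 + \<nu>2 * a2 ^ (d - 1) * b2 = 0" and k: "k \<le> d"
  shows "0 \<le> \<nu>1 * a1 ^ (d - k) * b1 ^ k + \<nu>2 * a2 ^ (d - k) * b2 ^ k"
proof (cases k)
  case 0
  then show ?thesis using assms by simp
next
  case (Suc j)
  have eq: "\<nu> * a ^ (d - k) * b ^ k = (\<nu> * a ^ (d - 1) * b) * (b / a) ^ j" if "0 < a" for \<nu> a b :: real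
  proof -
    have "d - 1 = (d - k) + j" using k Suc by simp
    then show ?thesis using that Suc by (simp add: power_add power_divide)
  qed
  let ?\<alpha> = "\<nu>1 * a1 ^ (d - 1) * b1"
  have "\<nu>1 * a1 ^ (d - k) * b1 ^ k + \<nu>2 * a2 ^ (d - k) * b2 ^ k = ?\<alpha> * ((b1 / a1) ^ j - (b2 / a2) ^ j)"
  proof -
    have "\<nu>2 * a2 ^ (d - 1) * b2 = - ?\<alpha>" using st by linarith
    then show ?thesis unfolding eq[OF assms(1)] eq[OF assms(2)] by (simp only: right_diff_distrib) simp
  qed
  moreover have "(b2 / a2) ^ j \<le> (b1 / a1) ^ j"
  proof -
    have "(b2 / a2) ^ j \<le> \<bar>b2 / a2\<bar> ^ j"
      using abs_ge_self[of "(b2 / a2) ^ j"] by (simp only: power_abs)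
    also have "\<dots> \<le> (b1 / a1) ^ j"
    proof (rule power_mono)
      have "b2 / a2 \<le> 0" using assms by (simp add: divide_nonpos_pos)
      then show "\<bar>b2 / a2\<bar> \<le> b1 / a1" using assms by simp
    qed simp
    finally show ?thesis .
  qed
  ultimately show ?thesis using assms by simp
qed

text \<open>Stationarity forces \<open>b1\<close> and \<open>b2\<close> to have opposite signs or
  vanish. Flipping both by \<open>\<eta>\<close> leaves the products of two \<open>b\<close> factors
  unchanged, so the one with the larger \<open>\<bar>b / a\<bar>\<close> can be made nonnegative, as
  \<open>rank_two_coeff_nonneg_aux\<close> wants.\<close>

lemma rank_two_coeff_nonneg:
  fixes a1 a2 b1 b2 \<nu>1 \<nu>2 :: real
  assumes a: "0 < a1" "0 < a2" and \<nu>: "0 < \<nu>1" "0 < \<nu>2"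
    and st: "\<nu>1 * a1 ^ (d - 1) * b1 + \<nu>2 * a2 ^ (d - 1) * b2 = 0"
  shows "\<exists>\<eta>\<in>{1, -1}. \<forall>k\<le>d. 0 \<le> \<nu>1 * a1 ^ (d - k) * (\<eta> * b1) ^ k + \<nu>2 * a2 ^ (d - k) * (\<eta> * b2) ^ k"
proof -
  have p: "0 < \<nu>1 * a1 ^ (d - 1)" "0 < \<nu>2 * a2 ^ (d - 1)" using a \<nu> by auto
  have signs: "(0 \<le> b1 \<and> b2 \<le> 0) \<or> (b1 \<le> 0 \<and> 0 \<le> b2)"
  proof (cases "0 \<le> b1")
    case True
    then have "0 \<le> \<nu>1 * a1 ^ (d - 1) * b1" using p by simp
    with st have "\<nu>2 * a2 ^ (d - 1) * b2 \<le> 0" by linarith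
    then have "b2 \<le> 0" using mult_pos_pos[OF p(2), of b2] by linarith
    with True show ?thesis by simp
  next
    case False
    then have "\<nu>1 * a1 ^ (d - 1) * b1 < 0" using p(1) mult_pos_neg[OF p(1), of b1] by simp
    with st have "0 < \<nu>2 * a2 ^ (d - 1) * b2" by linarith
    then have "0 < b2" using p(2) zero_less_mult_pos by blast
    with False show ?thesis by simp
  qed
  have st': "\<nu>2 * a2 ^ (d - 1) * b2 + \<nu>1 * a1 ^ (d - 1) * b1 = 0" using st by simp
  have neg: "\<nu>1 * a1 ^ (d - 1) * - b1 + \<nu>2 * a2 ^ (d - 1) * - b2 = 0"
    "\<nu>2 * a2 ^ (d - 1) * - b2 + \<nu>1 * a1 ^ (d - 1) * - b1 = 0" using st by (simp_all add: algebra_simps)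
  note aux = rank_two_coeff_nonneg_aux
  from signs show ?thesis
  proof
    assume s: "0 \<le> b1 \<and> b2 \<le> 0"
    show ?thesis
    proof (cases "- b2 / a2 \<le> b1 / a1")
      case True
      then show ?thesis using aux[OF a \<nu> _ _ _ st] s by (intro bexI[of _ 1]) auto
    next
      case False
      then have "0 \<le> \<nu>2 * a2 ^ (d - k) * (- b2) ^ k + \<nu>1 * a1 ^ (d - k) * (- b1) ^ k" if "k \<le> d" for k
        using aux[OF a(2,1) \<nu>(2,1) _ _ _ neg(2) that] s by auto
      then show ?thesis by (intro bexI[of _ "-1"]) (auto simp: add.commute)
    qed
  next
    assume s: "b1 \<le> 0 \<and> 0 \<le> b2"
    show ?thesis
    proof (cases "- b1 / a1 \<le> b2 / a2")
      case True
      then have "0 \<le> \<nu>2 * a2 ^ (d - k) * b2 ^ k + \<nu>1 * a1 ^ (d - k) * b1 ^ k" if "k \<le> d" for k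
        using aux[OF a(2,1) \<nu>(2,1) _ _ _ st' that] s by auto
      then show ?thesis by (intro bexI[of _ 1]) (auto simp: add.commute)
    next
      case False
      then have "0 \<le> \<nu>1 * a1 ^ (d - k) * (- b1) ^ k + \<nu>2 * a2 ^ (d - k) * (- b2) ^ k" if "k \<le> d" for k
        using aux[OF a \<nu> _ _ _ neg(1) that] s by auto
      then show ?thesis by (intro bexI[of _ "-1"]) auto
    qed
  qed
qed

text \<open>Two plane vectors \<open>(u1, v1)\<close> and \<open>(u2, v2)\<close> with positive
  scalar product. For a unit vector \<open>(c, s)\<close>, the \<open>x1\<close>, \<open>x2\<close>
  below are their coordinates along it and \<open>y1\<close>, \<open>y2\<close> those along
  \<open>(- s, c)\<close>.\<close>

locale rank_two =
  fixes d :: nat and \<nu>1 \<nu>2 u1 v1 u2 v2 :: real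
  assumes d: "0 < d" and \<nu>: "0 < \<nu>1" "0 < \<nu>2" and inner: "0 < u1 * u2 + v1 * v2"
begin

abbreviation "x1 c s \<equiv> u1 * c + v1 * s"
abbreviation "x2 c s \<equiv> u2 * c + v2 * s"
abbreviation "y1 c s \<equiv> v1 * c - u1 * s"
abbreviation "y2 c s \<equiv> v2 * c - u2 * s"

text \<open>Up to the factor \<open>d\<close>, the derivative of \<open>G\<close> along the unit
  circle vanishes; the same expression is the coefficient of degree one in the expansion.\<close>

abbreviation "stationary c s \<equiv> \<nu>1 * x1 c s ^ (d - 1) * y1 c s + \<nu>2 * x2 c s ^ (d - 1) * y2 c s = 0"

abbreviation "deg_coeff \<eta> c s k \<equiv> \<nu>1 * x1 c s ^ (d - k) * (\<eta> * y1 c s) ^ k + \<nu>2 * x2 c s ^ (d - k) * (\<eta> * y2 c s) ^ k"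

definition G :: "real \<Rightarrow> real \<Rightarrow> real" where
  "G c s = \<nu>1 * x1 c s ^ d + \<nu>2 * x2 c s ^ d"

text \<open>At a maximizer the two scalar products do not have opposite signs: otherwise
  reflect the unit vector across the line spanned by one of the two vectors.\<close>

lemma reflect_gt:
  assumes cs: "c\<^sup>2 + s\<^sup>2 = 1" and a: "0 < x1 c s" "x2 c s < 0"
  shows "\<exists>c' s'. c'\<^sup>2 + s'\<^sup>2 = 1 \<and> G c s < G c' s'"
proof -
  define n where "n = u1\<^sup>2 + v1\<^sup>2"
  have n: "0 < n"
    unfolding n_def using inner sum_power2_gt_zero_iff by fastforce
  define l where "l = 2 * x1 c s / n"
  have l: "0 < l" "l * n = 2 * x1 c s" unfolding l_def using a n by auto
  define c' s' where "c' = l * u1 - c" and "s' = l * v1 - s"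
  have "c'\<^sup>2 + s'\<^sup>2 = l * (l * n) - 2 * l * x1 c s + (c\<^sup>2 + s\<^sup>2)"
    unfolding c'_def s'_def n_def by (simp add: power2_eq_square algebra_simps)
  then have unit: "c'\<^sup>2 + s'\<^sup>2 = 1" unfolding l(2) cs by simp
  have "x1 c' s' = l * n - x1 c s"
    unfolding c'_def s'_def n_def by (simp add: power2_eq_square algebra_simps)
  then have a1: "x1 c' s' = x1 c s" unfolding l(2) by simp
  have "x2 c' s' = l * (u1 * u2 + v1 * v2) - x2 c s"
    unfolding c'_def s'_def by (simp add: algebra_simps)
  then have a2: "- x2 c s < x2 c' s'" using l inner by simp
  have "x2 c s ^ d \<le> (- x2 c s) ^ d"
    using a(2) by (metis abs_ge_self abs_of_neg power_abs)
  also have "\<dots> < x2 c' s' ^ d"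
    using a2 a(2) d by (intro power_strict_mono) auto
  finally have "G c s < G c' s'" unfolding G_def a1 using \<nu> by simp
  with unit show ?thesis by blast
qed

end

lemma rank_two_swap:
  assumes "rank_two d \<nu>1 \<nu>2 u1 v1 u2 v2"
  shows "rank_two d \<nu>2 \<nu>1 u2 v2 u1 v1" "rank_two.G d \<nu>2 \<nu>1 u2 v2 u1 v1 c s = rank_two.G d \<nu>1 \<nu>2 u1 v1 u2 v2 c s"
proof -
  show *: "rank_two d \<nu>2 \<nu>1 u2 v2 u1 v1" using assms by (auto simp: rank_two_def mult.commute)
  show "rank_two.G d \<nu>2 \<nu>1 u2 v2 u1 v1 c s = rank_two.G d \<nu>1 \<nu>2 u1 v1 u2 v2 c s"
    unfolding rank_two.G_def[OF assms] rank_two.G_def[OF *] by simp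
qed

context rank_two
begin

text \<open>If one scalar product were zero, stationarity with \<open>d \<ge> 2\<close> would
  contradict either \<open>0 < a1 * a2 + b1 * b2\<close> or \<open>0 < G c0 s0\<close>. Opposite
  signs are excluded by \<open>reflect_gt\<close>. If both are negative, \<open>0 < G c0 s0\<close>
  makes \<open>d\<close> even, and the opposite vector is a maximizer too.\<close>

lemma positive_maximizer:
  assumes d2: "2 \<le> d" and max: "\<And>c s. c\<^sup>2 + s\<^sup>2 = 1 \<Longrightarrow> G c s \<le> G c0 s0" and pos: "0 < G c0 s0"
    and cs: "c0\<^sup>2 + s0\<^sup>2 = 1"
    and st: "stationary c0 s0"
  obtains c s where "c\<^sup>2 + s\<^sup>2 = 1" "G c s = G c0 s0" "0 < x1 c s" "0 < x2 c s"
    "stationary c s"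
proof -
  interpret sw: rank_two d \<nu>2 \<nu>1 u2 v2 u1 v1 by (rule rank_two_swap(1)) unfold_locales
  have swG: "sw.G c s = G c s" for c s by (rule rank_two_swap(2)) unfold_locales
  define a1 a2 b1 b2 where "a1 = x1 c0 s0" and "a2 = x2 c0 s0"
    and "b1 = y1 c0 s0" and "b2 = y2 c0 s0"
  have "a1 * a2 + b1 * b2 = (u1 * u2 + v1 * v2) * (c0\<^sup>2 + s0\<^sup>2)"
    unfolding a1_def a2_def b1_def b2_def by (simp add: power2_eq_square algebra_simps)
  then have ab: "0 < a1 * a2 + b1 * b2" using inner cs by simp
  have st': "\<nu>1 * a1 ^ (d - 1) * b1 + \<nu>2 * a2 ^ (d - 1) * b2 = 0"
    using st unfolding a1_def a2_def b1_def b2_def .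
  have G0: "G c0 s0 = \<nu>1 * a1 ^ d + \<nu>2 * a2 ^ d" unfolding G_def a1_def a2_def ..
  have nz1: "a1 \<noteq> 0"
  proof
    assume z: "a1 = 0"
    then have "\<nu>2 * a2 ^ (d - 1) * b2 = 0" using st' d2 by (simp add: power_0_left)
    then have "a2 = 0 \<or> b2 = 0" using \<nu> by auto
    then show False
    proof
      assume "a2 = 0" then show False using pos d unfolding G0 z by (simp add: power_0_left)
    next
      assume "b2 = 0" then show False using ab z by simp
    qed
  qed
  have nz2: "a2 \<noteq> 0"
  proof
    assume z: "a2 = 0"
    then have "\<nu>1 * a1 ^ (d - 1) * b1 = 0" using st' d2 by (simp add: power_0_left)
    then have "b1 = 0" using \<nu> nz1 by auto
    then show False using ab z by simp
  qed
  have o1: "\<not> (0 < a1 \<and> a2 < 0)"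
    using reflect_gt[OF cs] max unfolding a1_def a2_def by (meson not_le)
  have o2: "\<not> (0 < a2 \<and> a1 < 0)"
    using sw.reflect_gt[OF cs] max unfolding a1_def a2_def swG by (meson not_le)
  show ?thesis
  proof (cases "0 < a1")
    case True
    then have "0 < a2" using o1 nz2 by auto
    then show ?thesis using that[of c0 s0] cs True st unfolding a1_def a2_def by simp
  next
    case False
    then have neg: "a1 < 0" "a2 < 0" using o2 nz1 nz2 by auto
    have ev: "even d"
    proof (rule ccontr)
      assume "odd d"
      then have "a1 ^ d < 0" "a2 ^ d < 0" using neg by (simp_all add: power_less_zero_eq)
      then have "G c0 s0 < 0" unfolding G0 using \<nu> by (simp add: add_neg_neg mult_pos_neg)
      then show False using pos by simp
    qed
    have m: "u1 * - c0 + v1 * - s0 = - a1" "u2 * - c0 + v2 * - s0 = - a2"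
      "v1 * - c0 - u1 * - s0 = - b1" "v2 * - c0 - u2 * - s0 = - b2"
      unfolding a1_def a2_def b1_def b2_def by simp_all
    have "odd (d - 1)" using ev d by simp
    then have "\<nu>1 * (- a1) ^ (d - 1) * (- b1) + \<nu>2 * (- a2) ^ (d - 1) * (- b2) = 0"
      using st' by (simp add: power_minus_odd)
    moreover have "G (- c0) (- s0) = G c0 s0" unfolding G0 unfolding G_def m using ev by simp
    ultimately show ?thesis using that[of "- c0" "- s0"] cs neg unfolding m by simp
  qed
qed

end

definition potts_u :: "real \<Rightarrow> real \<Rightarrow> real" where "potts_u q w = sqrt (1 + w / q)"
definition potts_v1 :: "real \<Rightarrow> real \<Rightarrow> real" where "potts_v1 q w = sqrt ((q - 1) * w / q)"
definition potts_v2 :: "real \<Rightarrow> real \<Rightarrow> real" where "potts_v2 q w = - sqrt (w / (q * (q - 1)))"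

text \<open>The two-spin interaction matrix is the Gram matrix of the vectors \<open>(u, v1)\<close> and \<open>(u, v2)\<close>.\<close>

lemma potts_gram:
  assumes q: "2 \<le> q" and w: "0 \<le> w"
  shows "(potts_u q w)\<^sup>2 + (potts_v1 q w)\<^sup>2 = 1 + w"
    "(potts_u q w)\<^sup>2 + (potts_v2 q w)\<^sup>2 = 1 + w / (q - 1)"
    "potts_u q w * potts_u q w + potts_v1 q w * potts_v2 q w = 1"
proof -
  have nn: "0 \<le> 1 + w / q" "0 \<le> (q - 1) * w / q" "0 \<le> w / (q * (q - 1))" using q w by auto
  have ne: "q \<noteq> 0" "q - 1 \<noteq> 0" using q by auto
  have u: "(potts_u q w)\<^sup>2 = 1 + w / q" unfolding potts_u_def using nn by simp
  show "(potts_u q w)\<^sup>2 + (potts_v1 q w)\<^sup>2 = 1 + w"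
    unfolding u potts_v1_def using nn ne by (simp add: field_simps)
  show "(potts_u q w)\<^sup>2 + (potts_v2 q w)\<^sup>2 = 1 + w / (q - 1)"
    unfolding u potts_v2_def using nn ne by (simp add: divide_simps) (simp add: algebra_simps)
  have "(q - 1) * w / q * (w / (q * (q - 1))) = (w / q)\<^sup>2"
    using ne by (simp add: divide_simps power2_eq_square)
  then have "potts_v1 q w * potts_v2 q w = - sqrt ((w / q)\<^sup>2)"
    unfolding potts_v1_def potts_v2_def by (simp only: mult_minus_right real_sqrt_mult[symmetric])
  then have "potts_v1 q w * potts_v2 q w = - (w / q)" using q w by simp
  then show "potts_u q w * potts_u q w + potts_v1 q w * potts_v2 q w = 1"
    using u by (simp add: power2_eq_square)
qed

locale potts =
  fixes d :: nat and q w :: real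
  assumes d0: "0 < d" and q: "2 \<le> q" and w: "0 \<le> w"

sublocale potts \<subseteq> rank_two d 1 "q - 1" "potts_u q w" "potts_v1 q w" "potts_u q w" "potts_v2 q w"
proof
  show "0 < d" by (rule d0)
  show "0 < (1::real)" by simp
  show "0 < q - 1" using q by simp
  show "0 < potts_u q w * potts_u q w + potts_v1 q w * potts_v2 q w"
    unfolding potts_gram(3)[OF q w] by simp
qed

context potts
begin

lemma Phi_fun_eq: "Phi_fun d q w t = G (cos t) (sin t)"
  unfolding Phi_fun_def G_def by (simp add: potts_u_def potts_v1_def potts_v2_def)

lemma G_le_Phi_max:
  assumes "c\<^sup>2 + s\<^sup>2 = 1" shows "G c s \<le> Phi_max d q w"
proof -
  obtain t where t: "0 \<le> t" "t < 2 * pi" "c = cos t" "s = sin t" using sincos_total_2pi[OF assms] by metis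
  define t' where "t' = (if t \<le> pi then t else t - 2 * pi)"
  have t': "t' \<in> {-pi..pi}" "c = cos t'" "s = sin t'"
    using t by (auto simp: t'_def cos_diff sin_diff)
  then have "G c s = Phi_fun d q w t'" by (simp add: Phi_fun_eq)
  then show ?thesis using Phi_max_attained[of d q w] t'(1) by metis
qed

lemma Phi_max_pos: "0 < Phi_max d q w"
proof -
  have u: "0 < potts_u q w" unfolding potts_u_def using q w by (simp add: add_pos_nonneg)
  have "0 < G 1 0" unfolding G_def using u q by (simp add: add_pos_pos)
  also have "\<dots> \<le> Phi_max d q w" by (rule G_le_Phi_max) simp
  finally show ?thesis .
qed

lemma Phi_maximizer:
  obtains c s where "c\<^sup>2 + s\<^sup>2 = 1" "G c s = Phi_max d q w"
    "stationary c s"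
proof -
  obtain t where t: "Phi_max d q w = Phi_fun d q w t" using Phi_max_attained by metis
  let ?D = "1 * x1 (cos t) (sin t) ^ (d - 1) * y1 (cos t) (sin t)
    + (q - 1) * x2 (cos t) (sin t) ^ (d - 1) * y2 (cos t) (sin t)"
  have der: "((\<lambda>t. G (cos t) (sin t)) has_real_derivative d * ?D) (at t)"
    unfolding G_def by (rule derivative_eq_intros refl)+ (simp add: algebra_simps)
  \<comment> \<open>\<open>t\<close> may be an endpoint of \<open>[- \<pi>, \<pi>]\<close>, but
    \<open>G\<close> on the whole circle is at most \<open>Phi_max\<close>, so \<open>t\<close> is a
    local maximizer on the real line.\<close>
  have mx: "\<forall>y. \<bar>t - y\<bar> < 1 \<longrightarrow> G (cos y) (sin y) \<le> G (cos t) (sin t)"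
    using G_le_Phi_max[of "cos y" "sin y" for y] t by (simp add: Phi_fun_eq)
  have "d * ?D = 0" by (rule DERIV_local_max[OF der zero_less_one mx])
  then have "?D = 0" using d0 by simp
  then show ?thesis using that[of "cos t" "sin t"] t by (simp add: Phi_fun_eq)
qed

text \<open>Scalar products, and hence the edge weights, do not depend on the orthonormal basis;
  \<open>\<eta>\<close> only chooses the orientation of its second vector.\<close>

lemma two_spin_Z_rotated:
  fixes c s \<eta> :: real
  assumes R: "regular_graph d (V, E)" and cs: "c\<^sup>2 + s\<^sup>2 = 1" and \<eta>: "\<eta> \<in> {1, -1}"
  defines "a \<equiv> \<lambda>\<sigma>. if \<sigma> then x2 c s else x1 c s"
    and "b \<equiv> \<lambda>\<sigma>. if \<sigma> then \<eta> * y2 c s else \<eta> * y1 c s"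
    and "\<nu> \<equiv> \<lambda>\<sigma>. if \<sigma> then q - 1 else 1"
  shows "two_spin_Z V E (q - 1) w =
    (\<Sum>S\<in>Pow V. (\<Prod>v\<in>V. \<nu> (v \<in> S)) * (\<Prod>e\<in>E. (\<Prod>x\<in>e. a (x \<in> S)) + (\<Prod>x\<in>e. b (x \<in> S))))"
  unfolding two_spin_Z_def
proof (rule sum.cong[OF refl])
  fix S assume S: "S \<in> Pow V"
  have Gr: "fin_graph (V, E)" using R by (simp add: regular_graph_def)
  have fin: "finite V" "finite E" using Gr fin_graph_finite_edges[OF Gr] by (auto simp: fin_graph_def)
  have \<eta>2: "\<eta> * \<eta> = 1" using \<eta> by auto
  have rot: "(u * c + v * s) * (u' * c + v' * s) + (\<eta> * (v * c - u * s)) * (\<eta> * (v' * c - u' * s)) = u * u' + v * v'"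
    for u v u' v' :: real
  proof -
    have "(u * c + v * s) * (u' * c + v' * s) + (\<eta> * \<eta>) * ((v * c - u * s) * (v' * c - u' * s))
      = (u * u' + v * v') * (c\<^sup>2 + s\<^sup>2)"
      unfolding \<eta>2 by (simp add: power2_eq_square algebra_simps)
    then show ?thesis unfolding cs by (simp add: mult_ac)
  qed
  have "(\<Prod>v\<in>V. \<nu> (v \<in> S)) = (q - 1) ^ card S"
  proof -
    have "(\<Prod>v\<in>V. \<nu> (v \<in> S)) = (\<Prod>v\<in>V. if v \<in> S then q - 1 else 1)" by (simp add: \<nu>_def)
    also have "\<dots> = (q - 1) ^ card {v \<in> V. v \<in> S}" by (rule prod_if_power[OF fin(1)])
    also have "{v \<in> V. v \<in> S} = S" using S by auto
    finally show ?thesis .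
  qed
  moreover have "(\<Prod>e\<in>E. (\<Prod>x\<in>e. a (x \<in> S)) + (\<Prod>x\<in>e. b (x \<in> S)))
    = (\<Prod>e\<in>E. (if e \<subseteq> V - S then 1 + w else 1) * (if e \<subseteq> S then 1 + w / (q - 1) else 1))"
  proof (rule prod.cong[OF refl])
    fix e assume "e \<in> E"
    then obtain x y where xy: "e = {x, y}" "x \<noteq> y" "x \<in> V" "y \<in> V" by (rule fin_graph_edgeE[OF Gr])
    have ab: "a \<sigma> * a \<tau> + b \<sigma> * b \<tau> =
       (if \<sigma> \<and> \<tau> then 1 + w / (q - 1) else if \<not> \<sigma> \<and> \<not> \<tau> then 1 + w else 1)" for \<sigma> \<tau>
      unfolding a_def b_def
      using rot[of "potts_u q w" "potts_v1 q w" "potts_u q w" "potts_v1 q w"]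
        rot[of "potts_u q w" "potts_v1 q w" "potts_u q w" "potts_v2 q w"]
        rot[of "potts_u q w" "potts_v2 q w" "potts_u q w" "potts_v1 q w"]
        rot[of "potts_u q w" "potts_v2 q w" "potts_u q w" "potts_v2 q w"] potts_gram[OF q w]
      by (cases \<sigma>; cases \<tau>) (simp_all only: power2_eq_square if_True if_False simp_thms mult.commute)
    show "(\<Prod>x\<in>e. a (x \<in> S)) + (\<Prod>x\<in>e. b (x \<in> S))
      = (if e \<subseteq> V - S then 1 + w else 1) * (if e \<subseteq> S then 1 + w / (q - 1) else 1)"
      using xy ab[of "x \<in> S" "y \<in> S"] by auto
  qed
  ultimately show "(1 + w) ^ card (edges_in E (V - S)) * ((q - 1) ^ card S * (1 + w / (q - 1)) ^ card (edges_in E S))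
    = (\<Prod>v\<in>V. \<nu> (v \<in> S)) * (\<Prod>e\<in>E. (\<Prod>x\<in>e. a (x \<in> S)) + (\<Prod>x\<in>e. b (x \<in> S)))"
    by (simp add: prod.distrib prod_if_power[OF fin(2)])
qed

lemma two_spin_lower:
  assumes R: "regular_graph d (V, E)"
  shows "Phi_max d q w ^ card V \<le> two_spin_Z V E (q - 1) w"
proof -
  have Gr: "fin_graph (V, E)" using R by (simp add: regular_graph_def)
  have fin: "finite V" "finite E" using Gr fin_graph_finite_edges[OF Gr] by (auto simp: fin_graph_def)
  have "\<exists>c s. c\<^sup>2 + s\<^sup>2 = 1 \<and> G c s = Phi_max d q w \<and> (\<exists>\<eta>\<in>{1, -1}. \<forall>k\<le>d.
    0 \<le> deg_coeff \<eta> c s k)"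
  \<comment> \<open>For \<open>d = 1\<close>, \<open>positive_maximizer\<close> does not apply, but
    only degrees 0 and 1 occur, with coefficients \<open>Phi_max d q w\<close> and
    \<open>0\<close>.\<close>
  proof (cases "d = 1")
    case True
    obtain c s where cs: "c\<^sup>2 + s\<^sup>2 = 1" "G c s = Phi_max d q w"
      "stationary c s"
      by (rule Phi_maximizer)
    have "0 \<le> deg_coeff 1 c s k"
      if "k \<le> d" for k
    proof (cases "k = 0")
      case True
      then show ?thesis using cs(2) Phi_max_pos by (simp add: G_def)
    next
      case False
      then have "k = 1" using that True by simp
      then show ?thesis using cs(3) by simp
    qed
    then show ?thesis using cs by blast
  next
    case False
    then have d2: "2 \<le> d" using d0 by simp
    obtain c0 s0 where cs: "c0\<^sup>2 + s0\<^sup>2 = 1" "G c0 s0 = Phi_max d q w"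
      "stationary c0 s0"
      by (rule Phi_maximizer)
    obtain c s where m: "c\<^sup>2 + s\<^sup>2 = 1" "G c s = Phi_max d q w"
      "0 < x1 c s" "0 < x2 c s"
      "stationary c s"
      using positive_maximizer[OF d2 _ _ cs(1) cs(3)] G_le_Phi_max Phi_max_pos cs(2) by metis
    have "0 < q - 1" using q by simp
    from rank_two_coeff_nonneg[OF m(3,4) zero_less_one this m(5)] m(1,2) show ?thesis by blast
  qed
  then obtain c s \<eta> where cs: "c\<^sup>2 + s\<^sup>2 = 1" "G c s = Phi_max d q w" "\<eta> \<in> {1, -1}" and nn: "\<And>k. k \<le> d \<Longrightarrow>
    0 \<le> deg_coeff \<eta> c s k"
    by blast
  define a where "a = (\<lambda>\<sigma>. if \<sigma> then x2 c s else x1 c s)"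
  define b where "b = (\<lambda>\<sigma>. if \<sigma> then \<eta> * y2 c s else \<eta> * y1 c s)"
  define \<nu> where "\<nu> = (\<lambda>\<sigma>. if \<sigma> then q - 1 else 1)"
  define r where "r k = (\<Sum>\<sigma>\<in>UNIV. \<nu> \<sigma> * a \<sigma> ^ (d - k) * b \<sigma> ^ k)" for k
  have r: "0 \<le> r k" if "k \<le> d" for k
    using nn[OF that] by (simp add: r_def UNIV_bool a_def b_def \<nu>_def add.commute)
  have r0: "r 0 = Phi_max d q w"
    using cs(2) by (simp add: r_def UNIV_bool a_def \<nu>_def G_def add.commute)
  have "two_spin_Z V E (q - 1) w = (\<Sum>A\<in>Pow E. \<Prod>v\<in>V. r (card (edges_at A v)))"
    unfolding two_spin_Z_rotated[OF R cs(1,3)] r_def a_def b_def \<nu>_def by (rule rank_two_expansion[OF R])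
  moreover have "(\<Sum>A\<in>{{}}. \<Prod>v\<in>V. r (card (edges_at A v))) \<le> (\<Sum>A\<in>Pow E. \<Prod>v\<in>V. r (card (edges_at A v)))"
  proof (rule sum_mono2)
    fix A assume A: "A \<in> Pow E - {{}}"
    have "card (edges_at A v) \<le> d" if "v \<in> V" for v
    proof -
      have "card (edges_at A v) \<le> card (edges_at E v)" using A fin by (intro card_mono) auto
      then show ?thesis using R that by (simp add: regular_graph_def)
    qed
    then show "0 \<le> (\<Prod>v\<in>V. r (card (edges_at A v)))" by (intro prod_nonneg r) auto
  qed (use fin in auto)
  ultimately show ?thesis using r0 by simp
qed

section \<open>The upper bound for the two-spin model\<close>

text \<open>The edge weights \<open>1 + w\<close> and \<open>1 + w / (q - 1)\<close> of a regular graph are absorbed in the activities.\<close>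

definition gauge1 :: real where "gauge1 = sqrt (1 + w)"
definition gauge2 :: real where "gauge2 = sqrt (1 + w / (q - 1))"
text \<open>Each end of an edge gets its gauge factor. Edges with equal spins are then accounted
  for, and an edge with unequal spins, of weight 1, is left with this factor.\<close>

definition coupling :: real where "coupling = 1 / (gauge1 * gauge2)"
definition act1 :: real where "act1 = gauge1 ^ d"
definition act2 :: real where "act2 = (q - 1) * gauge2 ^ d"

lemma gauge: "1 \<le> gauge1" "1 \<le> gauge2" "gauge1 * gauge1 = 1 + w" "gauge2 * gauge2 = 1 + w / (q - 1)"
proof -
  have nn: "0 \<le> w / (q - 1)" using q w by simp
  then show "1 \<le> gauge1" "1 \<le> gauge2" unfolding gauge1_def gauge2_def using w by simp_all
  show "gauge1 * gauge1 = 1 + w" "gauge2 * gauge2 = 1 + w / (q - 1)"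
    unfolding gauge1_def gauge2_def using nn w by simp_all
qed

lemma coupling: "0 < coupling" "coupling \<le> 1" "coupling * (gauge1 * gauge2) = 1"
proof -
  have "1 * 1 \<le> gauge1 * gauge2" using gauge by (intro mult_mono) auto
  then show "0 < coupling" "coupling \<le> 1" "coupling * (gauge1 * gauge2) = 1" unfolding coupling_def by auto
qed

lemma act_pos: "0 < act1" "0 < act2"
proof -
  have "0 < gauge1" "0 < gauge2" "0 < q - 1" using gauge(1,2) q by linarith+
  then show "0 < act1" "0 < act2" unfolding act1_def act2_def by simp_all
qed

lemma two_spin_Z_eq:
  assumes R: "regular_graph d (V, E)"
  shows "two_spin_Z V E (q - 1) w =
    (\<Sum>S\<in>Pow V. act1 ^ card (V - S) * act2 ^ card S * coupling ^ card {e \<in> E. card (e \<inter> S) = 1})"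
  unfolding two_spin_Z_def
proof (rule sum.cong[OF refl])
  fix S assume S: "S \<in> Pow V"
  have Gr: "fin_graph (V, E)" using R by (simp add: regular_graph_def)
  have fin: "finite V" "finite E" using Gr fin_graph_finite_edges[OF Gr] by (auto simp: fin_graph_def)
  let ?g = "\<lambda>v. if v \<in> S then gauge2 else gauge1"
  have "(1 + w) ^ card (edges_in E (V - S)) * (1 + w / (q - 1)) ^ card (edges_in E S)
    = (\<Prod>e\<in>E. (if e \<subseteq> V - S then 1 + w else 1) * (if e \<subseteq> S then 1 + w / (q - 1) else 1))"
    by (simp add: prod.distrib prod_if_power[OF fin(2)])
  also have "\<dots> = (\<Prod>e\<in>E. (\<Prod>v\<in>e. ?g v) * (if card (e \<inter> S) = 1 then coupling else 1))"
  proof (rule prod.cong[OF refl])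
    fix e assume "e \<in> E"
    then obtain x y where xy: "e = {x, y}" "x \<noteq> y" "x \<in> V" "y \<in> V" by (rule fin_graph_edgeE[OF Gr])
    then have "(\<Prod>v\<in>e. ?g v) = ?g x * ?g y" by simp
    then show "(if e \<subseteq> V - S then 1 + w else 1) * (if e \<subseteq> S then 1 + w / (q - 1) else 1)
      = (\<Prod>v\<in>e. ?g v) * (if card (e \<inter> S) = 1 then coupling else 1)"
      using gauge coupling(3) xy card_doubleton_Int[OF xy(2), of S]
      by (cases "x \<in> S"; cases "y \<in> S") (simp_all add: mult_ac)
  qed
  also have "\<dots> = (\<Prod>v\<in>V. ?g v ^ d) * coupling ^ card {e \<in> E. card (e \<inter> S) = 1}"
  proof -
    have "(\<Prod>v\<in>V. ?g v ^ card (edges_at E v)) = (\<Prod>v\<in>V. ?g v ^ d)"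
      using R by (intro prod.cong) (auto simp: regular_graph_def)
    then show ?thesis
      unfolding prod.distrib prod_edges_vertices[OF Gr] prod_if_power[OF fin(2)] by simp
  qed
  also have "(\<Prod>v\<in>V. ?g v ^ d) = (\<Prod>v\<in>V - S. ?g v ^ d) * (\<Prod>v\<in>S. ?g v ^ d)"
    using S fin by (intro prod.subset_diff) auto
  also have "\<dots> = act1 ^ card (V - S) * (gauge2 ^ d) ^ card S" by (simp add: act1_def)
  finally show "(1 + w) ^ card (edges_in E (V - S)) * ((q - 1) ^ card S * (1 + w / (q - 1)) ^ card (edges_in E S))
    = act1 ^ card (V - S) * act2 ^ card S * coupling ^ card {e \<in> E. card (e \<inter> S) = 1}"
    by (simp add: act2_def power_mult_distrib mult_ac)
qed

text \<open>The second form is the global spin flip \<open>S \<mapsto> V - S\<close>; one of the two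
  activities is at most 1, as the upper bound needs.\<close>

lemma two_spin_Z_ising:
  assumes R: "regular_graph d (V, E)"
  shows "two_spin_Z V E (q - 1) w = act1 ^ card V * ising_Z V E coupling (act2 / act1)"
    and "two_spin_Z V E (q - 1) w = act2 ^ card V * ising_Z V E coupling (act1 / act2)"
proof -
  have Gr: "fin_graph (V, E)" using R by (simp add: regular_graph_def)
  have fin: "finite V" using Gr by (auto simp: fin_graph_def)
  have c: "card V = card (V - S) + card S" if "S \<in> Pow V" for S
    using card_Diff_subset[OF finite_subset[OF _ fin], of S V] card_mono[OF fin, of S] that by auto
  let ?k = "\<lambda>S. coupling ^ card {e \<in> E. card (e \<inter> S) = 1}"
  have e: "y ^ card V * (z / y) ^ card S = y ^ card (V - S) * z ^ card S" if "0 < y" "S \<in> Pow V" for y z :: real and S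
    unfolding c[OF that(2)] using that(1) by (simp add: power_add power_divide)
  have A: "y ^ card V * ising_Z V E coupling (z / y) = (\<Sum>S\<in>Pow V. y ^ card (V - S) * z ^ card S * ?k S)"
    if "0 < y" for y z
    unfolding ising_Z_def sum_distrib_left ising_wt_def using e[OF that]
    by (intro sum.cong) (simp_all add: mult.assoc[symmetric])
  show "two_spin_Z V E (q - 1) w = act1 ^ card V * ising_Z V E coupling (act2 / act1)"
    unfolding two_spin_Z_eq[OF R] A[OF act_pos(1)] ..
  have "(\<Sum>S\<in>Pow V. act1 ^ card (V - S) * act2 ^ card S * ?k S)
     = (\<Sum>S\<in>Pow V. act2 ^ card (V - S) * act1 ^ card S * ?k S)"
  proof (rule sum.reindex_bij_witness[of _ "\<lambda>S. V - S" "\<lambda>S. V - S"])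
    fix S assume S: "S \<in> Pow V"
    have "card (e \<inter> (V - S)) = 1 \<longleftrightarrow> card (e \<inter> S) = 1" if e: "e \<in> E" for e
    proof -
      obtain x y where xy: "e = {x, y}" "x \<noteq> y" "x \<in> V" "y \<in> V" using e by (rule fin_graph_edgeE[OF Gr])
      show ?thesis unfolding xy(1) card_doubleton_Int[OF xy(2)] using xy by auto
    qed
    then have "{e \<in> E. card (e \<inter> (V - S)) = 1} = {e \<in> E. card (e \<inter> S) = 1}" by auto
    moreover have "V - (V - S) = S" using S by auto
    ultimately show "act2 ^ card (V - (V - S)) * act1 ^ card (V - S) * ?k (V - S)
      = act1 ^ card (V - S) * act2 ^ card S * ?k S" by simp
  qed auto
  then show "two_spin_Z V E (q - 1) w = act2 ^ card V * ising_Z V E coupling (act1 / act2)"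
    unfolding two_spin_Z_eq[OF R] A[OF act_pos(2)] .
qed

text \<open>Take the combination of \<open>(u, v1)\<close> and \<open>(u, v2)\<close> with
  coefficients \<open>m1 / gauge1\<close> and \<open>m2 / gauge2\<close>. By the Gram relations its
  squared length is \<open>1 + 2 * coupling * s + s\<^sup>2\<close> for messages
  \<open>(1, s)\<close> or \<open>(s, 1)\<close>, and \<open>G\<close> at the normalized vector is
  the Bethe value.\<close>

lemma bethe_le_Phi_max:
  assumes s: "0 \<le> s"
  shows "act1 * bethe d coupling (act2 / act1) s \<le> Phi_max d q w"
    and "act2 * bethe d coupling (act1 / act2) s \<le> Phi_max d q w"
proof -
  let ?n = "sqrt (1 + 2 * coupling * s + s\<^sup>2)"
  have n2: "0 < 1 + 2 * coupling * s + s\<^sup>2" using bethe_factors_pos(3)[OF coupling(1) s] .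
  then have n: "0 < ?n" "?n * ?n = 1 + 2 * coupling * s + s\<^sup>2" by auto
  let ?u = "potts_u q w" and ?v1 = "potts_v1 q w" and ?v2 = "potts_v2 q w"
  have g: "0 < gauge1" "0 < gauge2" using gauge by auto
  have gram: "?u * ?u + ?v1 * ?v1 = gauge1 * gauge1" "?u * ?u + ?v2 * ?v2 = gauge2 * gauge2"
    "?u * ?u + ?v1 * ?v2 = 1"
    using potts_gram[OF q w] gauge by (simp_all add: power2_eq_square)
  have i1: "gauge1 * coupling = 1 / gauge2" "gauge2 * coupling = 1 / gauge1"
    using coupling(3) g by (simp_all add: field_simps)
  have main: "((gauge1 * (m1 + coupling * m2)) ^ d + (q - 1) * (gauge2 * (coupling * m1 + m2)) ^ d) / ?n ^ d \<le> Phi_max d q w"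
    if m: "m1 * m1 + 2 * coupling * m1 * m2 + m2 * m2 = ?n * ?n" for m1 m2
  proof -
    define c0 where "c0 = m1 / gauge1 * ?u + m2 / gauge2 * ?u"
    define s0 where "s0 = m1 / gauge1 * ?v1 + m2 / gauge2 * ?v2"
    have "c0 * c0 + s0 * s0 = (m1 / gauge1) * (m1 / gauge1) * (?u * ?u + ?v1 * ?v1)
      + 2 * (m1 / gauge1) * (m2 / gauge2) * (?u * ?u + ?v1 * ?v2)
      + (m2 / gauge2) * (m2 / gauge2) * (?u * ?u + ?v2 * ?v2)"
      unfolding c0_def s0_def by (simp add: algebra_simps)
    also have "\<dots> = m1 * m1 + 2 * coupling * m1 * m2 + m2 * m2"
      unfolding gram using g by (simp add: coupling_def)
    finally have "c0 * c0 + s0 * s0 = ?n * ?n" using m by simp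
    then have unit: "(c0 / ?n)\<^sup>2 + (s0 / ?n)\<^sup>2 = 1"
      using n(1) by (simp add: power2_eq_square add_divide_distrib[symmetric])
    have "?u * c0 + ?v1 * s0 = m1 / gauge1 * (?u * ?u + ?v1 * ?v1) + m2 / gauge2 * (?u * ?u + ?v1 * ?v2)"
      unfolding c0_def s0_def by (simp add: algebra_simps)
    also have "\<dots> = gauge1 * (m1 + coupling * m2)"
      unfolding gram using g i1 by (simp add: distrib_left mult.assoc[symmetric])
    finally have p1: "?u * (c0 / ?n) + ?v1 * (s0 / ?n) = gauge1 * (m1 + coupling * m2) / ?n"
      by (simp add: add_divide_distrib[symmetric])
    have "?u * c0 + ?v2 * s0 = m1 / gauge1 * (?u * ?u + ?v1 * ?v2) + m2 / gauge2 * (?u * ?u + ?v2 * ?v2)"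
      unfolding c0_def s0_def by (simp add: algebra_simps)
    also have "\<dots> = gauge2 * (coupling * m1 + m2)"
      unfolding gram using g i1 by (simp add: distrib_left mult.assoc[symmetric])
    finally have p2: "?u * (c0 / ?n) + ?v2 * (s0 / ?n) = gauge2 * (coupling * m1 + m2) / ?n"
      by (simp add: add_divide_distrib[symmetric])
    have "G (c0 / ?n) (s0 / ?n) = ((gauge1 * (m1 + coupling * m2)) ^ d + (q - 1) * (gauge2 * (coupling * m1 + m2)) ^ d) / ?n ^ d"
      unfolding G_def p1 p2 by (simp add: power_divide add_divide_distrib)
    then show ?thesis using G_le_Phi_max[OF unit] by simp
  qed
  have "act1 * bethe d coupling (act2 / act1) s
    = ((gauge1 * (1 + coupling * s)) ^ d + (q - 1) * (gauge2 * (coupling * 1 + s)) ^ d) / ?n ^ d"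
  proof -
    have "act1 * (A + act2 / act1 * B) = act1 * A + act2 * B" for A B
      using act_pos by (simp add: distrib_left)
    then show ?thesis
      unfolding bethe_def times_divide_eq_right power_mult_distrib
      by (simp add: act1_def act2_def add.commute mult.assoc)
  qed
  also have "\<dots> \<le> Phi_max d q w"
    by (rule main, unfold n(2)) (simp add: power2_eq_square)
  finally show "act1 * bethe d coupling (act2 / act1) s \<le> Phi_max d q w" .
  have "act2 * bethe d coupling (act1 / act2) s
    = ((gauge1 * (s + coupling * 1)) ^ d + (q - 1) * (gauge2 * (coupling * s + 1)) ^ d) / ?n ^ d"
  proof -
    have "act2 * (A + act1 / act2 * B) = act1 * B + act2 * A" for A B
      using act_pos by (simp add: distrib_left)
    then show ?thesis
      unfolding bethe_def times_divide_eq_right power_mult_distrib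
      by (simp add: act1_def act2_def add.commute mult.assoc)
  qed
  also have "\<dots> \<le> Phi_max d q w"
    by (rule main, unfold n(2)) (simp add: power2_eq_square)
  finally show "act2 * bethe d coupling (act1 / act2) s \<le> Phi_max d q w" .
qed

lemma two_spin_upper:
  assumes \<epsilon>: "0 < \<epsilon>"
  shows "\<exists>K (C::real). 0 \<le> C \<and> (\<forall>(V :: 'v set) E. regular_graph d (V, E) \<longrightarrow>
    ln (two_spin_Z V E (q - 1) w) \<le> card V * (ln (Phi_max d q w) + \<epsilon>) + C * num_bad V E (Suc K))"
proof -
  have main: ?thesis
    if y: "0 < y" and \<mu>: "0 < \<mu>" "\<mu> \<le> 1"
      and Z: "\<And>V E. regular_graph d (V :: 'v set, E) \<Longrightarrow> two_spin_Z V E (q - 1) w = y ^ card V * ising_Z V E coupling \<mu>"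
      and B: "\<And>s. 0 \<le> s \<Longrightarrow> y * bethe d coupling \<mu> s \<le> Phi_max d q w" for y \<mu>
  proof -
    obtain s K and C :: real where sKC: "0 \<le> s \<and> s \<le> 1 \<and> 0 \<le> C \<and> (\<forall>(V :: 'v set) E. regular_graph d (V, E) \<longrightarrow>
      ln (ising_Z V E coupling \<mu>) \<le> card V * (ln (bethe d coupling \<mu> s) + \<epsilon>) + C * num_bad V E (Suc K))"
      using ising_upper[OF d0 coupling(1,2) \<mu> \<epsilon>] by (elim exE)
    then have s: "0 \<le> s" "0 \<le> C" by simp_all
    have up: "ln (ising_Z V E coupling \<mu>) \<le> card V * (ln (bethe d coupling \<mu> s) + \<epsilon>) + C * num_bad V E (Suc K)"
      if "regular_graph d (V, E)" for V :: "'v set" and E using sKC that by simp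
    have "cavity d coupling \<mu>" using d0 coupling \<mu> by unfold_locales auto
    then have bp: "0 < bethe d coupling \<mu> s" using cavity.bethe_pos s by blast
    have "ln (y * bethe d coupling \<mu> s) \<le> ln (Phi_max d q w)"
      using B[OF s(1)] bp y by (subst ln_le_cancel_iff) (auto intro: Phi_max_pos)
    then have ly: "ln y + ln (bethe d coupling \<mu> s) \<le> ln (Phi_max d q w)"
      using bp y by (simp add: ln_mult)
    have "ln (two_spin_Z V E (q - 1) w) \<le> card V * (ln (Phi_max d q w) + \<epsilon>) + C * num_bad V E (Suc K)"
      if R: "regular_graph d (V, E)" for V :: "'v set" and E
    proof -
      have "finite V" using R by (simp add: regular_graph_def fin_graph_def)
      then have "0 < ising_Z V E coupling \<mu>" using coupling \<mu> by (intro ising_Z_pos) auto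
      then have "ln (two_spin_Z V E (q - 1) w) = card V * ln y + ln (ising_Z V E coupling \<mu>)"
        unfolding Z[OF R] using y by (simp add: ln_mult ln_realpow)
      also have "\<dots> \<le> card V * ln y + (card V * (ln (bethe d coupling \<mu> s) + \<epsilon>) + C * num_bad V E (Suc K))"
        using up[OF R] by simp
      also have "\<dots> = card V * (ln y + ln (bethe d coupling \<mu> s) + \<epsilon>) + C * num_bad V E (Suc K)"
        by (simp add: algebra_simps)
      also have "\<dots> \<le> card V * (ln (Phi_max d q w) + \<epsilon>) + C * num_bad V E (Suc K)"
        using ly by (intro add_right_mono mult_left_mono) auto
      finally show ?thesis .
    qed
    then show ?thesis using s(2) by blast
  qed
  show ?thesis
  proof (cases "act2 \<le> act1")
    case True
    then show ?thesis using act_pos two_spin_Z_ising(1) bethe_le_Phi_max(1)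
      by (intro main[of act1 "act2 / act1"]) auto
  next
    case False
    then show ?thesis using act_pos two_spin_Z_ising(2) bethe_le_Phi_max(2)
      by (intro main[of act2 "act1 / act2"]) auto
  qed
qed

text \<open>The lower bound has no error term. In the upper bound, \<open>g1\<close> controls the
  cyclic components and \<open>g2\<close> the vertices without a tree ball; all constants are
  uniform over \<open>d\<close>-regular graphs.\<close>

lemma free_energy_estimate:
  assumes \<epsilon>: "0 < \<epsilon>"
  shows "\<exists>g1 g2 (C::real). \<forall>G :: 'v graph. regular_graph d G \<longrightarrow>
    0 \<le> 1 / card (verts G) * ln (rc_partition G q w) - ln (Phi_max d q w) \<and>
    1 / card (verts G) * ln (rc_partition G q w) - ln (Phi_max d q w) \<le>
      \<epsilon> + C * (num_short_cycles G g1 / card (verts G)) + C * (num_short_cycles G g2 / card (verts G))"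
proof -
  obtain K and C :: real where C: "0 \<le> C" and up: "\<And>(V :: 'v set) E. regular_graph d (V, E) \<Longrightarrow>
    ln (two_spin_Z V E (q - 1) w) \<le> card V * (ln (Phi_max d q w) + \<epsilon> / 2) + C * num_bad V E (Suc K)"
    using two_spin_upper[of "\<epsilon> / 2"] \<epsilon> by auto
  have lq: "0 < ln q" using q by simp
  obtain g :: nat where g: "0 < g" "ln q / g \<le> \<epsilon> / 2"
  proof -
    obtain g :: nat where "2 * ln q / \<epsilon> < g" using reals_Archimedean2 by blast
    moreover have "0 < 2 * ln q / \<epsilon>" using lq \<epsilon> by simp
    ultimately have "0 < real g" by linarith
    moreover have "ln q / g \<le> \<epsilon> / 2"
      using \<open>2 * ln q / \<epsilon> < g\<close> \<open>0 < real g\<close> \<epsilon> by (simp add: field_simps)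
    ultimately show ?thesis using that by simp
  qed
  define k2 where "k2 = 2 * int (Suc K) + 4"
  define D where "D = (4 * Suc K + 6) * (d + 1) ^ Suc K"
  define C' where "C' = ln q + C * D"
  have C': "ln q \<le> C'" "C * D \<le> C'" unfolding C'_def using lq C by simp_all
  have "0 \<le> 1 / card V * ln (rc_partition (V, E) q w) - ln (Phi_max d q w) \<and>
    1 / card V * ln (rc_partition (V, E) q w) - ln (Phi_max d q w) \<le>
      \<epsilon> + C' * (num_short_cycles (V, E) (int g) / card V) + C' * (num_short_cycles (V, E) k2 / card V)"
    if R: "regular_graph d (V, E)" for V :: "'v set" and E
  proof -
    have Gr: "fin_graph (V, E)" using R by (simp add: regular_graph_def)
    define n where "n = real (card V)"
    have n: "0 < n" unfolding n_def using Gr by (simp add: fin_graph_def card_gt_0_iff)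
    define Z2 Z L1 L2 where "Z2 = two_spin_Z V E (q - 1) w" and "Z = rc_partition (V, E) q w"
      and "L1 = real (num_short_cycles (V, E) (int g))" and "L2 = real (num_short_cycles (V, E) k2)"
    have L: "0 \<le> L1" "0 \<le> L2" unfolding L1_def L2_def by simp_all
    have "Phi_max d q w ^ card V \<le> Z2" unfolding Z2_def by (rule two_spin_lower[OF R])
    moreover have Pp: "0 < Phi_max d q w ^ card V" using Phi_max_pos by simp
    ultimately have Z2: "0 < Z2" by linarith
    have "Z2 \<le> Z" unfolding Z2_def Z_def by (rule two_spin_le_rc_partition[OF Gr q w])
    then have Zp: "0 < Z" using Z2 by simp
    have "ln (Phi_max d q w ^ card V) \<le> ln Z"
      using \<open>Phi_max d q w ^ card V \<le> Z2\<close> \<open>Z2 \<le> Z\<close> Pp Zp by simp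
    then have low: "n * ln (Phi_max d q w) \<le> ln Z" using Phi_max_pos by (simp add: ln_realpow n_def)
    have "Z \<le> q powr (L1 + n / g) * Z2"
      unfolding Z_def Z2_def L1_def n_def by (rule rc_partition_le_two_spin[OF Gr q w g(1)])
    then have "ln Z \<le> ln (q powr (L1 + n / g) * Z2)" using Zp Z2 q by simp
    also have "\<dots> = (L1 + n / g) * ln q + ln Z2" using Z2 q by (simp add: ln_mult ln_powr)
    also have "ln Z2 \<le> n * (ln (Phi_max d q w) + \<epsilon> / 2) + C * num_bad V E (Suc K)"
      unfolding Z2_def n_def by (rule up[OF R])
    also have "C * num_bad V E (Suc K) \<le> C * (L2 * D)"
    proof -
      have "real (num_bad V E (Suc K)) \<le> L2 * D"
        using of_nat_mono[OF card_not_tree_ball[OF R, of "Suc K"], where 'a = real]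
        unfolding L2_def D_def k2_def by (simp only: of_nat_mult)
      then show ?thesis using C by (rule mult_left_mono)
    qed
    finally have "ln Z \<le> (L1 + n / g) * ln q + (n * (ln (Phi_max d q w) + \<epsilon> / 2) + C * (L2 * D))" by simp
    also have "\<dots> = n * ln (Phi_max d q w) + n * (\<epsilon> / 2) + n * (ln q / g) + ln q * L1 + (C * D) * L2"
      by (simp add: algebra_simps)
    also have "\<dots> \<le> n * ln (Phi_max d q w) + n * (\<epsilon> / 2) + n * (\<epsilon> / 2) + C' * L1 + C' * L2"
      using g(2) n L C' by (intro add_mono mult_left_mono mult_right_mono) auto
    finally have "ln Z \<le> n * (ln (Phi_max d q w) + \<epsilon>) + C' * L1 + C' * L2" by (simp add: algebra_simps)
    then have "ln Z / n \<le> (n * (ln (Phi_max d q w) + \<epsilon>) + C' * L1 + C' * L2) / n"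
      using n by (intro divide_right_mono) auto
    also have "\<dots> = ln (Phi_max d q w) + \<epsilon> + C' * (L1 / n) + C' * (L2 / n)"
      using n by (simp add: add_divide_distrib)
    finally have upper: "ln Z / n \<le> ln (Phi_max d q w) + \<epsilon> + C' * (L1 / n) + C' * (L2 / n)" .
    have lower: "ln (Phi_max d q w) \<le> ln Z / n" using low n by (simp add: pos_le_divide_eq mult.commute)
    show ?thesis using upper lower unfolding Z_def n_def L1_def L2_def by simp
  qed
  then show ?thesis by (intro exI[of _ "int g"] exI[of _ k2] exI[of _ C']) auto
qed

end

section \<open>Random regular graphs\<close>

definition reg_edges :: "nat \<Rightarrow> nat \<Rightarrow> nat set set set" where
  "reg_edges d n = {E. regular_graph d ({..<n}, E)}"

lemma finite_reg_edges: "finite (reg_edges d n)"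
  by (rule finite_subset[of _ "Pow (Pow {..<n})"])
    (auto simp: reg_edges_def regular_graph_def fin_graph_def)

lemma card_edges_at_insert:
  assumes "finite X" "f \<notin> X"
  shows "card (edges_at (insert f X) z) = card (edges_at X z) + (if z \<in> f then 1 else 0)"
proof -
  have "edges_at (insert f X) z = (if z \<in> f then insert f (edges_at X z) else edges_at X z)" by auto
  then show ?thesis using assms by simp
qed

definition switch_edges :: "'v \<Rightarrow> 'v \<Rightarrow> 'v \<Rightarrow> 'v \<Rightarrow> 'v set set \<Rightarrow> 'v set set" where
  "switch_edges u v x y E = insert {u, x} (insert {v, y} (E - {{u, v}, {x, y}}))"

text \<open>The second claim recovers \<open>E\<close> from the switched graph and
  \<open>u, v, x, y\<close>; it makes the double counting in \<open>num_above_switch\<close>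
  injective.\<close>

lemma regular_switch_edges:
  assumes R: "regular_graph d (V, E)" and uv: "{u, v} \<in> E" and xy: "{x, y} \<in> E"
    and ne: "{x, y} \<noteq> {u, v}" "x \<noteq> u" "y \<noteq> v" and new: "{u, x} \<notin> E" "{v, y} \<notin> E"
  shows "regular_graph d (V, switch_edges u v x y E)"
    "E = insert {u, v} (insert {x, y} (switch_edges u v x y E - {{u, x}, {v, y}}))"
proof -
  have G: "fin_graph (V, E)" using R by (simp add: regular_graph_def)
  have fE: "finite E" by (rule fin_graph_finite_edges[OF G])
  have V: "u \<in> V" "v \<in> V" "x \<in> V" "y \<in> V" and n1: "u \<noteq> v" "x \<noteq> y"
    using fin_graph_edge[OF G uv] fin_graph_edge[OF G xy] by auto
  have n2: "x \<noteq> v" "y \<noteq> u" using new uv by (auto simp: insert_commute)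
  let ?X = "E - {{u, v}, {x, y}}"
  have E: "E = insert {u, v} (insert {x, y} ?X)" using uv xy by auto
  have dis: "{u, v} \<notin> insert {x, y} ?X" "{x, y} \<notin> ?X" "{u, x} \<notin> insert {v, y} ?X" "{v, y} \<notin> ?X"
    using ne new n1 n2 by (auto simp: doubleton_eq_iff)
  have fX: "finite ?X" using fE by simp
  have "card (edges_at E z) = card (edges_at (switch_edges u v x y E) z)" for z
  proof -
    have "card (edges_at E z) = card (edges_at ?X z) + (if z \<in> {x, y} then 1 else 0) + (if z \<in> {u, v} then 1 else 0)"
      by (subst E, subst card_edges_at_insert, use fX dis in simp, use dis in simp,
          subst card_edges_at_insert) (use fX dis in auto)
    moreover have "card (edges_at (switch_edges u v x y E) z)
      = card (edges_at ?X z) + (if z \<in> {v, y} then 1 else 0) + (if z \<in> {u, x} then 1 else 0)"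
      unfolding switch_edges_def
      by (subst card_edges_at_insert, use fX dis in simp, use dis in simp,
          subst card_edges_at_insert) (use fX dis in auto)
    ultimately show ?thesis using n1 n2 ne by auto
  qed
  moreover have "fin_graph (V, switch_edges u v x y E)"
    using G V ne n1 n2 unfolding fin_graph_def switch_edges_def by auto
  ultimately show "regular_graph d (V, switch_edges u v x y E)"
    using R by (simp add: regular_graph_def)
  show "E = insert {u, v} (insert {x, y} (switch_edges u v x y E - {{u, x}, {v, y}}))"
    using new uv xy unfolding switch_edges_def by blast
qed

definition num_above :: "nat \<Rightarrow> nat \<Rightarrow> nat set set \<Rightarrow> nat" where
  "num_above d n F = card {E \<in> reg_edges d n. F \<subseteq> E}"

lemma card_adjacent_pairs:
  assumes R: "regular_graph d (V, E)" and S: "S \<subseteq> V"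
  shows "card {(x, y). x \<in> S \<and> {x, y} \<in> E} = card S * d" "finite {(x, y). x \<in> S \<and> {x, y} \<in> E}"
proof -
  have G: "fin_graph (V, E)" using R by (simp add: regular_graph_def)
  have fS: "finite S" using S G finite_subset by (auto simp: fin_graph_def)
  have eq: "{(x, y). x \<in> S \<and> {x, y} \<in> E} = Sigma S (\<lambda>x. {y. {x, y} \<in> E})" by auto
  show "finite {(x, y). x \<in> S \<and> {x, y} \<in> E}"
    unfolding eq using fS finite_nbrs[OF G] by (intro finite_SigmaI) auto
  have "card (Sigma S (\<lambda>x. {y. {x, y} \<in> E})) = (\<Sum>x\<in>S. card {y. {x, y} \<in> E})"
    by (rule card_SigmaI) (use fS finite_nbrs[OF G] in auto)
  also have "\<dots> = (\<Sum>x\<in>S. d)" using S regular_card_nbrs[OF R] by (intro sum.cong) auto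
  finally show "card {(x, y). x \<in> S \<and> {x, y} \<in> E} = card S * d" unfolding eq by simp
qed

text \<open>Among the \<open>n * d\<close> oriented edges \<open>(x, y)\<close>, those with
  \<open>x\<close> equal or adjacent to \<open>u\<close> number at most \<open>d * (d + 1)\<close>,
  likewise those with \<open>y\<close> equal or adjacent to \<open>v\<close>, and each edge of
  \<open>F\<close> excludes its two orientations.\<close>

lemma card_switchable:
  assumes R: "regular_graph d ({..<n}, E)" and FE: "F \<subseteq> E" and uv: "u < n" "v < n"
  shows "n * d \<le> card {(x, y). {x, y} \<in> E \<and> {x, y} \<notin> F \<and> x \<noteq> u \<and> y \<noteq> v \<and> {u, x} \<notin> E \<and> {v, y} \<notin> E}
    + 2 * (d * (d + 1)) + 2 * card F"
proof -
  have G: "fin_graph ({..<n}, E)" using R by (simp add: regular_graph_def)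
  have fF: "finite F" using FE fin_graph_finite_edges[OF G] finite_subset by auto
  let ?P = "{(x, y). {x, y} \<in> E \<and> {x, y} \<notin> F \<and> x \<noteq> u \<and> y \<noteq> v \<and> {u, x} \<notin> E \<and> {v, y} \<notin> E}"
  let ?N = "\<lambda>u. insert u {x. {u, x} \<in> E}"
  let ?Q = "\<lambda>S. {(x, y). x \<in> S \<and> {x, y} \<in> E}"
  have N: "?N z \<subseteq> {..<n}" "card (?N z) \<le> d + 1" if "z < n" for z
  proof -
    show "?N z \<subseteq> {..<n}" using that fin_graph_edge[OF G] by auto
    have "card {x. {z, x} \<in> E} = d" using regular_card_nbrs[OF R, of z] that by simp
    then show "card (?N z) \<le> d + 1" using card_insert_le_m1[of "d + 1" "{x. {z, x} \<in> E}" z] by simp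
  qed
  have Q: "card (?Q (?N z)) \<le> d * (d + 1)" "finite (?Q (?N z))" if "z < n" for z
  proof -
    have "card (?N z) * d \<le> (d + 1) * d" using N(2)[OF that] by (rule mult_right_mono) simp
    then show "card (?Q (?N z)) \<le> d * (d + 1)"
      unfolding card_adjacent_pairs(1)[OF R N(1)[OF that]] by (simp only: mult.commute)
    show "finite (?Q (?N z))" by (rule card_adjacent_pairs(2)[OF R N(1)[OF that]])
  qed
  have swap: "card ((\<lambda>(x, y). (y, x)) ` ?Q (?N v)) \<le> d * (d + 1)"
    using card_image_le[OF Q(2)[OF uv(2)]] Q(1)[OF uv(2)] by (rule order.trans)
  have fP: "finite ?P"
    by (rule finite_subset[of _ "?Q {..<n}"])
      (use card_adjacent_pairs(2)[OF R, of "{..<n}"] fin_graph_edge[OF G] in auto)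
  have pr: "finite {(x, y). {x, y} = f} \<and> card {(x, y). {x, y} = f} \<le> 2" if fF: "f \<in> F" for f
  proof -
    obtain p r where f: "f = {p, r}" using fin_graph_edgeE[OF G, of f] fF FE by blast
    then have sub: "{(x, y). {x, y} = f} \<subseteq> {(p, r), (r, p)}" by (auto simp: doubleton_eq_iff)
    then have "finite {(x, y). {x, y} = f}" by (rule finite_subset) simp
    moreover have "card {(x, y). {x, y} = f} \<le> card {(p, r), (r, p)}"
      by (rule card_mono[OF _ sub]) simp
    moreover have "card {(p, r), (r, p)} \<le> 2"
      using card_insert_le_m1[of 2 "{(r, p)}" "(p, r)"] by simp
    ultimately show ?thesis by linarith
  qed
  have "card (\<Union>f\<in>F. {(x, y). {x, y} = f}) \<le> (\<Sum>f\<in>F. card {(x, y). {x, y} = f})"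
    by (rule card_UN_le[OF fF])
  also have "\<dots> \<le> (\<Sum>f\<in>F. 2)" using pr by (intro sum_mono) auto
  finally have B3: "card (\<Union>f\<in>F. {(x, y). {x, y} = f}) \<le> 2 * card F" by simp
  have "?Q {..<n} \<subseteq> ?P \<union> (?Q (?N u) \<union> ((\<lambda>(x, y). (y, x)) ` ?Q (?N v) \<union> (\<Union>f\<in>F. {(x, y). {x, y} = f})))"
    by (auto simp: image_iff insert_commute)
  then have "card (?Q {..<n}) \<le> card (?P \<union> (?Q (?N u) \<union> ((\<lambda>(x, y). (y, x)) ` ?Q (?N v) \<union> (\<Union>f\<in>F. {(x, y). {x, y} = f}))))"
    using fP Q(2)[OF uv(1)] Q(2)[OF uv(2)] fF pr by (intro card_mono) auto
  also have "\<dots> \<le> card ?P + (card (?Q (?N u)) + (card ((\<lambda>(x, y). (y, x)) ` ?Q (?N v)) + card (\<Union>f\<in>F. {(x, y). {x, y} = f})))"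
    by (meson add_left_mono card_Un_le order.trans)
  also have "\<dots> \<le> card ?P + (d * (d + 1) + (d * (d + 1) + 2 * card F))"
    using Q(1)[OF uv(1)] swap B3 by (intro add_mono order.refl)
  finally show ?thesis using card_adjacent_pairs(1)[OF R, of "{..<n}"] by simp
qed

text \<open>Double counting of switchings that remove \<open>e\<close> but no other edge of
  \<open>F\<close>. The resulting graph contains \<open>F - {e}\<close>, and in it \<open>x\<close>
  is a neighbour of \<open>u\<close> and \<open>y\<close> one of \<open>v\<close>: at most
  \<open>d * d\<close> choices lead back.\<close>

lemma num_above_switch:
  assumes e: "e \<in> F"
  shows "num_above d n F * n * d \<le> num_above d n F * (2 * (d * (d + 1)) + 2 * card F) + d * d * num_above d n (F - {e})"
proof (cases "num_above d n F = 0")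
  case False
  then obtain E0 where E0: "E0 \<in> reg_edges d n" "F \<subseteq> E0"
    unfolding num_above_def by (metis (no_types, lifting) card.empty empty_Collect_eq)
  obtain u v where uv: "e = {u, v}" "u \<noteq> v" "u < n" "v < n"
    using fin_graph_edgeE[of "{..<n}" E0 e] E0 e by (auto simp: reg_edges_def regular_graph_def)
  let ?A = "{E \<in> reg_edges d n. F \<subseteq> E}" and ?B = "{E \<in> reg_edges d n. F - {e} \<subseteq> E}"
  let ?P = "\<lambda>E. {(x, y). {x, y} \<in> E \<and> {x, y} \<notin> F \<and> x \<noteq> u \<and> y \<noteq> v \<and> {u, x} \<notin> E \<and> {v, y} \<notin> E}"
  let ?R = "\<lambda>E. {x. {u, x} \<in> E} \<times> {y. {v, y} \<in> E}"
  let ?f = "\<lambda>(E, (x, y)). (switch_edges u v x y E, (x, y))"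
  have fin: "finite ?A" "finite ?B" using finite_reg_edges by auto
  have fR: "finite (?R E) \<and> card (?R E) = d * d" if "E \<in> ?B" for E
  proof -
    have R: "regular_graph d ({..<n}, E)" using that by (simp add: reg_edges_def)
    have G: "fin_graph ({..<n}, E)" using R by (simp add: regular_graph_def)
    show ?thesis using regular_card_nbrs[OF R] uv finite_nbrs[OF G] by (simp add: card_cartesian_product)
  qed
  have fP: "finite (?P E)" if "E \<in> ?A" for E
  proof (rule finite_subset)
    have R: "regular_graph d ({..<n}, E)" using that by (simp add: reg_edges_def)
    have G: "fin_graph ({..<n}, E)" using R by (simp add: regular_graph_def)
    show "finite {(x, y). x \<in> {..<n} \<and> {x, y} \<in> E}" by (rule card_adjacent_pairs(2)[OF R]) simp
    show "?P E \<subseteq> {(x, y). x \<in> {..<n} \<and> {x, y} \<in> E}" using fin_graph_edge[OF G] by auto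
  qed
  have sw: "regular_graph d ({..<n}, switch_edges u v x y E) \<and>
      E = insert {u, v} (insert {x, y} (switch_edges u v x y E - {{u, x}, {v, y}}))"
    if "E \<in> ?A" "(x, y) \<in> ?P E" for E x y
  proof -
    have "regular_graph d ({..<n}, E)" "{u, v} \<in> E" "{x, y} \<in> E" "{x, y} \<noteq> {u, v}" "x \<noteq> u" "y \<noteq> v"
      "{u, x} \<notin> E" "{v, y} \<notin> E"
      using that e uv by (auto simp: reg_edges_def)
    from regular_switch_edges[OF this] show ?thesis by blast
  qed
  have "inj_on ?f (Sigma ?A ?P)"
  proof (rule inj_onI)
    fix a b assume ab: "a \<in> Sigma ?A ?P" "b \<in> Sigma ?A ?P" "?f a = ?f b"
    obtain E x y where a: "a = (E, (x, y))" by (cases a) auto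
    obtain E' x' y' where b: "b = (E', (x', y'))" by (cases b) auto
    have eq: "x = x'" "y = y'" "switch_edges u v x y E = switch_edges u v x y E'"
      using ab(3) unfolding a b by auto
    have 1: "E = insert {u, v} (insert {x, y} (switch_edges u v x y E - {{u, x}, {v, y}}))"
      using sw[of E x y] ab(1) unfolding a by blast
    have 2: "E' = insert {u, v} (insert {x, y} (switch_edges u v x y E' - {{u, x}, {v, y}}))"
      using sw[of E' x y] ab(2) unfolding b eq(1,2) by blast
    have "E = E'" by (subst 1, subst 2) (simp only: eq(3))
    then show "a = b" unfolding a b using eq by simp
  qed
  moreover have "?f ` Sigma ?A ?P \<subseteq> Sigma ?B ?R"
  proof
    fix b assume "b \<in> ?f ` Sigma ?A ?P"
    then obtain E x y where E: "E \<in> ?A" "(x, y) \<in> ?P E" and b: "b = (switch_edges u v x y E, (x, y))" by auto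
    have "F - {e} \<subseteq> switch_edges u v x y E" using E uv(1) unfolding switch_edges_def by blast
    then show "b \<in> Sigma ?B ?R" using sw[OF E] unfolding b by (auto simp: reg_edges_def switch_edges_def)
  qed
  moreover have "finite (Sigma ?B ?R)"
  proof (rule finite_SigmaI[OF fin(2)])
    show "finite (?R E)" if "E \<in> ?B" for E using fR[OF that] by blast
  qed
  ultimately have "card (Sigma ?A ?P) \<le> card (Sigma ?B ?R)" by (rule card_inj_on_le)
  also have "card (Sigma ?B ?R) = (\<Sum>E\<in>?B. card (?R E))" by (rule card_SigmaI[OF fin(2)]) (use fR in blast)
  also have "\<dots> = (\<Sum>E\<in>?B. d * d)" by (rule sum.cong[OF refl]) (use fR in blast)
  also have "card (Sigma ?A ?P) = (\<Sum>E\<in>?A. card (?P E))" by (rule card_SigmaI[OF fin(1)]) (use fP in blast)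
  finally have le: "(\<Sum>E\<in>?A. card (?P E)) \<le> d * d * num_above d n (F - {e})" by (simp add: num_above_def mult.commute)
  have "num_above d n F * n * d = (\<Sum>E\<in>?A. n * d)" by (simp add: num_above_def mult.assoc)
  also have "\<dots> \<le> (\<Sum>E\<in>?A. card (?P E) + (2 * (d * (d + 1)) + 2 * card F))"
    using card_switchable[of d n _ F u v] uv by (intro sum_mono) (auto simp: reg_edges_def add.assoc)
  also have "\<dots> = (\<Sum>E\<in>?A. card (?P E)) + num_above d n F * (2 * (d * (d + 1)) + 2 * card F)"
    by (simp only: sum.distrib sum_constant num_above_def of_nat_id distrib_left)
  finally show ?thesis using le by linarith
qed simp

text \<open>For \<open>n\<close> this large the forbidden switchings are at most half of
  \<open>n * d\<close>, so each edge of \<open>F\<close> costs a factor \<open>2 * d / n\<close>,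
  twice the ratio \<open>d * d / (n * d)\<close> of the switching count.\<close>

lemma num_above_bound:
  assumes d: "0 < d" and F: "finite F" "card F \<le> m" and n: "4 * (d + 1) + 4 * m \<le> n"
  shows "num_above d n F \<le> (2 * d / n) ^ card F * card (reg_edges d n)"
  using F
proof (induction F rule: finite_induct)
  case empty
  then show ?case by (simp add: num_above_def)
next
  case (insert e F)
  let ?F = "insert e F"
  have c: "card ?F = Suc (card F)" "card ?F \<le> m" using insert by auto
  let ?N = "real (num_above d n ?F)"
  have n0: "0 < n" using n by simp
  have "2 * (d * (d + 1)) + 2 * card ?F \<le> d * (2 * (d + 1) + 2 * m)"
  proof -
    have "2 * card ?F \<le> 2 * m * d" using c(2) d by (cases d) auto
    then show ?thesis by (simp add: algebra_simps)
  qed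
  also have "2 * \<dots> \<le> d * n" using n mult_left_mono[of "4 * (d + 1) + 4 * m" n d] by (simp add: algebra_simps)
  finally have half: "2 * (2 * (d * (d + 1)) + 2 * card ?F) \<le> d * n" by simp
  have sw: "num_above d n ?F * n * d \<le> num_above d n ?F * (2 * (d * (d + 1)) + 2 * card ?F) + d * d * num_above d n F"
    using num_above_switch[of e ?F d n] insert.hyps by simp
  have "num_above d n ?F * (2 * (2 * (d * (d + 1)) + 2 * card ?F)) \<le> num_above d n ?F * (d * n)"
    by (rule mult_left_mono[OF half]) simp
  then have "2 * (num_above d n ?F * (2 * (d * (d + 1)) + 2 * card ?F)) \<le> num_above d n ?F * n * d"
    by (simp only: mult.assoc mult.commute mult.left_commute)
  with sw have "num_above d n ?F * n * d \<le> 2 * (d * d * num_above d n F)" by linarith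
  then have "d * (num_above d n ?F * n) \<le> d * (2 * d * num_above d n F)" by (simp add: algebra_simps)
  then have "num_above d n ?F * n \<le> 2 * d * num_above d n F" using d by simp
  then have "?N * n \<le> 2 * d * real (num_above d n F)" by (metis of_nat_le_iff of_nat_mult of_nat_numeral)
  then have "?N \<le> 2 * d / n * real (num_above d n F)" using n0 by (simp add: field_simps)
  also have "\<dots> \<le> 2 * d / n * ((2 * d / n) ^ card F * card (reg_edges d n))"
    using insert by (intro mult_left_mono) auto
  finally show ?case unfolding c(1) by (simp add: mult.assoc)
qed

section \<open>Counting pairs of disjoint short cycles\<close>

definition cycle_edges :: "'v list \<Rightarrow> 'v set set" where
  "cycle_edges xs = (\<lambda>i. {xs ! i, xs ! ((i + 1) mod length xs)}) ` {..<length xs}"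

lemma is_cycle_iff:
  "is_cycle G C \<longleftrightarrow> C \<subseteq> edges G \<and> (\<exists>xs. 3 \<le> length xs \<and> distinct xs \<and> C = cycle_edges xs)"
proof -
  have "cycle_edges xs = {{xs ! i, xs ! ((i + 1) mod length xs)} | i. i < length xs}" for xs :: "'a list"
    unfolding cycle_edges_def by auto
  then show ?thesis unfolding is_cycle_def by simp
qed

text \<open>If two different positions gave the same edge, going two steps around would return to
  the start, so the length would divide 2.\<close>

lemma card_cycle_edges:
  assumes "3 \<le> length xs" "distinct xs" shows "card (cycle_edges xs) = length xs"
proof -
  have "inj_on (\<lambda>i. {xs ! i, xs ! ((i + 1) mod length xs)}) {..<length xs}"
  proof (rule inj_onI)
    fix i j assume ij: "i \<in> {..<length xs}" "j \<in> {..<length xs}"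
      "{xs ! i, xs ! ((i + 1) mod length xs)} = {xs ! j, xs ! ((j + 1) mod length xs)}"
    let ?k = "length xs"
    have k: "0 < ?k" using assms(1) by linarith
    then have lt: "(i + 1) mod ?k < ?k" "(j + 1) mod ?k < ?k" by simp_all
    show "i = j"
    proof (rule ccontr)
      assume "i \<noteq> j"
      then have "i = (j + 1) mod ?k" "j = (i + 1) mod ?k"
        using ij lt assms(2) by (auto simp: doubleton_eq_iff nth_eq_iff_index_eq)
      then have "i = ((i + 1) mod ?k + 1) mod ?k" by simp
      also have "\<dots> = (i + 2) mod ?k" by (simp add: mod_simps)
      finally have "i mod ?k = (i + 2) mod ?k" using ij(1) by simp
      then have "?k dvd 2" using mod_eq_dvd_iff_nat[of i "i + 2" ?k] by simp
      then show False using assms(1) dvd_imp_le[of ?k 2] by simp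
    qed
  qed
  then show ?thesis unfolding cycle_edges_def by (simp add: card_image)
qed

lemma Union_cycle_edges:
  assumes "3 \<le> length xs" shows "\<Union>(cycle_edges xs) = set xs"
proof -
  have "0 < length xs" using assms by linarith
  then have "xs ! ((i + 1) mod length xs) \<in> set xs" for i by simp
  then show ?thesis unfolding cycle_edges_def by (auto simp: in_set_conv_nth)
qed

lemma cycle_in_ball:
  assumes C: "is_cycle (V, E) C" "z \<in> \<Union>C" "card C \<le> m" shows "\<Union>C \<subseteq> ball_in E z m"
proof -
  obtain xs where xs: "C \<subseteq> E" "3 \<le> length xs" "distinct xs" "C = cycle_edges xs"
    using C(1) by (auto simp: is_cycle_iff)
  let ?k = "length xs"
  have k: "0 < ?k" "?k \<le> m" using xs(2) card_cycle_edges[OF xs(2,3)] C(3) xs(4) by auto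
  obtain a where a: "a < ?k" "z = xs ! a"
    using C(2) unfolding xs(4) Union_cycle_edges[OF xs(2)] by (auto simp: in_set_conv_nth)
  have step: "xs ! ((a + j) mod ?k) \<in> ball_in E z j" for j
  proof (induction j)
    case 0 then show ?case using a by simp
  next
    case (Suc j)
    have "{xs ! ((a + j) mod ?k), xs ! (((a + j) mod ?k + 1) mod ?k)} \<in> C"
      unfolding xs(4) cycle_edges_def using k by (intro imageI) simp
    moreover have "((a + j) mod ?k + 1) mod ?k = (a + Suc j) mod ?k" by (simp add: mod_simps)
    ultimately have "{xs ! ((a + j) mod ?k), xs ! ((a + Suc j) mod ?k)} \<in> E" using xs(1) by auto
    then show ?case using Suc by auto
  qed
  have "xs ! i \<in> ball_in E z m" if i: "i < ?k" for i
  proof -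
    \<comment> \<open>The number of forward steps around the cycle from position \<open>a\<close> to
      position \<open>i\<close>.\<close>
    define j where "j = (i + (?k - a)) mod ?k"
    have "(a + j) mod ?k = (a + (i + (?k - a))) mod ?k" unfolding j_def by (simp add: mod_simps)
    also have "a + (i + (?k - a)) = i + ?k" using a by simp
    finally have "(a + j) mod ?k = i" using i by simp
    moreover have "j \<le> m" unfolding j_def using k by (meson less_imp_le mod_less_divisor order.trans)
    ultimately show ?thesis using step[of j] ball_in_mono[of j m E z] by auto
  qed
  then show ?thesis unfolding xs(4) Union_cycle_edges[OF xs(2)] by (auto simp: in_set_conv_nth)
qed

definition short_cycles :: "nat \<Rightarrow> 'v set \<times> 'v set set \<Rightarrow> 'v set set set" where
  "short_cycles m G = {C. is_cycle G C \<and> card C \<le> m}"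

text \<open>A cycle of length at most \<open>m\<close> has at most \<open>2 * m\<close> vertices. A
  second one through a given vertex is a set of subsets of a ball with at most
  \<open>(d + 1) ^ m\<close> elements, whence the double exponential.\<close>

definition meet_bound :: "nat \<Rightarrow> nat \<Rightarrow> nat" where
  "meet_bound d m = 2 * m * 2 ^ (2 ^ ((d + 1) ^ m))"

lemma card_meeting_cycles:
  assumes R: "regular_graph d (V, E)" and C: "C \<in> short_cycles m (V, E)"
  shows "card {D \<in> short_cycles m (V, E). \<Union>C \<inter> \<Union>D \<noteq> {}} \<le> meet_bound d m"
proof -
  have G: "fin_graph (V, E)" using R by (simp add: regular_graph_def)
  have CV: "\<Union>C \<subseteq> V" "card (\<Union>C) \<le> 2 * m"
    using card_Union_cycle[OF G, of C] C by (auto simp: short_cycles_def)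
  have fC: "finite (\<Union>C)" using CV(1) G finite_subset by (auto simp: fin_graph_def)
  have at: "finite {D \<in> short_cycles m (V, E). z \<in> \<Union>D} \<and>
      card {D \<in> short_cycles m (V, E). z \<in> \<Union>D} \<le> 2 ^ (2 ^ ((d + 1) ^ m))" if z: "z \<in> V" for z
  proof -
    let ?B = "ball_in E z m"
    have fB: "finite ?B" by (rule finite_ball_in[OF G z])
    have sub: "{D \<in> short_cycles m (V, E). z \<in> \<Union>D} \<subseteq> Pow (Pow ?B)"
      using cycle_in_ball[of V E _ z m] by (fastforce simp: short_cycles_def)
    then have "card {D \<in> short_cycles m (V, E). z \<in> \<Union>D} \<le> card (Pow (Pow ?B))"
      using fB by (intro card_mono) auto
    also have "\<dots> = 2 ^ (2 ^ card ?B)" using fB by (simp add: card_Pow)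
    also have "\<dots> \<le> 2 ^ (2 ^ ((d + 1) ^ m))"
      using card_ball_in[OF R z, of m] by (intro power_increasing) auto
    finally show ?thesis using sub fB by (auto intro: finite_subset)
  qed
  have eq: "{D \<in> short_cycles m (V, E). \<Union>C \<inter> \<Union>D \<noteq> {}} = (\<Union>z\<in>\<Union>C. {D \<in> short_cycles m (V, E). z \<in> \<Union>D})"
    by auto
  have "card (\<Union>z\<in>\<Union>C. {D \<in> short_cycles m (V, E). z \<in> \<Union>D}) \<le> (\<Sum>z\<in>\<Union>C. card {D \<in> short_cycles m (V, E). z \<in> \<Union>D})"
    by (rule card_UN_le[OF fC])
  also have "\<dots> \<le> (\<Sum>z\<in>\<Union>C. 2 ^ (2 ^ ((d + 1) ^ m)))" by (rule sum_mono) (use at CV(1) in blast)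
  also have "\<dots> \<le> meet_bound d m" using CV(2) by (simp add: meet_bound_def)
  finally show ?thesis unfolding eq .
qed

definition list_pairs :: "nat \<Rightarrow> nat \<Rightarrow> (nat list \<times> nat list) set" where
  "list_pairs m n = {(xs, ys). set xs \<subseteq> {..<n} \<and> set ys \<subseteq> {..<n} \<and> 3 \<le> length xs \<and> length xs \<le> m
     \<and> 3 \<le> length ys \<and> length ys \<le> m \<and> distinct (xs @ ys)}"

abbreviation "cycle_pairs m n E \<equiv> {(xs, ys). (xs, ys) \<in> list_pairs m n \<and> cycle_edges xs \<union> cycle_edges ys \<subseteq> E}"

text \<open>Of all ordered pairs of short cycles, at most \<open>meet_bound d m\<close> per first
  cycle meet; the disjoint ones inject into \<open>cycle_pairs\<close> by choosing one vertex list
  for each cycle.\<close>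

lemma short_cycle_pairs:
  assumes R: "regular_graph d ({..<n}, E)"
  shows "card (short_cycles m ({..<n}, E)) * card (short_cycles m ({..<n}, E))
    \<le> card (cycle_pairs m n E)
      + card (short_cycles m ({..<n}, E)) * meet_bound d m"
proof -
  let ?S = "short_cycles m ({..<n}, E)"
  let ?T = "cycle_pairs m n E"
  have G: "fin_graph ({..<n}, E)" using R by (simp add: regular_graph_def)
  have fS: "finite ?S" unfolding short_cycles_def by (rule finite_short_cycles[OF G])
  define l where "l C = (SOME xs. 3 \<le> length xs \<and> distinct xs \<and> C = cycle_edges xs)" for C :: "nat set set"
  have l: "3 \<le> length (l C) \<and> distinct (l C) \<and> C = cycle_edges (l C)" if "C \<in> ?S" for C
    unfolding l_def by (rule someI_ex) (use that in \<open>auto simp: short_cycles_def is_cycle_iff\<close>)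
  let ?D = "Sigma ?S (\<lambda>C. {D \<in> ?S. \<Union>C \<inter> \<Union>D = {}})"
  have fT: "finite ?T"
  proof (rule finite_subset)
    let ?L = "{xs. set xs \<subseteq> {..<n} \<and> length xs \<le> m}"
    show "?T \<subseteq> ?L \<times> ?L" by (auto simp: list_pairs_def)
    show "finite (?L \<times> ?L)" by (intro finite_cartesian_product finite_lists_length_le) auto
  qed
  have "card ?D \<le> card ?T"
  proof (rule card_inj_on_le[of "\<lambda>(C, D). (l C, l D)", OF _ _ fT])
    show "inj_on (\<lambda>(C, D). (l C, l D)) ?D"
      by (rule inj_on_inverseI[of _ "\<lambda>(xs, ys). (cycle_edges xs, cycle_edges ys)"]) (use l in auto)
    show "(\<lambda>(C, D). (l C, l D)) ` ?D \<subseteq> ?T"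
    proof clarify
      fix C D assume CD: "C \<in> ?S" "D \<in> ?S" "\<Union>C \<inter> \<Union>D = {}"
      have one: "set (l C) = \<Union>C \<and> set (l C) \<subseteq> {..<n} \<and> length (l C) \<le> m \<and> cycle_edges (l C) \<subseteq> E"
        if "C \<in> ?S" for C
      proof -
        have cy: "is_cycle ({..<n}, E) C" "card C \<le> m" using that by (auto simp: short_cycles_def)
        have "set (l C) = \<Union>C" using Union_cycle_edges[of "l C"] l[OF that] by metis
        moreover have "length (l C) = card C" using card_cycle_edges[of "l C"] l[OF that] by metis
        moreover have "cycle_edges (l C) = C" using l[OF that] by simp
        ultimately show ?thesis using cy card_Union_cycle(2)[OF G cy(1)] by (simp add: is_cycle_iff)
      qed
      show "(l C, l D) \<in> list_pairs m n \<and> cycle_edges (l C) \<union> cycle_edges (l D) \<subseteq> E"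
        using one[OF CD(1)] one[OF CD(2)] l[OF CD(1)] l[OF CD(2)] CD(3) unfolding list_pairs_def by auto
    qed
  qed
  have "card ?S * card ?S = (\<Sum>C\<in>?S. card ?S)" by simp
  also have "\<dots> \<le> (\<Sum>C\<in>?S. card {D \<in> ?S. \<Union>C \<inter> \<Union>D = {}} + meet_bound d m)"
  proof (rule sum_mono)
    fix C assume C: "C \<in> ?S"
    have "?S = {D \<in> ?S. \<Union>C \<inter> \<Union>D = {}} \<union> {D \<in> ?S. \<Union>C \<inter> \<Union>D \<noteq> {}}" by auto
    then have "card ?S \<le> card ({D \<in> ?S. \<Union>C \<inter> \<Union>D = {}} \<union> {D \<in> ?S. \<Union>C \<inter> \<Union>D \<noteq> {}})"
      by (rule arg_cong[THEN eq_refl])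
    also have "\<dots> \<le> card {D \<in> ?S. \<Union>C \<inter> \<Union>D = {}} + card {D \<in> ?S. \<Union>C \<inter> \<Union>D \<noteq> {}}"
      by (rule card_Un_le)
    finally show "card ?S \<le> card {D \<in> ?S. \<Union>C \<inter> \<Union>D = {}} + meet_bound d m"
      using card_meeting_cycles[OF R C] by simp
  qed
  also have "\<dots> = card ?D + card ?S * meet_bound d m"
    using fS by (simp add: sum.distrib card_SigmaI)
  finally show ?thesis using \<open>card ?D \<le> card ?T\<close> by simp
qed

text \<open>Disjoint lists have \<open>length xs + length ys\<close> edges in total, at most
  \<open>2 * m\<close>, each costing \<open>2 * d / n\<close>. There are \<open>n ^ k\<close> lists
  of length \<open>k\<close>, so the powers of \<open>n\<close> cancel and the mean is
  bounded.\<close>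

lemma sum_list_pairs_above:
  assumes d: "0 < d" and n: "4 * (d + 1) + 8 * m \<le> n"
  shows "(\<Sum>E\<in>reg_edges d n. real (card (cycle_pairs m n E)))
    \<le> (\<Sum>k\<le>m. real (2 * d) ^ k)\<^sup>2 * card (reg_edges d n)"
proof -
  let ?L = "{xs. set xs \<subseteq> {..<n} \<and> length xs \<le> m}"
  have fL: "finite ?L" by (rule finite_lists_length_le) simp
  have sub: "list_pairs m n \<subseteq> ?L \<times> ?L" by (auto simp: list_pairs_def)
  have fP: "finite (list_pairs m n)" by (rule finite_subset[OF sub]) (use fL in simp)
  let ?c = "\<lambda>p. cycle_edges (fst p) \<union> cycle_edges (snd p)"
  let ?r = "2 * real d / real n"
  have n0: "0 < n" using n by simp
  have "real (card (cycle_pairs m n E))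
    = (\<Sum>p\<in>{p \<in> list_pairs m n. ?c p \<subseteq> E}. 1)" for E
    by (simp, rule arg_cong[of _ _ card]) auto
  then have "(\<Sum>E\<in>reg_edges d n. real (card (cycle_pairs m n E)))
    = (\<Sum>E\<in>reg_edges d n. \<Sum>p\<in>{p \<in> list_pairs m n. ?c p \<subseteq> E}. 1)" by simp
  also have "\<dots> = (\<Sum>p\<in>list_pairs m n. \<Sum>E\<in>{E \<in> reg_edges d n. ?c p \<subseteq> E}. 1)"
    by (rule sum.swap_restrict[OF finite_reg_edges fP])
  also have "\<dots> = (\<Sum>p\<in>list_pairs m n. real (num_above d n (?c p)))" by (simp add: num_above_def)
  also have "\<dots> \<le> (\<Sum>p\<in>list_pairs m n. ?r ^ length (fst p) * ?r ^ length (snd p) * card (reg_edges d n))"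
  proof (rule sum_mono)
    fix p assume "p \<in> list_pairs m n"
    then obtain xs ys where p: "p = (xs, ys)" "3 \<le> length xs" "length xs \<le> m" "3 \<le> length ys" "length ys \<le> m"
      "distinct xs" "distinct ys" "set xs \<inter> set ys = {}" by (auto simp: list_pairs_def)
    have cx: "card (cycle_edges xs) = length xs" "card (cycle_edges ys) = length ys"
      using p card_cycle_edges by auto
    have fin: "finite (cycle_edges xs)" "finite (cycle_edges ys)" by (simp_all add: cycle_edges_def)
    have "cycle_edges xs \<inter> cycle_edges ys = {}"
    proof (rule ccontr)
      assume "cycle_edges xs \<inter> cycle_edges ys \<noteq> {}"
      then obtain e where e: "e \<in> cycle_edges xs" "e \<in> cycle_edges ys" by auto
      then have "e \<noteq> {}" "e \<subseteq> \<Union>(cycle_edges xs)" "e \<subseteq> \<Union>(cycle_edges ys)" by (auto simp: cycle_edges_def)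
      then show False using p(8) unfolding Union_cycle_edges[OF p(2)] Union_cycle_edges[OF p(4)] by auto
    qed
    then have c: "card (?c p) = length xs + length ys" using cx fin p(1) by (simp add: card_Un_disjoint)
    have "real (num_above d n (?c p)) \<le> (2 * d / n) ^ card (?c p) * card (reg_edges d n)"
      using num_above_bound[OF d, of "?c p" "2 * m" n] fin c p n by simp
    then show "real (num_above d n (?c p)) \<le> ?r ^ length (fst p) * ?r ^ length (snd p) * card (reg_edges d n)"
      unfolding c by (simp add: p(1) power_add)
  qed
  also have "\<dots> \<le> (\<Sum>p\<in>?L \<times> ?L. ?r ^ length (fst p) * ?r ^ length (snd p) * card (reg_edges d n))"
    by (rule sum_mono2) (use fL sub in auto)
  also have "\<dots> = (\<Sum>xs\<in>?L. ?r ^ length xs)\<^sup>2 * card (reg_edges d n)"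
  proof -
    have "(\<Sum>p\<in>?L \<times> ?L. ?r ^ length (fst p) * ?r ^ length (snd p)) = (\<Sum>xs\<in>?L. ?r ^ length xs) * (\<Sum>ys\<in>?L. ?r ^ length ys)"
      unfolding sum_product sum.cartesian_product by (intro sum.cong) auto
    then show ?thesis by (simp add: power2_eq_square sum_distrib_right[symmetric])
  qed
  also have "(\<Sum>xs\<in>?L. ?r ^ length xs) = (\<Sum>k\<le>m. real (2 * d) ^ k)"
  proof -
    have "(\<Sum>xs\<in>?L. ?r ^ length xs) = (\<Sum>k\<in>{..m}. \<Sum>xs\<in>{xs \<in> ?L. length xs = k}. ?r ^ length xs)"
      by (rule sum.group[symmetric]) (use fL in auto)
    also have "\<dots> = (\<Sum>k\<le>m. real (2 * d) ^ k)"
    proof (rule sum.cong[OF refl])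
      fix k assume k: "k \<in> {..m}"
      then have "{xs \<in> ?L. length xs = k} = {xs. set xs \<subseteq> {..<n} \<and> length xs = k}" by auto
      then have "card {xs \<in> ?L. length xs = k} = n ^ k" by (simp add: card_lists_length_eq)
      then have "(\<Sum>xs\<in>{xs \<in> ?L. length xs = k}. ?r ^ length xs) = n ^ k * ?r ^ k" by simp
      also have "\<dots> = (n * ?r) ^ k" by (simp only: of_nat_power power_mult_distrib)
      also have "n * ?r = real (2 * d)" using n0 by simp
      finally show "(\<Sum>xs\<in>{xs \<in> ?L. length xs = k}. ?r ^ length xs) = real (2 * d) ^ k" .
    qed
    finally show ?thesis .
  qed
  finally show ?thesis .
qed

text \<open>Markov's inequality for the number of pairs of disjoint short cycles.\<close>

lemma many_short_cycles_bound:
  fixes \<delta> :: real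
  assumes d: "0 < d" and \<delta>: "0 < \<delta>" and n: "4 * (d + 1) + 8 * m \<le> n" "2 * meet_bound d m \<le> \<delta> * n"
  shows "card {E \<in> reg_edges d n. \<delta> * n \<le> card (short_cycles m ({..<n}, E))}
    \<le> 2 * (\<Sum>k\<le>m. real (2 * d) ^ k)\<^sup>2 / \<delta>\<^sup>2 * card (reg_edges d n) / (real n)\<^sup>2"
proof -
  let ?B = "{E \<in> reg_edges d n. \<delta> * n \<le> card (short_cycles m ({..<n}, E))}"
  let ?p = "\<lambda>E. real (card (cycle_pairs m n E))"
  let ?S = "\<Sum>k\<le>m. real (2 * d) ^ k"
  have n0: "0 < real n" using n by simp
  have dn: "0 < \<delta> * n" using \<delta> n0 by simp
  have low: "(\<delta> * n)\<^sup>2 / 2 \<le> ?p E" if E: "E \<in> ?B" for E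
  proof -
    define L where "L = real (card (short_cycles m ({..<n}, E)))"
    have R: "regular_graph d ({..<n}, E)" using E by (simp add: reg_edges_def)
    have L: "\<delta> * n \<le> L" using E by (simp add: L_def)
    have "L * L \<le> ?p E + L * meet_bound d m"
      using of_nat_mono[OF short_cycle_pairs[OF R, of m], where 'a = real] by (simp add: L_def)
    \<comment> \<open>The hypothesis on \<open>n\<close> leaves at most half of the pairs to meeting
      cycles.\<close>
    moreover have "L * (2 * meet_bound d m) \<le> L * L" using L n(2) dn by (intro mult_left_mono) auto
    moreover have "(\<delta> * n)\<^sup>2 \<le> L * L" unfolding power2_eq_square using L dn by (intro mult_mono) auto
    ultimately show ?thesis by simp
  qed
  have "card ?B * ((\<delta> * n)\<^sup>2 / 2) = (\<Sum>E\<in>?B. (\<delta> * n)\<^sup>2 / 2)" by simp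
  also have "\<dots> \<le> (\<Sum>E\<in>?B. ?p E)" by (rule sum_mono[OF low])
  also have "\<dots> \<le> (\<Sum>E\<in>reg_edges d n. ?p E)" by (rule sum_mono2) (use finite_reg_edges in auto)
  also have "\<dots> \<le> ?S\<^sup>2 * card (reg_edges d n)" by (rule sum_list_pairs_above[OF d n(1)])
  finally have "card ?B * (\<delta>\<^sup>2 * (real n)\<^sup>2) \<le> 2 * ?S\<^sup>2 * card (reg_edges d n)"
    by (simp add: power_mult_distrib)
  then have "card ?B \<le> 2 * ?S\<^sup>2 * card (reg_edges d n) / (\<delta>\<^sup>2 * (real n)\<^sup>2)"
    using \<delta> n0 by (subst pos_le_divide_eq) auto
  then show ?thesis by (simp add: mult.assoc)
qed

section \<open>Almost sure scarcity of short cycles\<close>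

lemma labelled_eq: "labelled_regular_graphs d n = Pair {..<n} ` reg_edges d n"
  unfolding labelled_regular_graphs_def reg_edges_def by force

lemma random_regular_in_labelled:
  assumes "random_regular_graphs M d G" "n \<in> admissible_orders d" "\<omega> \<in> space M"
  shows "G n \<omega> \<in> labelled_regular_graphs d n"
proof -
  have "G n \<in> measurable M (count_space (labelled_regular_graphs d n))"
    using assms(1,2) unfolding random_regular_graphs_def by auto
  from measurable_space[OF this assms(3)] show ?thesis by simp
qed

lemma random_regular_prob:
  assumes RR: "random_regular_graphs M d G" and n: "n \<in> admissible_orders d"
    and S: "S \<subseteq> labelled_regular_graphs d n"
  shows "{\<omega> \<in> space M. G n \<omega> \<in> S} \<in> sets M"
    "measure M {\<omega> \<in> space M. G n \<omega> \<in> S} = card S / card (labelled_regular_graphs d n)"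
proof -
  let ?N = "count_space (labelled_regular_graphs d n)"
  have me: "G n \<in> measurable M ?N"
    and di: "distr M ?N (G n) = uniform_count_measure (labelled_regular_graphs d n)"
    using RR n unfolding random_regular_graphs_def by auto
  have eq: "{\<omega> \<in> space M. G n \<omega> \<in> S} = G n -` S \<inter> space M" by auto
  show "{\<omega> \<in> space M. G n \<omega> \<in> S} \<in> sets M" unfolding eq using S by (intro measurable_sets[OF me]) auto
  have "measure M {\<omega> \<in> space M. G n \<omega> \<in> S} = measure (distr M ?N (G n)) S"
    unfolding eq using S by (intro measure_distr[symmetric, OF me]) auto
  also have "\<dots> = card S / card (labelled_regular_graphs d n)"
    unfolding di using S finite_reg_edges by (intro measure_uniform_count_measure) (auto simp: labelled_eq)
  finally show "measure M {\<omega> \<in> space M. G n \<omega> \<in> S} = card S / card (labelled_regular_graphs d n)" .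
qed

text \<open>The bad events have probability of order \<open>1 / n^2\<close>, and the convergence
  part of Borel-Cantelli asks for nothing about their joint law. Orders that are not admissible get
  the empty event.\<close>

lemma random_regular_few_short_cycles:
  fixes \<delta> :: real
  assumes RR: "random_regular_graphs M d G" and d: "0 < d" and \<delta>: "0 < \<delta>"
  shows "AE \<omega> in M. eventually (\<lambda>n. n \<in> admissible_orders d \<longrightarrow> card (short_cycles m (G n \<omega>)) < \<delta> * n) sequentially"
proof -
  interpret prob_space M using RR by (simp add: random_regular_graphs_def)
  define bad where "bad n = {H \<in> labelled_regular_graphs d n. \<delta> * n \<le> card (short_cycles m H)}" for n
  define A where "A n = (if n \<in> admissible_orders d then {\<omega> \<in> space M. G n \<omega> \<in> bad n} else {})" for n
  define K where "K = 2 * (\<Sum>k\<le>m. real (2 * d) ^ k)\<^sup>2 / \<delta>\<^sup>2"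
  have K: "0 \<le> K" unfolding K_def by simp
  have sub: "bad n \<subseteq> labelled_regular_graphs d n" for n by (auto simp: bad_def)
  have A: "A n \<in> sets M" for n unfolding A_def using random_regular_prob(1)[OF RR _ sub] by auto
  obtain n1 where n1: "real (2 * meet_bound d m) / \<delta> \<le> real n1" using real_arch_simple by blast
  define n0 where "n0 = max n1 (4 * (d + 1) + 8 * m)"
  have bound: "measure M (A n) \<le> K * (1 / (real n)\<^sup>2)" if n: "n0 \<le> n" for n
  proof (cases "n \<in> admissible_orders d")
    case True
    let ?c = "real (card (reg_edges d n))"
    have "bad n = Pair {..<n} ` {E \<in> reg_edges d n. \<delta> * n \<le> card (short_cycles m ({..<n}, E))}"
      unfolding bad_def labelled_eq by auto
    then have "card (bad n) = card {E \<in> reg_edges d n. \<delta> * n \<le> card (short_cycles m ({..<n}, E))}"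
      by (simp add: card_image inj_on_def)
    moreover have "2 * meet_bound d m \<le> \<delta> * n"
    proof -
      have "real (2 * meet_bound d m) / \<delta> \<le> real n" using n1 n unfolding n0_def by simp
      then show ?thesis using \<delta> by (simp add: pos_divide_le_eq mult.commute)
    qed
    ultimately have cb: "card (bad n) \<le> K * ?c / (real n)\<^sup>2"
      using many_short_cycles_bound[OF d \<delta>, of m n] n unfolding K_def n0_def by simp
    have "measure M (A n) = card (bad n) / ?c"
      using random_regular_prob(2)[OF RR True sub] True unfolding A_def labelled_eq
      by (simp add: card_image inj_on_def)
    also have "\<dots> \<le> K * ?c / (real n)\<^sup>2 / ?c" using cb by (intro divide_right_mono) auto
    \<comment> \<open>An inequality suffices, so the case \<open>?c = 0\<close>, in which the
      quotient is \<open>0\<close>, is included.\<close>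
    also have "\<dots> \<le> K * (1 / (real n)\<^sup>2)" using K by simp
    finally show ?thesis .
  next
    case False
    then show ?thesis using K by (simp add: A_def)
  qed
  have "summable (\<lambda>n. measure M (A n))"
  proof (rule summable_comparison_test_ev)
    show "eventually (\<lambda>n. norm (measure M (A n)) \<le> K * (1 / (real n)\<^sup>2)) sequentially"
      using bound by (auto simp: eventually_sequentially)
    show "summable (\<lambda>n. K * (1 / (real n)\<^sup>2))"
      using inverse_power_summable[of 2, where 'a = real] by (intro summable_mult) (simp add: divide_inverse)
  qed
  then have "AE \<omega> in M. eventually (\<lambda>n. \<omega> \<in> space M - A n) sequentially"
    by (intro borel_cantelli_AE1 A) (auto simp: emeasure_eq_measure)
  then show ?thesis
  proof (rule AE_mp, intro AE_I2 impI)
    fix \<omega> assume w: "\<omega> \<in> space M" and ev: "eventually (\<lambda>n. \<omega> \<in> space M - A n) sequentially"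
    show "eventually (\<lambda>n. n \<in> admissible_orders d \<longrightarrow> card (short_cycles m (G n \<omega>)) < \<delta> * n) sequentially"
    proof (rule eventually_mono[OF ev], intro impI)
      fix n assume n: "\<omega> \<in> space M - A n" "n \<in> admissible_orders d"
      have "G n \<omega> \<in> labelled_regular_graphs d n"
        by (rule random_regular_in_labelled[OF RR n(2) w])
      then show "card (short_cycles m (G n \<omega>)) < \<delta> * n"
        using n unfolding A_def bad_def by force
    qed
  qed
qed

section \<open>The limit of the free energy\<close>

text \<open>The filter is arbitrary so that it can be \<open>sequentially\<close> for a given
  sequence and its restriction to the admissible orders for random graphs.\<close>

lemma (in potts) free_energy_tendsto:
  fixes H :: "nat \<Rightarrow> 'v graph"
  assumes R: "eventually (\<lambda>n. regular_graph d (H n)) Fl"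
    and L: "\<And>g. ((\<lambda>n. num_short_cycles (H n) g / card (verts (H n))) \<longlongrightarrow> 0) Fl"
  shows "((\<lambda>n. 1 / card (verts (H n)) * ln (rc_partition (H n) q w)) \<longlongrightarrow> ln (Phi_max d q w)) Fl"
proof (rule tendstoI)
  fix \<epsilon> :: real assume \<epsilon>: "0 < \<epsilon>"
  obtain g1 g2 and C :: real where est: "\<forall>G :: 'v graph. regular_graph d G \<longrightarrow>
    0 \<le> 1 / card (verts G) * ln (rc_partition G q w) - ln (Phi_max d q w) \<and>
    1 / card (verts G) * ln (rc_partition G q w) - ln (Phi_max d q w) \<le>
      \<epsilon> / 2 + C * (num_short_cycles G g1 / card (verts G)) + C * (num_short_cycles G g2 / card (verts G))"
    using free_energy_estimate[of "\<epsilon> / 2"] \<epsilon> by auto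
  have "((\<lambda>n. \<epsilon> / 2 + C * (num_short_cycles (H n) g1 / card (verts (H n))) + C * (num_short_cycles (H n) g2 / card (verts (H n))))
    \<longlongrightarrow> \<epsilon> / 2 + C * 0 + C * 0) Fl"
    by (intro tendsto_intros L)
  then have "eventually (\<lambda>n. \<epsilon> / 2 + C * (num_short_cycles (H n) g1 / card (verts (H n)))
      + C * (num_short_cycles (H n) g2 / card (verts (H n))) < \<epsilon>) Fl"
    using \<epsilon> by (intro order_tendstoD(2)[of _ "\<epsilon> / 2"]) auto
  with R show "eventually (\<lambda>n. dist (1 / card (verts (H n)) * ln (rc_partition (H n) q w)) (ln (Phi_max d q w)) < \<epsilon>) Fl"
  proof eventually_elim
    case (elim n)
    then show ?case using est[rule_format, OF elim(1)] by (simp add: dist_real_def)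
  qed
qed

lemma num_short_cycles_le:
  assumes "fin_graph (V, E)" shows "num_short_cycles (V, E) g \<le> card (short_cycles (nat g) (V, E))"
  unfolding num_short_cycles_def
proof (rule card_mono)
  show "finite (short_cycles (nat g) (V, E))" unfolding short_cycles_def by (rule finite_short_cycles[OF assms])
qed (auto simp: short_cycles_def)

lemma random_regular_large_girth:
  assumes RR: "random_regular_graphs M d G" and d: "0 < d"
  shows "AE \<omega> in M. \<forall>g. ((\<lambda>n. num_short_cycles (G n \<omega>) g / card (verts (G n \<omega>))) \<longlongrightarrow> 0)
    (inf sequentially (principal (admissible_orders d)))"
proof -
  \<comment> \<open>Countably many lengths \<open>m\<close> and thresholds
    \<open>1 / (j + 1)\<close> suffice, so a single null set serves all \<open>g\<close> and all
    \<open>\<epsilon>\<close>.\<close>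
  have "AE \<omega> in M. \<forall>m j. eventually (\<lambda>n. n \<in> admissible_orders d \<longrightarrow>
      card (short_cycles m (G n \<omega>)) < 1 / real (Suc j) * n) sequentially"
    unfolding AE_all_countable by (intro allI random_regular_few_short_cycles[OF RR d]) simp
  then show ?thesis
  proof (rule AE_mp, intro AE_I2 impI allI)
    fix \<omega> g assume w: "\<omega> \<in> space M" and few: "\<forall>m j. eventually (\<lambda>n. n \<in> admissible_orders d \<longrightarrow>
      card (short_cycles m (G n \<omega>)) < 1 / real (Suc j) * n) sequentially"
    show "((\<lambda>n. num_short_cycles (G n \<omega>) g / card (verts (G n \<omega>))) \<longlongrightarrow> 0)
      (inf sequentially (principal (admissible_orders d)))"
    proof (rule tendstoI)
      fix \<epsilon> :: real assume "0 < \<epsilon>"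
      then obtain j where j: "1 / real (Suc j) < \<epsilon>" using reals_Archimedean by (auto simp: inverse_eq_divide)
      have "eventually (\<lambda>n. n \<in> admissible_orders d \<longrightarrow>
        dist (num_short_cycles (G n \<omega>) g / card (verts (G n \<omega>))) 0 < \<epsilon>) sequentially"
        using few[rule_format, of "nat g" j]
      proof (rule eventually_mono, intro impI)
        fix n assume n: "n \<in> admissible_orders d \<longrightarrow> card (short_cycles (nat g) (G n \<omega>)) < 1 / real (Suc j) * n"
          "n \<in> admissible_orders d"
        have "G n \<omega> \<in> labelled_regular_graphs d n"
          by (rule random_regular_in_labelled[OF RR n(2) w])
        then obtain E where E: "G n \<omega> = ({..<n}, E)" "regular_graph d ({..<n}, E)"
          by (auto simp: labelled_eq reg_edges_def)
        have n0: "0 < n" using n(2) by (auto simp: admissible_orders_def)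
        have "real (num_short_cycles (G n \<omega>) g) \<le> card (short_cycles (nat g) (G n \<omega>))"
          using num_short_cycles_le[of "{..<n}" E g] E by (simp add: regular_graph_def)
        also have "\<dots> < 1 / real (Suc j) * n" using n by blast
        also have "\<dots> < \<epsilon> * n" using j n0 by (intro mult_strict_right_mono) auto
        finally show "dist (num_short_cycles (G n \<omega>) g / card (verts (G n \<omega>))) 0 < \<epsilon>"
          using n0 by (simp add: E(1) dist_real_def pos_divide_less_eq)
      qed
      then show "eventually (\<lambda>n. dist (num_short_cycles (G n \<omega>) g / card (verts (G n \<omega>))) 0 < \<epsilon>)
        (inf sequentially (principal (admissible_orders d)))"
        by (simp add: eventually_inf_principal)
    qed
  qed
qed

theorem theorem1p1:
  fixes d :: nat and q w :: real
  assumes "d > 0" and "q \<ge> 2" and "w \<ge> 0"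
  shows
    "(\<forall>G :: nat \<Rightarrow> 'v graph.
        (\<forall>n. regular_graph d (G n)) \<longrightarrow> essentially_large_girth G \<longrightarrow>
        (\<lambda>n. 1 / real (card (verts (G n))) * ln (rc_partition (G n) q w))
          \<longlonglongrightarrow> ln (Phi_max d q w)) \<and>
     (\<forall>(M :: 'a measure) G.
        random_regular_graphs M d G \<longrightarrow>
        (AE \<omega> in M.
          ((\<lambda>n. 1 / real (card (verts (G n \<omega>))) * ln (rc_partition (G n \<omega>) q w))
            \<longlongrightarrow> ln (Phi_max d q w))
            (inf sequentially (principal (admissible_orders d)))))"
proof -
  interpret potts d q w using assms by unfold_locales auto
  show ?thesis
  proof (intro conjI allI impI)
    fix G :: "nat \<Rightarrow> 'v graph"
    assume "\<forall>n. regular_graph d (G n)" "essentially_large_girth G"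
    then show "(\<lambda>n. 1 / real (card (verts (G n))) * ln (rc_partition (G n) q w)) \<longlonglongrightarrow> ln (Phi_max d q w)"
      by (intro free_energy_tendsto) (auto simp: essentially_large_girth_def)
  next
    fix M :: "'a measure" and G
    assume RR: "random_regular_graphs M d G"
    have reg: "eventually (\<lambda>n. regular_graph d (G n \<omega>)) (inf sequentially (principal (admissible_orders d)))"
      if w: "\<omega> \<in> space M" for \<omega>
    proof -
      have "regular_graph d (G n \<omega>)" if n: "n \<in> admissible_orders d" for n
      proof -
        have "G n \<omega> \<in> labelled_regular_graphs d n"
          by (rule random_regular_in_labelled[OF RR n w])
        then show ?thesis by (simp add: labelled_regular_graphs_def)
      qed
      then show ?thesis by (auto simp: eventually_inf_principal)
    qed
    show "AE \<omega> in M. ((\<lambda>n. 1 / real (card (verts (G n \<omega>))) * ln (rc_partition (G n \<omega>) q w))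
      \<longlongrightarrow> ln (Phi_max d q w)) (inf sequentially (principal (admissible_orders d)))"
      using random_regular_large_girth[OF RR assms(1)]
      by (rule AE_mp, intro AE_I2 impI free_energy_tendsto reg) auto
  qed
qed

end
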